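(* Let $n\ge 1$ and let $(\mathcal{V}_E^n,\mathcal{V}_H^n)$ be a space of pairs $(\mathbf{v},\mathbf{w})$ of piecewise smooth vector fields on $\Omega_h\times I^n$. Then $$B^n(\mathbf{v},\mathbf{w};\mathbf{v},\mathbf{w})\ \ge\ \tfrac12\,|\!|\!|(\mathbf{v},\mathbf{w})|\!|\!|^2_{\Omega\times I^n}\qquad\text{for all }(\mathbf{v},\mathbf{w})\in(\mathcal{V}_E^n,\mathcal{V}_H^n),$$ where $$|\!|\!|(\mathbf{v},\mathbf{w})|\!|\!|^2_{\Omega\times I^n}=\|\epsilon^{1/2}\mathbf{v}(t^n)\|_\Omega^2+\|\mu^{1/2}\mathbf{w}(t^n)\|_\Omega^2+\|\epsilon^{1/2}\mathbf{v}(t^{n-1})\|_\Omega^2+\|\mu^{1/2}\mathbf{w}(t^{n-1})\|_\Omega^2+2\beta\|\mathbf{n}\times\mathbf{w}\|^2_{\partial\Omega\times I^n}$$ and $B^n$ is the bilinear form defined in the context.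
   Context: Setting. $\Omega\subset\mathbb{R}^3$ is a bounded polyhedral Lipschitz domain and $\Omega_h=\{K\}$ is a non-overlapping partition of $\Omega$ into finitely many simple regular polyhedral elements $K$ (tetrahedra, parallelepipeds, prisms, etc.). Interior interfaces are $f=\partial K_1\cap\partial K_2$, $K_1\neq K_2\in\Omega_h$, and boundary faces are $f=\partial K\cap\partial\Omega$. $0=t^0<t^1<\dots<t^N=T$ and $I^n=[t^{n-1},t^n]$. The material parameters $\epsilon,\mu>0$ are time-independent and constant on each element $K$; $\beta\ge 0$ is a constant. $\mathbf{n}$ denotes the outward unit normal on $\partial K$ or on $\partial\Omega$. $\|\cdot\|_D$ is the $L^2(D)$-norm. A vector field on $\Omega_h\times I^n$ is piecewise smooth if its restriction to each $K\times I^n$ is smooth up to the boundary; no continuity between elements is required. On an interface $f=\partial K_1\cap\partial K_2$ with traces $\mathbf{E}_1,\mathbf{E}_2$ from $K_1,K_2$, $\{\mathbf{E}\}=\frac12(\mathbf{E}_1+\mathbf{E}_2)$. Bilinear form. For piecewise smooth arguments, $$B^n(\mathbf{E},\mathbf{H};\mathbf{v},\mathbf{w})=\sum_{K\in\Omega_h}\int_{K\times I^n}(\epsilon\partial_t\mathbf{E}-\mathrm{curl}\,\mathbf{H})\cdot\mathbf{v}+(\mu\partial_t\mathbf{H}+\mathrm{curl}\,\mathbf{E})\cdot\mathbf{w}$$ $$+\sum_{K\in\Omega_h}\int_K\epsilon\mathbf{E}(t^{n-1})\cdot\mathbf{v}(t^{n-1})+\mu\mathbf{H}(t^{n-1})\cdot\mathbf{w}(t^{n-1})$$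 $$+\sum_{K\in\Omega_h}\int_{\partial K\times I^n}\mathbf{n}\times(\mathbf{H}-\mathbf{H}^* )\cdot\mathbf{v}-\mathbf{n}\times(\mathbf{E}-\mathbf{E}^* )\cdot\mathbf{w}.$$ The numerical fluxes are $\mathbf{E}^*=\{\mathbf{E}\}$, $\mathbf{H}^*=\{\mathbf{H}\}$ on interior interfaces, and on boundary faces $\mathbf{H}^*=\mathbf{H}$ and $\mathbf{E}^*=\beta\,\mathbf{H}\times\mathbf{n}$ (so $\mathbf{n}\times\mathbf{E}^*=\beta\,\mathbf{n}\times(\mathbf{H}\times\mathbf{n})$). *)

theory Defs
  imports "HOL-Analysis.Analysis"
begin

unbundle no cross3_syntax
unbundle set_product_syntax
notation cross3 (infixr \<open>\<times>\<^sub>3\<close> 80)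

type_synonym point = "real ^ 3"

text \<open>In the cylinder of radius \<open>r\<close> and half-height \<open>h\<close> around a boundary point \<open>p\<close> with axis \<open>e\<close>,
  the domain is the subgraph of a Lipschitz function on the plane orthogonal to \<open>e\<close>.\<close>

definition lipschitz_boundary :: "point set \<Rightarrow> bool" where
  "lipschitz_boundary U \<longleftrightarrow>
     (\<forall>p\<in>frontier U. \<exists>e \<phi> L r h. norm e = 1 \<and> r > 0 \<and> h > 0 \<and>
        L-lipschitz_on {y. y \<bullet> e = 0} \<phi> \<and>
        (\<forall>x. let s = (x - p) \<bullet> e; y = (x - p) - s *\<^sub>R e
             in norm y < r \<and> \<bar>s\<bar> < h \<longrightarrow> (x \<in> U \<longleftrightarrow> s < \<phi> y)))"

definition polyhedral_lipschitz_domain :: "point set \<Rightarrow> bool" where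
  "polyhedral_lipschitz_domain U \<longleftrightarrow>
     open U \<and> connected U \<and> U \<noteq> {} \<and> bounded U \<and> lipschitz_boundary U \<and>
     (\<exists>\<P>. finite \<P> \<and> (\<forall>P\<in>\<P>. polytope P) \<and> closure U = \<Union>\<P>)"

text \<open>Elements are closed sets. Nothing is assumed about how they meet, so hanging nodes are
  allowed, and they need not be convex.\<close>

definition polyhedral_element :: "point set \<Rightarrow> bool" where
  "polyhedral_element K \<longleftrightarrow> polyhedral_lipschitz_domain (interior K) \<and> closure (interior K) = K"

definition polyhedral_partition :: "point set \<Rightarrow> point set set \<Rightarrow> bool" where
  "polyhedral_partition \<Omega> \<Omega>h \<longleftrightarrow>
     finite \<Omega>h \<and> (\<forall>K\<in>\<Omega>h. polyhedral_element K) \<and> \<Union>\<Omega>h = closure \<Omega> \<and>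
     (\<forall>K\<in>\<Omega>h. \<forall>K'\<in>\<Omega>h. K \<noteq> K' \<longrightarrow> interior K \<inter> interior K' = {})"

text \<open>Defined at the points near which the set is a half-space, which for a polyhedral Lipschitz
  domain is all of the boundary except finitely many segments.\<close>

definition outer_normal :: "point set \<Rightarrow> point \<Rightarrow> point" where
  "outer_normal S x = (THE n. norm n = 1 \<and>
     (\<exists>r>0. closure S \<inter> ball x r = {y \<in> ball x r. n \<bullet> (y - x) \<le> 0}))"

text \<open>Area measure of a plane: the image of Lebesgue measure on \<open>\<real>\<^sup>2\<close> under an isometric
  parametrization, the choice of which is immaterial.\<close>

definition plane_area :: "point set \<Rightarrow> point measure" where
  "plane_area P = distr (lborel :: (real ^ 2) measure) borel
     (SOME \<psi>. (\<forall>x y. dist (\<psi> x) (\<psi> y) = dist x y) \<and> range \<psi> = P)"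

text \<open>The planes that contain a two-dimensional piece of \<open>S\<close>. For the boundary \<open>S\<close> of a polyhedral
  domain there are finitely many, they cover \<open>S\<close>, and any two overlap in a null set, so that the
  area integral over \<open>S\<close> is the sum of the area integrals over the parts of \<open>S\<close> in these planes.\<close>

definition face_planes :: "point set \<Rightarrow> point set set" where
  "face_planes S = {P. affine P \<and> aff_dim P = 2 \<and> emeasure (plane_area P) S \<noteq> 0}"

definition surface_time_integral ::
    "point set \<Rightarrow> real set \<Rightarrow> (point \<times> real \<Rightarrow> real) \<Rightarrow> real" where
  "surface_time_integral S I g =
     (\<Sum>P\<in>face_planes S. LINT z:(S \<times> I)|(plane_area P \<Otimes>\<^sub>M lborel). g z)"

text \<open>Smoothness up to the boundary: on \<open>D\<close>, the closure of a Lipschitz domain, derivatives relative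
  to \<open>D\<close> are unique, and at boundary points they are the continuous extensions of the
  derivatives in the interior.\<close>

primrec Ck_on :: "nat \<Rightarrow> 'a::real_normed_vector set \<Rightarrow> ('a \<Rightarrow> 'b::real_normed_vector) \<Rightarrow> bool" where
  "Ck_on 0 D f = continuous_on D f"
| "Ck_on (Suc k) D f =
     ((\<forall>z\<in>D. f differentiable (at z within D)) \<and>
      (\<forall>d. Ck_on k D (\<lambda>z. frechet_derivative f (at z within D) d)))"

definition smooth_on :: "'a::real_normed_vector set \<Rightarrow> ('a \<Rightarrow> 'b::real_normed_vector) \<Rightarrow> bool" where
  "smooth_on D f \<longleftrightarrow> (\<forall>k. Ck_on k D f)"

text \<open>A field on the partition is two-valued on interfaces, so it is represented by the family of its
  restrictions: \<open>v K (x, t)\<close> is the value at \<open>(x, t)\<close> of the restriction of \<open>v\<close> to the element \<open>K\<close>,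
  and its trace from \<open>K\<close> if \<open>x \<in> frontier K\<close>. Values outside of \<open>K \<times> I\<close> are irrelevant.\<close>

type_synonym field = "point set \<Rightarrow> point \<times> real \<Rightarrow> real ^ 3"

definition piecewise_smooth :: "point set set \<Rightarrow> real set \<Rightarrow> field \<Rightarrow> bool" where
  "piecewise_smooth \<Omega>h I v \<longleftrightarrow> (\<forall>K\<in>\<Omega>h. smooth_on (K \<times> I) (v K))"

definition piecewise_smooth_space :: "point set set \<Rightarrow> real set \<Rightarrow> (field \<times> field) set \<Rightarrow> bool" where
  "piecewise_smooth_space \<Omega>h I V \<longleftrightarrow>
     (\<forall>(v, w)\<in>V. piecewise_smooth \<Omega>h I v \<and> piecewise_smooth \<Omega>h I w) \<and>
     V \<noteq> {} \<and>
     (\<forall>(v, w)\<in>V. \<forall>(v', w')\<in>V. \<forall>a b.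
        ((\<lambda>K z. a *\<^sub>R v K z + b *\<^sub>R v' K z), (\<lambda>K z. a *\<^sub>R w K z + b *\<^sub>R w' K z)) \<in> V)"

definition dt :: "(point \<times> real) set \<Rightarrow> (point \<times> real \<Rightarrow> real ^ 3) \<Rightarrow> point \<times> real \<Rightarrow> real ^ 3" where
  "dt D F z = frechet_derivative F (at z within D) (0, 1)"

definition dx :: "(point \<times> real) set \<Rightarrow> 3 \<Rightarrow> (point \<times> real \<Rightarrow> real ^ 3) \<Rightarrow> point \<times> real \<Rightarrow> real ^ 3" where
  "dx D j F z = frechet_derivative F (at z within D) (axis j 1, 0)"

definition curl :: "(point \<times> real) set \<Rightarrow> (point \<times> real \<Rightarrow> real ^ 3) \<Rightarrow> point \<times> real \<Rightarrow> real ^ 3" where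
  "curl D F z = vector [dx D 2 F z $ 3 - dx D 3 F z $ 2,
                        dx D 3 F z $ 1 - dx D 1 F z $ 3,
                        dx D 1 F z $ 2 - dx D 2 F z $ 1]"

text \<open>The element on the other side of the interface; the choice matters only on edges,
  which have area zero.\<close>

definition neighbour :: "point set set \<Rightarrow> point set \<Rightarrow> point \<Rightarrow> point set" where
  "neighbour \<Omega>h K x = (SOME K'. K' \<in> \<Omega>h \<and> K' \<noteq> K \<and> x \<in> frontier K')"

definition average :: "point set set \<Rightarrow> field \<Rightarrow> field" where
  "average \<Omega>h F K = (\<lambda>(x, s). (1 / 2) *\<^sub>R (F K (x, s) + F (neighbour \<Omega>h K x) (x, s)))"

definition flux_E :: "point set \<Rightarrow> point set set \<Rightarrow> real \<Rightarrow> field \<Rightarrow> field \<Rightarrow> field" where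
  "flux_E \<Omega> \<Omega>h \<beta> E H K = (\<lambda>(x, s).
     if x \<in> frontier \<Omega> then \<beta> *\<^sub>R (H K (x, s) \<times>\<^sub>3 outer_normal K x) else average \<Omega>h E K (x, s))"

definition flux_H :: "point set \<Rightarrow> point set set \<Rightarrow> field \<Rightarrow> field" where
  "flux_H \<Omega> \<Omega>h H K = (\<lambda>(x, s).
     if x \<in> frontier \<Omega> then H K (x, s) else average \<Omega>h H K (x, s))"

text \<open>The form on the time slab from \<open>a\<close> to \<open>b\<close>. The material parameters are constant on each
  element, hence functions of the element.\<close>

definition dg_form ::
    "point set \<Rightarrow> point set set \<Rightarrow> (point set \<Rightarrow> real) \<Rightarrow> (point set \<Rightarrow> real) \<Rightarrow> real \<Rightarrow> real \<Rightarrow> real \<Rightarrow>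
     field \<Rightarrow> field \<Rightarrow> field \<Rightarrow> field \<Rightarrow> real" where
  "dg_form \<Omega> \<Omega>h \<epsilon> \<mu> \<beta> a b E H v w =
     (\<Sum>K\<in>\<Omega>h. let D = K \<times> {a..b} in LINT z:D|lborel.
        (\<epsilon> K *\<^sub>R dt D (E K) z - curl D (H K) z) \<bullet> v K z +
        (\<mu> K *\<^sub>R dt D (H K) z + curl D (E K) z) \<bullet> w K z)
   + (\<Sum>K\<in>\<Omega>h. LINT x:K|lborel.
        \<epsilon> K * (E K (x, a) \<bullet> v K (x, a)) + \<mu> K * (H K (x, a) \<bullet> w K (x, a)))
   + (\<Sum>K\<in>\<Omega>h. surface_time_integral (frontier K) {a..b} (\<lambda>(x, s).
        (outer_normal K x \<times>\<^sub>3 (H K (x, s) - flux_H \<Omega> \<Omega>h H K (x, s))) \<bullet> v K (x, s) -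
        (outer_normal K x \<times>\<^sub>3 (E K (x, s) - flux_E \<Omega> \<Omega>h \<beta> E H K (x, s))) \<bullet> w K (x, s)))"

text \<open>The element containing \<open>x\<close>, unique up to a null set of \<open>\<Omega>\<close>, and of \<open>frontier \<Omega>\<close> with
  respect to area.\<close>

definition element_at :: "point set set \<Rightarrow> point \<Rightarrow> point set" where
  "element_at \<Omega>h x = (SOME K. K \<in> \<Omega>h \<and> x \<in> K)"

definition L2_norm_on :: "point set \<Rightarrow> (point \<Rightarrow> real ^ 3) \<Rightarrow> real" where
  "L2_norm_on S f = sqrt (LINT x:S|lborel. (norm (f x))\<^sup>2)"

definition L2_norm_surface_time :: "point set \<Rightarrow> real set \<Rightarrow> (point \<times> real \<Rightarrow> real ^ 3) \<Rightarrow> real" where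
  "L2_norm_surface_time S I g = sqrt (surface_time_integral S I (\<lambda>z. (norm (g z))\<^sup>2))"

definition weighted_trace ::
    "point set set \<Rightarrow> (point set \<Rightarrow> real) \<Rightarrow> field \<Rightarrow> real \<Rightarrow> point \<Rightarrow> real ^ 3" where
  "weighted_trace \<Omega>h c v s x = (let K = element_at \<Omega>h x in sqrt (c K) *\<^sub>R v K (x, s))"

definition dg_norm_sq ::
    "point set \<Rightarrow> point set set \<Rightarrow> (point set \<Rightarrow> real) \<Rightarrow> (point set \<Rightarrow> real) \<Rightarrow> real \<Rightarrow> real \<Rightarrow> real \<Rightarrow>
     field \<Rightarrow> field \<Rightarrow> real" where
  "dg_norm_sq \<Omega> \<Omega>h \<epsilon> \<mu> \<beta> a b v w =
     (L2_norm_on \<Omega> (weighted_trace \<Omega>h \<epsilon> v b))\<^sup>2 +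
     (L2_norm_on \<Omega> (weighted_trace \<Omega>h \<mu> w b))\<^sup>2 +
     (L2_norm_on \<Omega> (weighted_trace \<Omega>h \<epsilon> v a))\<^sup>2 +
     (L2_norm_on \<Omega> (weighted_trace \<Omega>h \<mu> w a))\<^sup>2 +
     2 * \<beta> * (L2_norm_surface_time (frontier \<Omega>) {a..b}
               (\<lambda>(x, s). outer_normal \<Omega> x \<times>\<^sub>3 w (element_at \<Omega>h x) (x, s)))\<^sup>2"

end

theory Submission
  imports Defs
begin

text \<open>
  Testing the form with its own argument, the time derivatives integrate to half the difference of
  the energies at the two ends of the time slab, and
  \<open>curl v \<bullet> w - curl w \<bullet> v = div (v \<times> w)\<close> turns the curl terms into integrals of
  \<open>n \<bullet> (v \<times> w)\<close> over the element boundaries. There they cancel against the central fluxes: the two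
  sides of an interface contribute opposite values, and a boundary face retains
  \<open>\<beta> |n \<times> w|\<^sup>2\<close>. So the inequality is in fact an equality.

  For the divergence theorem on an element \<open>K\<close>, recall that \<open>K\<close> is the closure of its interior and
  that its boundary lies in finitely many planes. Almost every line in a coordinate direction \<open>j\<close>
  meets these planes transversally in distinct points, so that it meets \<open>K\<close> in finitely many
  intervals, whose end points carry the sign of the \<open>j\<close>-th component of the outer normal; and
  projecting a plane along direction \<open>j\<close> scales area by the absolute value of that component of its
  normal.
\<close>

subsection \<open>The fundamental theorem of calculus on finite unions of intervals\<close>

text \<open>A single finite family of planes covers the boundaries of all elements and of the
  domain. Almost every point of one of these planes, with respect to area, lies in no other plane of
  the family. In a small ball around such a point, an element containing it is either everything or
  one closed half-ball. Hence no combinatorics of faces is needed: normals and neighbours are read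
  off from half-balls, hanging nodes and non-convex elements cause no further cases, and edges and
  corners disappear in null sets. The other obstacle is measurability. Outer normals, neighbours and
  the element containing a point are descriptions or choices, with some value at exceptional points
  too, while every separate surface term has to be integrable before terms of different elements can
  be combined. The normal is therefore treated as locally constant off a Borel exceptional set, and
  the choices as constant on finitely many Borel pieces.\<close>

text \<open>The one-dimensional trace of an outer normal: near a boundary point the set is the
  half-line that \<open>\<sigma>\<close> points out of, which excludes isolated points and
  punctures. Only the sign of \<open>\<sigma>\<close> matters, so a component of a unit normal can
  be inserted without rescaling.\<close>

definition one_sided :: "real set \<Rightarrow> (real \<Rightarrow> real) \<Rightarrow> bool" where
  "one_sided A \<sigma> \<longleftrightarrow> (\<forall>s\<in>frontier A. \<sigma> s \<noteq> 0 \<and> (\<exists>r>0. \<forall>x. \<bar>x - s\<bar> < r \<longrightarrow> (x \<in> A \<longleftrightarrow> \<sigma> s * (x - s) \<le> 0)))"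

text \<open>All balls in the straddling description of the frontier may be shrunk below
  \<open>r\<close>. It serves to compare boundaries before and after an interval is cut off.\<close>

lemma frontier_local:
  fixes A B :: "'a::metric_space set"
  assumes "r > 0" "\<And>y. dist y x < r \<Longrightarrow> y \<in> A \<longleftrightarrow> y \<in> B"
  shows "x \<in> frontier A \<longleftrightarrow> x \<in> frontier B"
proof -
  have "x \<in> frontier B" if "x \<in> frontier A" "\<And>y. dist y x < r \<Longrightarrow> y \<in> A \<longleftrightarrow> y \<in> B" for A B
    unfolding frontier_straddle mem_Collect_eq
  proof (intro allI impI)
    fix e :: real assume "e > 0"
    with \<open>r > 0\<close> have "min e r > 0" by simp
    then have "(\<exists>y\<in>A. dist x y < min e r) \<and> (\<exists>y. y \<notin> A \<and> dist x y < min e r)"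
      using that(1) unfolding frontier_straddle by blast
    then show "(\<exists>y\<in>B. dist x y < e) \<and> (\<exists>y. y \<notin> B \<and> dist x y < e)"
      using that(2) by (metis dist_commute min_less_iff_conj)
  qed
  then show ?thesis using assms(2) by blast
qed

text \<open>Induction on the number of boundary points, splitting off the rightmost component \<open>{p..m}\<close>.\<close>

lemma integral_derivative_one_sided:
  fixes f f' :: "real \<Rightarrow> real"
  assumes "compact A" "finite (frontier A)" "one_sided A \<sigma>"
    and "continuous_on A f" "continuous_on A f'"
    and "\<And>x. x \<in> interior A \<Longrightarrow> (f has_real_derivative f' x) (at x)"
  shows "(LINT x:A|lborel. f' x) = (\<Sum>s\<in>frontier A. sgn (\<sigma> s) * f s)"
  using assms
proof (induction "card (frontier A)" arbitrary: A rule: less_induct)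
  case less
  show ?case
  proof (cases "A = {}")
    case True
    then show ?thesis by (simp add: set_lebesgue_integral_def)
  next
    case False
    define m where "m = Sup A"
    have bd: "bdd_above A" "bdd_below A" and clA: "closed A"
      using less.prems(1) by (auto simp: compact_eq_bounded_closed bounded_imp_bdd_above bounded_imp_bdd_below)
    have mA: "m \<in> A" unfolding m_def using False bd clA by (simp add: closed_contains_Sup)
    have le_m: "x \<le> m" if "x \<in> A" for x unfolding m_def using that bd by (simp add: cSup_upper)
    have fr_iff: "s \<in> frontier A \<longleftrightarrow> s \<in> A \<and> (\<forall>e>0. \<exists>y. y \<notin> A \<and> dist s y < e)" for s
    proof -
      have "s \<in> A" if "s \<in> frontier A" using clA that frontier_subset_closed by blast
      moreover have "s \<in> frontier A \<longleftrightarrow> (\<forall>e>0. (\<exists>y\<in>A. dist s y < e) \<and> (\<exists>y. y \<notin> A \<and> dist s y < e))"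
        unfolding frontier_straddle by blast
      moreover have "\<exists>y\<in>A. dist s y < e" if "s \<in> A" "e > 0" for e
        using that by (intro bexI[of _ s]) auto
      ultimately show ?thesis by blast
    qed
    have mfr: "m \<in> frontier A"
      unfolding fr_iff
    proof (intro conjI allI impI mA)
      fix e :: real assume "e > 0"
      then have "m + e/2 \<notin> A" "dist m (m + e/2) < e" using le_m[of "m + e/2"] by (auto simp: dist_real_def)
      then show "\<exists>y. y \<notin> A \<and> dist m y < e" by blast
    qed
    have os: "\<sigma> s \<noteq> 0 \<and> (\<exists>r>0. \<forall>x. \<bar>x - s\<bar> < r \<longrightarrow> (x \<in> A \<longleftrightarrow> \<sigma> s * (x - s) \<le> 0))"
      if "s \<in> frontier A" for s using less.prems(3) that unfolding one_sided_def by blast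
    obtain r where r: "r > 0" "\<And>x. \<bar>x - m\<bar> < r \<Longrightarrow> (x \<in> A \<longleftrightarrow> \<sigma> m * (x - m) \<le> 0)"
      using os[OF mfr] by blast
    \<comment> \<open>Otherwise points to the right of the maximum \<open>m\<close> would belong to
      \<open>A\<close>.\<close>
    have sm: "\<sigma> m > 0"
    proof (rule ccontr)
      assume "\<not> ?thesis"
      then have "\<sigma> m * ((m + r/2) - m) \<le> 0" using r(1) by (simp add: mult_nonpos_nonneg)
      then have "m + r/2 \<in> A" using r by auto
      then show False using le_m[of "m + r/2"] r(1) by auto
    qed
    have left: "x \<in> A" if "m - r < x" "x \<le> m" for x
      using r that sm by (auto simp: mult_nonneg_nonpos)
    define Q where "Q = frontier A - {m}"
    have i_fr: "Inf A \<in> frontier A"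
      unfolding fr_iff
    proof (intro conjI allI impI)
      show "Inf A \<in> A" using False bd clA by (simp add: closed_contains_Inf)
      fix e :: real assume "e > 0"
      then have "Inf A - e/2 \<notin> A" "dist (Inf A) (Inf A - e/2) < e"
        using cInf_lower[OF _ bd(2), of "Inf A - e/2"] by (auto simp: dist_real_def)
      then show "\<exists>y. y \<notin> A \<and> dist (Inf A) y < e" by blast
    qed
    \<comment> \<open>There are points of \<open>A\<close> to the left of \<open>m\<close>, so the
      infimum is a second boundary point and \<open>Q\<close> is nonempty.\<close>
    have "m - r/2 \<in> A" using left[of "m - r/2"] r(1) by simp
    then have "Inf A \<le> m - r/2" using bd cInf_lower by blast
    then have "Inf A \<noteq> m" using r(1) by auto
    then have Qne: "Q \<noteq> {}" "finite Q" using i_fr less.prems(2) by (auto simp: Q_def)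
    define p where "p = Max Q"
    have pQ: "p \<in> Q" and p_max: "\<And>q. q \<in> Q \<Longrightarrow> q \<le> p" using Qne by (auto simp: p_def)
    then have pfr: "p \<in> frontier A" and pA: "p \<in> A" and pm: "p < m"
      using fr_iff le_m by (force simp: Q_def)+
    have mid: "{p<..<m} \<subseteq> A"
    proof (rule ccontr)
      assume "\<not> ?thesis"
      then have "{p<..<m} - A \<noteq> {}" by blast
      \<comment> \<open>A witness in \<open>A\<close> between \<open>p\<close> and \<open>m\<close>:
        the midpoint keeps it to the right of \<open>p\<close>, and \<open>m - r/2\<close> keeps it
        in the range where \<open>left\<close> applies.\<close>
      moreover have "max ((p+m)/2) (m - r/2) \<in> {p<..<m} \<inter> A"
        using pm r(1) left[of "max ((p+m)/2) (m - r/2)"] by (auto simp: max_def)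
      then have "{p<..<m} \<inter> A \<noteq> {}" by blast
      ultimately have "{p<..<m} \<inter> frontier A \<noteq> {}"
        by (intro connected_Int_frontier connected_Ioo)
      then obtain q where "q \<in> frontier A" "p < q" "q < m" by auto
      then show False using p_max[of q] by (auto simp: Q_def)
    qed
    then have pmA: "{p..m} \<subseteq> A" using pA mA
      by (metis greaterThanLessThan_iff less_eq_real_def subset_eq atLeastAtMost_iff)
    obtain r2 where r2: "r2 > 0" "\<And>x. \<bar>x - p\<bar> < r2 \<Longrightarrow> (x \<in> A \<longleftrightarrow> \<sigma> p * (x - p) \<le> 0)"
      using os[OF pfr] by blast
    have sp: "\<sigma> p < 0"
    proof (rule ccontr)
      assume "\<not> ?thesis"
      then have "\<sigma> p > 0" using os[OF pfr] by auto
      define x where "x = min (p + r2/2) m"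
      have x: "p < x" "\<bar>x - p\<bar> < r2" "x \<in> A" using r2(1) pm pmA by (auto simp: x_def min_def)
      then have "\<sigma> p * (x - p) \<le> 0" using r2(2) by blast
      then show False using x(1) \<open>\<sigma> p > 0\<close> by (simp add: mult_le_0_iff)
    qed
    have out: "x \<notin> A" if "p - r2 < x" "x < p" for x
    proof
      assume "x \<in> A"
      then have "\<sigma> p * (x - p) \<le> 0" using r2(2)[of x] that by auto
      then show False using sp that by (simp add: mult_le_0_iff)
    qed
    \<comment> \<open>By \<open>out\<close> there is a gap of length at least \<open>r2\<close> to
      the left of \<open>p\<close>. Cutting at \<open>p - r2\<close> with a closed half-line
      therefore loses nothing and keeps \<open>A'\<close> compact.\<close>
    define A' where "A' = A \<inter> {..p - r2}"
    have A_eq: "A = A' \<union> {p..m}" and disj: "A' \<inter> {p..m} = {}"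
      using pmA le_m out r2(1) by (force simp: A'_def)+
    have cA': "compact A'" unfolding A'_def by (intro compact_Int_closed less.prems(1)) auto
    have fr': "frontier A' = frontier A - {p, m}"
    proof (intro set_eqI iffI)
      fix s assume s: "s \<in> frontier A'"
      then have sA': "s \<in> A'" using cA' frontier_subset_closed compact_imp_closed by blast
      then have "s < p" using r2(1) by (auto simp: A'_def)
      then have "s \<in> frontier A' \<longleftrightarrow> s \<in> frontier A"
        by (intro frontier_local[of "p - s"]) (auto simp: A_eq dist_real_def)
      then show "s \<in> frontier A - {p, m}" using s \<open>s < p\<close> pm by auto
    next
      fix s assume s: "s \<in> frontier A - {p, m}"
      then have "s \<in> Q" by (auto simp: Q_def)
      then have "s < p" using p_max[of s] s by auto
      then have "s \<in> frontier A' \<longleftrightarrow> s \<in> frontier A"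
        by (intro frontier_local[of "p - s"]) (auto simp: A_eq dist_real_def)
      then show "s \<in> frontier A'" using s by auto
    qed
    have osA': "one_sided A' \<sigma>"
      unfolding one_sided_def
    proof (intro ballI conjI)
      fix s assume s: "s \<in> frontier A'"
      then have "s \<in> A'" using cA' frontier_subset_closed compact_imp_closed by blast
      then have sp': "s < p" using r2(1) by (auto simp: A'_def)
      have sA: "s \<in> frontier A" using s fr' by auto
      then show "\<sigma> s \<noteq> 0" using os by blast
      obtain r3 where r3: "r3 > 0" "\<forall>x. \<bar>x - s\<bar> < r3 \<longrightarrow> (x \<in> A \<longleftrightarrow> \<sigma> s * (x - s) \<le> 0)"
        using os[OF sA] by blast
      have "\<forall>x. \<bar>x - s\<bar> < min r3 (p - s) \<longrightarrow> (x \<in> A' \<longleftrightarrow> \<sigma> s * (x - s) \<le> 0)"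
        using r3(2) by (auto simp: A_eq)
      then show "\<exists>r>0. \<forall>x. \<bar>x - s\<bar> < r \<longrightarrow> (x \<in> A' \<longleftrightarrow> \<sigma> s * (x - s) \<le> 0)"
        using r3(1) sp' by (intro exI[of _ "min r3 (p - s)"]) auto
    qed
    have "card (frontier A') < card (frontier A)"
      unfolding fr' using mfr less.prems(2) by (intro psubset_card_mono) auto
    then have IH: "(LINT x:A'|lborel. f' x) = (\<Sum>s\<in>frontier A'. sgn (\<sigma> s) * f s)"
    proof (rule less.hyps)
      show "finite (frontier A')" using fr' less.prems(2) by auto
      show "continuous_on A' f" "continuous_on A' f'" using less.prems(4,5) continuous_on_subset
        unfolding A'_def by blast+
      show "(f has_real_derivative f' x) (at x)" if "x \<in> interior A'" for x
        using less.prems(6) interior_mono[of A' A] that unfolding A'_def by blast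
    qed (fact cA' osA')+
    have int: "set_integrable lborel B f'" if "compact B" "B \<subseteq> A" for B
      unfolding set_integrable_def using that less.prems(5) continuous_on_subset
      by (blast intro: borel_integrable_compact)
    have FTC: "(f' has_integral f m - f p) {p..m}"
    proof (rule fundamental_theorem_of_calculus_interior)
      show "continuous_on {p..m} f" using less.prems(4) pmA continuous_on_subset by blast
      fix x assume x: "x \<in> {p<..<m}"
      then have "x \<in> interior A" using mid interior_maximal[of "{p<..<m}" A] by auto
      then show "(f has_vector_derivative f' x) (at x)"
        using less.prems(6) has_real_derivative_iff_has_vector_derivative by blast
    qed (use pm in simp)
    have "(LINT x:A|lborel. f' x) = (LINT x:A'|lborel. f' x) + (LINT x:{p..m}|lborel. f' x)"
      by (subst A_eq) (intro set_integral_Un disj int cA' pmA compact_Icc, auto simp: A'_def)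
    also have "(LINT x:{p..m}|lborel. f' x) = f m - f p"
      using set_borel_integral_eq_integral(2)[OF int[OF compact_Icc pmA]] FTC integral_unique by metis
    finally have split: "(LINT x:A|lborel. f' x) = (LINT x:A'|lborel. f' x) + (f m - f p)" .
    have "(\<Sum>s\<in>frontier A. sgn (\<sigma> s) * f s) = (\<Sum>s\<in>frontier A'. sgn (\<sigma> s) * f s) + (f m - f p)"
    proof -
      have eq: "frontier A = insert p (insert m (frontier A'))" and "p \<notin> insert m (frontier A')" "m \<notin> frontier A'"
        using fr' pfr mfr pm by auto
      moreover have "finite (frontier A')" using fr' less.prems(2) by auto
      ultimately show ?thesis unfolding eq using sp sm by (simp add: sgn_if)
    qed
    with split IH show ?thesis by simp
  qed
qed

subsection \<open>Area on planes\<close>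

text \<open>The change of variables formula as an equality of measures, so that it can be
  substituted into an integral. It suffices to compare boxes; the preimage of a box is a set of
  finite measure, to which the formula for the measure of a linear image applies.\<close>

lemma lborel_affine_matrix:
  fixes M :: "real ^ 'n::{finite,wellorder} \<Rightarrow> real ^ 'n::_" and q :: "real ^ 'n::_"
  assumes "linear M" and "det (matrix M) \<noteq> 0"
  shows "lborel = density (distr lborel borel (\<lambda>y. q + M y)) (\<lambda>_. ennreal \<bar>det (matrix M)\<bar>)"
proof (rule lborel_eqI)
  let ?T = "\<lambda>y. q + M y" and ?d = "\<bar>det (matrix M)\<bar>"
  obtain N where N: "linear N" "\<And>x. N (M x) = x" "\<And>x. M (N x) = x"
    using assms det_nz_iff_inj[OF assms(1)] linear_injective_isomorphism[of M] by blast
  have T[measurable]: "?T \<in> borel_measurable lborel"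
    using assms(1) linear_continuous_on[of M UNIV] linear_conv_bounded_linear
    by (intro borel_measurable_add) (auto intro: borel_measurable_continuous_onI)
  fix l u :: "real ^ 'n::_" assume lu: "\<And>b. b \<in> Basis \<Longrightarrow> l \<bullet> b \<le> u \<bullet> b"
  define S where "S = ?T -` box l u"
  have "S = N ` ((+) (- q) ` box l u)"
    unfolding S_def image_image
  proof (intro set_eqI iffI)
    fix x assume "x \<in> ?T -` box l u"
    then show "x \<in> (\<lambda>x. N (- q + x)) ` box l u"
      by (intro image_eqI[of _ _ "q + M x"]) (auto simp: N(2))
  next
    fix x assume "x \<in> (\<lambda>x. N (- q + x)) ` box l u"
    then show "x \<in> ?T -` box l u" by (auto simp: N(3))
  qed
  then have S: "S \<in> lmeasurable"
    using N(1) by (metis lmeasurable_box measurable_linear_image measurable_translation)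
  have "(+) q ` (M ` S) = box l u"
    unfolding image_image S_def
  proof (intro set_eqI iffI)
    fix x assume "x \<in> box l u"
    then show "x \<in> (\<lambda>x. q + M x) ` (\<lambda>y. q + M y) -` box l u"
      by (intro image_eqI[of _ _ "N (x - q)"]) (auto simp: N(3))
  qed auto
  then have "measure lebesgue (box l u) = measure lebesgue (M ` S)"
    by (metis measure_translation)
  also have "\<dots> = ?d * measure lebesgue S"
    using assms(1) S by (rule measure_linear_image)
  finally have eq: "measure lebesgue (box l u) = ?d * measure lebesgue S" .
  have Sb: "S \<in> sets borel"
    unfolding S_def using measurable_sets[OF T, of "box l u"] by simp
  have "emeasure (density (distr lborel borel ?T) (\<lambda>_. ennreal ?d)) (box l u)
      = ennreal ?d * emeasure lborel S"
    by (simp add: emeasure_density_const emeasure_distr S_def)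
  also have "emeasure lborel S = ennreal (measure lebesgue S)"
    using emeasure_eq_measure2[OF S] emeasure_completion[of S lborel] Sb by simp
  also have "ennreal ?d * ennreal (measure lebesgue S) = ennreal (measure lebesgue (box l u))"
    using eq by (simp add: ennreal_mult')
  also have "\<dots> = ennreal (\<Prod>b\<in>Basis. (u - l) \<bullet> b)"
    using lu by (simp add: measure_completion measure_lborel_box)
  finally show "emeasure (density (distr lborel borel ?T) (\<lambda>_. ennreal ?d)) (box l u) = ennreal (\<Prod>b\<in>Basis. (u - l) \<bullet> b)" .
qed simp

text \<open>A closed set is Borel, so being null for the completed measure passes to
  \<open>lborel\<close>.\<close>

lemma emeasure_lborel_negligible_closed:
  fixes S :: "'a::euclidean_space set"
  assumes "closed S" "negligible S"
  shows "emeasure lborel S = 0"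
proof -
  have "S \<in> sets lborel" using assms(1) by simp
  then have "S \<in> null_sets lborel"
    using assms(2) null_sets_completion_iff[of S lborel] by (simp add: negligible_iff_null_sets)
  then show ?thesis by (rule null_setsD1)
qed

lemma inner_real2: "x \<bullet> y = x $ 1 * y $ 1 + x $ 2 * y $ 2" for x y :: "real ^ 2"
  by (simp add: inner_vec_def sum_2)

text \<open>Written through the two components of the argument, so that projecting the plane onto
  coordinates gives an explicit matrix.\<close>

definition plane_map :: "point \<Rightarrow> point \<Rightarrow> point \<Rightarrow> real ^ 2 \<Rightarrow> point" where
  "plane_map p u w y = p + y $ 1 *\<^sub>R u + y $ 2 *\<^sub>R w"

lemma continuous_on_plane_map [continuous_intros]: "continuous_on S (plane_map p u w)"
  unfolding plane_map_def by (intro continuous_intros)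

lemma plane_map_measurable [measurable]: "plane_map p u w \<in> borel_measurable borel"
  by (intro borel_measurable_continuous_onI continuous_on_plane_map)

text \<open>By polarization, an isometry normalized to fix the origin preserves inner products. The
  images of the two axes are then orthonormal, and the components of an image point along them are
  the coordinates of its argument. This opens up the unspecified isometry in
  \<open>plane_area\<close>.\<close>

lemma isometry_eq_plane_map:
  fixes \<psi> :: "real ^ 2 \<Rightarrow> point"
  assumes iso: "\<forall>x y. dist (\<psi> x) (\<psi> y) = dist x y"
  obtains p u w where "norm u = 1" "norm w = 1" "u \<bullet> w = 0" "\<psi> = plane_map p u w"
proof -
  define f where "f x = \<psi> x - \<psi> 0" for x
  have norm_f: "norm (f x) = norm x" for x
    using iso unfolding f_def by (metis dist_norm diff_zero)
  have norm_d: "norm (f x - f y) = norm (x - y)" for x y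
    using iso unfolding f_def by (simp add: dist_norm)
  have inner: "f x \<bullet> f y = x \<bullet> y" for x y
  proof -
    have "(norm (f x - f y))\<^sup>2 = (norm (x - y))\<^sup>2" using norm_d by simp
    moreover have "(norm (f x))\<^sup>2 = (norm x)\<^sup>2" "(norm (f y))\<^sup>2 = (norm y)\<^sup>2" using norm_f by simp_all
    ultimately show ?thesis
      by (simp add: power2_norm_eq_inner inner_diff_left inner_diff_right inner_commute)
  qed
  define u w where "u = f (axis 1 1)" and "w = f (axis 2 1)"
  have fu: "f y \<bullet> u = y $ 1" "f y \<bullet> w = y $ 2" for y
    by (simp_all add: u_def w_def inner inner_axis)
  have uw: "norm u = 1" "norm w = 1" "u \<bullet> w = 0"
    by (simp_all add: u_def w_def norm_f inner inner_axis_axis norm_axis_1)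
  have f_eq: "f y = y $ 1 *\<^sub>R u + y $ 2 *\<^sub>R w" for y
  proof -
    have uu: "u \<bullet> u = 1" "w \<bullet> w = 1" using uw by (simp_all add: norm_eq_1)
    have ff: "f y \<bullet> f y = y $ 1 * y $ 1 + y $ 2 * y $ 2"
      by (simp add: inner inner_real2)
    \<comment> \<open>Expansion of a squared residual. For orthonormal \<open>u\<close>,
      \<open>w\<close> and the components given by \<open>fu\<close>, it reduces to
      \<open>f y \<bullet> f y\<close> minus the squares of the coordinates of \<open>y\<close>,
      which is zero by \<open>ff\<close>.\<close>
    have ex: "(e - (a *\<^sub>R u + b *\<^sub>R w)) \<bullet> (e - (a *\<^sub>R u + b *\<^sub>R w))
        = e \<bullet> e - 2 * a * (e \<bullet> u) - 2 * b * (e \<bullet> w) + a * a * (u \<bullet> u) + b * b * (w \<bullet> w) + 2 * a * b * (u \<bullet> w)"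
      for e a b
      by (simp add: inner_diff_left inner_diff_right inner_add_left inner_add_right
          inner_commute[of u e] inner_commute[of w e] inner_commute[of w u] algebra_simps)
    have "(f y - (y $ 1 *\<^sub>R u + y $ 2 *\<^sub>R w)) \<bullet> (f y - (y $ 1 *\<^sub>R u + y $ 2 *\<^sub>R w)) = 0"
      unfolding ex fu uu ff uw(3) by simp
    then show ?thesis by simp
  qed
  have "\<psi> = plane_map (\<psi> 0) u w"
  proof
    fix y
    have "\<psi> y = \<psi> 0 + f y" by (simp add: f_def)
    then show "\<psi> y = plane_map (\<psi> 0) u w y" by (simp only: f_eq plane_map_def add.assoc)
  qed
  with uw show ?thesis using that by blast
qed

text \<open>The triple product expansion shows that the cross product of
  \<open>u \<times>\<^sub>3 w\<close> with \<open>m\<close> vanishes; by Lagrange's identity these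
  two unit vectors have inner product 1 or -1.\<close>

lemma orthonormal_complement_unique:
  fixes u w m n :: "real ^ 3"
  assumes "norm u = 1" "norm w = 1" "u \<bullet> w = 0" "norm m = 1" "m \<bullet> u = 0" "m \<bullet> w = 0"
  shows "u \<times>\<^sub>3 w = m \<or> u \<times>\<^sub>3 w = - m"
proof -
  define n where "n = u \<times>\<^sub>3 w"
  have nn: "n \<bullet> n = 1"
    using norm_cross[of u w] assms by (simp add: n_def power2_norm_eq_inner)
  have "n \<times>\<^sub>3 m = (m \<bullet> u) *\<^sub>R w - (m \<bullet> w) *\<^sub>R u"
    unfolding n_def by (simp add: vec_eq_iff forall_3 cross_components inner_vec_def sum_3 algebra_simps)
  then have "n \<times>\<^sub>3 m = 0" using assms by simp
  then have "(n \<bullet> m)\<^sup>2 = 1"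
    using norm_cross[of n m] nn assms by (simp add: power2_norm_eq_inner norm_eq_1)
  then consider "n \<bullet> m = 1" | "n \<bullet> m = -1" by (auto simp: power2_eq_1_iff)
  then show ?thesis
  proof cases
    case 1
    then have "(n - m) \<bullet> (n - m) = 0" using nn assms(4)
      by (simp add: inner_diff_left inner_diff_right inner_commute norm_eq_1)
    then show ?thesis by (simp add: n_def)
  next
    case 2
    then have "(n + m) \<bullet> (n + m) = 0" using nn assms(4)
      by (simp add: inner_add_left inner_add_right inner_commute norm_eq_1)
    then show ?thesis by (simp add: n_def add_eq_0_iff2)
  qed
qed

text \<open>Keeps a unit normal at hand, in terms of which sides, heights and projections are
  computed. The link to the planes in \<open>face_planes\<close> is
  \<open>is_plane_iff_affine\<close>.\<close>

definition is_plane :: "point set \<Rightarrow> bool" where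
  "is_plane P \<longleftrightarrow> (\<exists>m c. norm m = 1 \<and> P = {x. m \<bullet> x = c})"

lemma is_plane_hyperplane: "is_plane {x. a \<bullet> x = b}" if "a \<noteq> 0"
proof -
  have "{x. a \<bullet> x = b} = {x. (a /\<^sub>R norm a) \<bullet> x = b / norm a}"
    using that by (auto simp: field_simps)
  moreover have "norm (a /\<^sub>R norm a) = 1" using that by simp
  ultimately show ?thesis unfolding is_plane_def by blast
qed

lemma is_plane_iff_affine: "is_plane P \<longleftrightarrow> affine P \<and> aff_dim P = 2"
proof
  assume "is_plane P"
  then obtain m c where "norm m = 1" "P = {x. m \<bullet> x = c}" by (auto simp: is_plane_def)
  moreover then have "m \<noteq> 0" by auto
  ultimately show "affine P \<and> aff_dim P = 2"
    by (simp add: affine_hyperplane aff_dim_hyperplane)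
next
  assume P: "affine P \<and> aff_dim P = 2"
  then have "aff_dim P = int (DIM(point) - 1)" by simp
  from iffD1[OF aff_dim_eq_hyperplane this] obtain a b where "a \<noteq> 0" "affine hull P = {x. a \<bullet> x = b}"
    by blast
  moreover have "affine hull P = P" using P by simp
  ultimately show "is_plane P" using is_plane_hyperplane by simp
qed

text \<open>Resolves the choice in \<open>plane_area\<close>: since an isometry onto the plane
  exists, the chosen map is one, and it has the form \<open>plane_map\<close>. The orientation of
  \<open>u\<close>, \<open>w\<close> is left to the choice, whence the two signs.\<close>

lemma plane_areaE:
  assumes "norm m = 1"
  obtains p u w where "norm u = 1" "norm w = 1" "u \<bullet> w = 0"
    "u \<times>\<^sub>3 w = m \<or> u \<times>\<^sub>3 w = - m" "range (plane_map p u w) = {x. m \<bullet> x = c}"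
    "plane_area {x. m \<bullet> x = c} = distr lborel borel (plane_map p u w)"
    "m \<bullet> u = 0" "m \<bullet> w = 0" "m \<bullet> p = c"
proof -
  let ?P = "{x. m \<bullet> x = c}"
  define \<psi> :: "real ^ 2 \<Rightarrow> point" where
    "\<psi> = (SOME \<psi>. (\<forall>x y. dist (\<psi> x) (\<psi> y) = dist x y) \<and> range \<psi> = ?P)"
  have "m \<noteq> 0" using assms by auto
  then have "dim {x. m \<bullet> x = 0} = 2" by (simp add: dim_hyperplane)
  then obtain f :: "real ^ 2 \<Rightarrow> point" where f: "linear f" "f ` UNIV = {x. m \<bullet> x = 0}" "\<And>x. norm (f x) = norm x"
    using isometry_subspaces[of "UNIV :: (real ^ 2) set" "{x. m \<bullet> x = 0}"]
    by (auto simp: subspace_hyperplane)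
  have mm: "m \<bullet> m = 1" using assms by (simp add: norm_eq_1)
  \<comment> \<open>The parallel plane through the origin is two-dimensional, so it has a linear
    isometric parametrization; \<open>c *\<^sub>R m\<close> is a point of the given plane to
    translate it to.\<close>
  have "\<exists>\<psi>. (\<forall>x y :: real ^ 2. dist (\<psi> x) (\<psi> y) = dist x y) \<and> range \<psi> = ?P"
  proof (intro exI conjI allI)
    show "dist (c *\<^sub>R m + f x) (c *\<^sub>R m + f y) = dist x y" for x y
      using f(3)[of "x - y"] by (simp add: dist_norm linear_diff[OF f(1)])
    show "range (\<lambda>x. c *\<^sub>R m + f x) = ?P"
    proof (intro set_eqI iffI)
      fix x assume "x \<in> range (\<lambda>x. c *\<^sub>R m + f x)"
      then show "x \<in> ?P" using f(2) mm by (auto simp: inner_add_right)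
    next
      fix x assume "x \<in> ?P"
      then have "x - c *\<^sub>R m \<in> f ` UNIV" using mm unfolding f(2) by (simp add: inner_diff_right)
      then obtain y where "x - c *\<^sub>R m = f y" by blast
      then show "x \<in> range (\<lambda>x. c *\<^sub>R m + f x)" by (intro image_eqI[of _ _ y]) (auto simp: algebra_simps)
    qed
  qed
  then have \<psi>: "\<forall>x y. dist (\<psi> x) (\<psi> y) = dist x y" "range \<psi> = ?P"
    unfolding \<psi>_def by (rule someI2_ex; blast)+
  obtain p u w where puw: "norm u = 1" "norm w = 1" "u \<bullet> w = 0" "\<psi> = plane_map p u w"
    using isometry_eq_plane_map[OF \<psi>(1)] .
  have P: "m \<bullet> plane_map p u w y = c" for y using \<psi>(2) puw(4) by auto
  have p: "m \<bullet> p = c" using P[of 0] by (simp add: plane_map_def)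
  have u: "m \<bullet> u = 0" using P[of "axis 1 1"] p by (simp add: plane_map_def inner_add_right axis_def)
  have w: "m \<bullet> w = 0" using P[of "axis 2 1"] p by (simp add: plane_map_def inner_add_right axis_def)
  have "plane_area ?P = distr lborel borel (plane_map p u w)"
    unfolding plane_area_def \<psi>_def[symmetric] puw(4) ..
  with that show ?thesis
    using puw(1-3) orthonormal_complement_unique[OF puw(1-3) assms u w] \<psi>(2) puw(4) p u w by blast
qed

lemma sets_plane_area [simp, measurable_cong]: "sets (plane_area P) = sets borel"
  and space_plane_area [simp]: "space (plane_area P) = UNIV"
  by (simp_all add: plane_area_def)

lemma emeasure_plane_area_finite:
  assumes "is_plane P" "bounded S" "S \<in> sets borel"
  shows "emeasure (plane_area P) S < \<infinity>"
proof -
  obtain m c where m: "norm m = 1" "P = {x. m \<bullet> x = c}" using assms(1) by (auto simp: is_plane_def)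
  obtain p u w where *: "norm u = 1" "norm w = 1" "u \<bullet> w = 0"
    "plane_area P = distr lborel borel (plane_map p u w)" using plane_areaE[OF m(1)] m(2) by metis
  have norm: "norm (plane_map p u w y - p) = norm y" for y
  proof -
    have "u \<bullet> u = 1" "w \<bullet> w = 1" using * by (simp_all add: norm_eq_1)
    then have "(plane_map p u w y - p) \<bullet> (plane_map p u w y - p) = y \<bullet> y"
      using *(3) by (simp add: plane_map_def inner_add_left inner_add_right inner_commute inner_real2)
    then show ?thesis by (simp add: norm_eq)
  qed
  obtain B where B: "\<And>x. x \<in> S \<Longrightarrow> norm x \<le> B" using assms(2) by (auto simp: bounded_iff)
  have "norm y \<le> B + norm p" if "plane_map p u w y \<in> S" for y
    using norm_triangle_ineq4[of "plane_map p u w y" p] B[OF that] norm[of y] by simp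
  then have "bounded (plane_map p u w -` S)" by (auto simp: bounded_iff)
  then show ?thesis
    unfolding *(4) using assms(3) emeasure_bounded_finite[of "plane_map p u w -` S"] by (simp add: emeasure_distr)
qed

lemma sigma_finite_plane_area:
  assumes "is_plane P"
  shows "sigma_finite_measure (plane_area P)"
proof
  show "\<exists>A. countable A \<and> A \<subseteq> sets (plane_area P) \<and> \<Union>A = space (plane_area P) \<and> (\<forall>a\<in>A. emeasure (plane_area P) a \<noteq> \<infinity>)"
  proof (intro exI conjI ballI)
    show "\<Union>(range (\<lambda>n. ball 0 (real n))) = space (plane_area P)"
      by (auto intro: reals_Archimedean2)
    show "emeasure (plane_area P) a \<noteq> \<infinity>" if "a \<in> range (\<lambda>n. ball 0 (real n))" for a
      using emeasure_plane_area_finite[OF assms, of a] that by auto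
  qed auto
qed

text \<open>The preimage of \<open>Q\<close> under the parametrization of \<open>P\<close> is given
  by one linear equation in two variables, a null set unless the equation is trivial. A trivial
  equation would mean that \<open>Q\<close> has the normal of \<open>P\<close> up to sign and
  contains the base point of \<open>P\<close>.\<close>

lemma emeasure_plane_area_other_plane:
  assumes "is_plane P" "is_plane Q" "P \<noteq> Q"
  shows "emeasure (plane_area P) Q = 0"
proof -
  obtain m c where m: "norm m = 1" "P = {x. m \<bullet> x = c}" using assms(1) by (auto simp: is_plane_def)
  obtain a b where a: "norm a = 1" "Q = {x. a \<bullet> x = b}" using assms(2) by (auto simp: is_plane_def)
  obtain p u w where *: "norm u = 1" "norm w = 1" "u \<bullet> w = 0" "u \<times>\<^sub>3 w = m \<or> u \<times>\<^sub>3 w = - m"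
    "plane_area P = distr lborel borel (plane_map p u w)" "m \<bullet> p = c"
    using plane_areaE[OF m(1)] m(2) by metis
  define d :: "real ^ 2" where "d = (\<chi> i. if i = 1 then a \<bullet> u else a \<bullet> w)"
  have pre: "plane_map p u w -` Q = {y. d \<bullet> y = b - a \<bullet> p}"
    by (auto simp: a(2) plane_map_def d_def inner_real2 inner_add_right algebra_simps)
  have "d \<noteq> 0 \<or> b - a \<bullet> p \<noteq> 0"
  proof (rule ccontr)
    assume "\<not> ?thesis"
    then have "d $ 1 = 0" "d $ 2 = 0" and bp: "b = a \<bullet> p" by auto
    then have "a \<bullet> u = 0" "a \<bullet> w = 0" by (auto simp: d_def)
    then have "u \<times>\<^sub>3 w = a \<or> u \<times>\<^sub>3 w = - a"
      by (intro orthonormal_complement_unique * a)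
    then have "a = m \<or> a = - m" using *(4) by auto
    then show False using assms(3) m(2) a(2) *(6) bp by auto
  qed
  then have "negligible {y. d \<bullet> y = b - a \<bullet> p}" by (rule negligible_hyperplane)
  then have "emeasure lborel {y. d \<bullet> y = b - a \<bullet> p} = 0"
    by (rule emeasure_lborel_negligible_closed[OF closed_hyperplane])
  moreover have "Q \<in> sets borel" unfolding a(2) by (intro borel_closed closed_hyperplane)
  ultimately show ?thesis unfolding *(5) by (simp add: emeasure_distr pre)
qed

subsection \<open>Local half-spaces\<close>

text \<open>The predicate under the description in \<open>outer_normal\<close>, named so that
  existence and uniqueness of the normal can be handled separately.\<close>

definition halfspace_at :: "point set \<Rightarrow> point \<Rightarrow> point \<Rightarrow> bool" where
  "halfspace_at S x n \<longleftrightarrow> norm n = 1 \<and> (\<exists>r>0. closure S \<inter> ball x r = {y \<in> ball x r. n \<bullet> (y - x) \<le> 0})"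

text \<open>A step from \<open>x\<close> in the direction \<open>n - n'\<close> leaves the
  half-space of \<open>n\<close> but not that of \<open>n'\<close>, because distinct unit vectors
  have inner product less than 1.\<close>

lemma halfspace_at_unique:
  assumes "halfspace_at S x n" "halfspace_at S x n'"
  shows "n = n'"
proof (rule ccontr)
  assume "n \<noteq> n'"
  have n: "n \<bullet> n = 1" "n' \<bullet> n' = 1" using assms by (auto simp: halfspace_at_def norm_eq_1)
  obtain r where r: "r > 0" "closure S \<inter> ball x r = {y \<in> ball x r. n \<bullet> (y - x) \<le> 0}"
    using assms(1) by (auto simp: halfspace_at_def)
  obtain r' where r': "r' > 0" "closure S \<inter> ball x r' = {y \<in> ball x r'. n' \<bullet> (y - x) \<le> 0}"
    using assms(2) by (auto simp: halfspace_at_def)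
  have "(n - n') \<bullet> (n - n') > 0" using \<open>n \<noteq> n'\<close> by simp
  then have lt: "n \<bullet> n' < 1" using n by (simp add: inner_diff_left inner_diff_right inner_commute)
  \<comment> \<open>Since \<open>norm (n - n')\<close> is at most 2, the divisor 4 keeps the step
    within half of the smaller radius.\<close>
  define e where "e = min r r' / 4"
  have e: "e > 0" using r(1) r'(1) by (simp add: e_def)
  define y where "y = x + e *\<^sub>R (n - n')"
  have "norm (n - n') \<le> 2" using norm_triangle_ineq4[of n n'] assms by (simp add: halfspace_at_def)
  then have "dist x y \<le> e * 2" using e by (simp add: y_def dist_norm)
  moreover have "e * 2 < min r r'" using e unfolding e_def by linarith
  ultimately have y: "y \<in> ball x r" "y \<in> ball x r'" by auto
  have "n \<bullet> (y - x) = e * (1 - n \<bullet> n')" "n' \<bullet> (y - x) = e * (n \<bullet> n' - 1)"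
    using n by (simp_all add: y_def inner_diff_right inner_commute)
  then have "n \<bullet> (y - x) > 0" "n' \<bullet> (y - x) \<le> 0"
    using e lt by (simp_all add: mult_le_0_iff)
  moreover have "y \<in> closure S" using calculation(2) r'(2) y(2) by blast
  then have "y \<in> {y \<in> ball x r. n \<bullet> (y - x) \<le> 0}" using y(1) unfolding r(2)[symmetric] by blast
  ultimately show False by simp
qed

lemma outer_normal_alt: "outer_normal S x = (THE n. halfspace_at S x n)"
  by (simp add: outer_normal_def halfspace_at_def)

lemma outer_normal_eq: "halfspace_at S x n \<Longrightarrow> outer_normal S x = n"
  unfolding outer_normal_alt using halfspace_at_unique by blast

lemma halfspace_at_closure: "halfspace_at (closure S) x n \<longleftrightarrow> halfspace_at S x n"
  by (simp add: halfspace_at_def)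

text \<open>An open half-ball. Being open and connected, it lies entirely inside or entirely outside
  of any set whose boundary it avoids.\<close>

definition side :: "point \<Rightarrow> point \<Rightarrow> real \<Rightarrow> point set" where
  "side m x r = {y \<in> ball x r. m \<bullet> (y - x) > 0}"

lemma side_alt: "side m x r = ball x r \<inter> {y. m \<bullet> y > m \<bullet> x}"
  by (auto simp: side_def inner_diff_right)

lemma open_side: "open (side m x r)"
  unfolding side_alt by (intro open_Int open_ball open_halfspace_gt)

lemma connected_side: "connected (side m x r)"
  unfolding side_alt by (intro convex_connected convex_Int convex_ball convex_halfspace_gt)

lemma side_point: "x + e *\<^sub>R m \<in> side m x r" if "norm m = 1" "0 < e" "e < r"
  using that by (simp add: side_def dist_norm norm_eq_1[symmetric] power2_norm_eq_inner[symmetric])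

lemma side_nonempty: "side m x r \<noteq> {}" if "norm m = 1" "r > 0"
  using side_point[OF that(1), of "r/2" r x] that by auto

text \<open>Rules out lower-dimensional parts such as attached walls or segments.\<close>

definition regular_closed :: "point set \<Rightarrow> bool" where
  "regular_closed K \<longleftrightarrow> closure (interior K) = K"

lemma regular_closed_closed: "regular_closed K \<Longrightarrow> closed K"
  by (metis regular_closed_def closed_closure)

lemma side_dichotomy:
  assumes "frontier K \<inter> side m x r = {}"
  shows "side m x r \<subseteq> interior K \<or> side m x r \<inter> K = {}"
proof (cases "side m x r \<inter> K = {}")
  case False
  then have "side m x r \<subseteq> K"
    using connected_Int_frontier[OF connected_side, of m x r K] assms by blast
  then show ?thesis using open_side interior_maximal by blast
qed auto

text \<open>A shift by a small multiple \<open>d\<close> of the normal moves the point into the open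
  half-ball; \<open>d\<close> is bounded by the distance to the sphere so that the ball is not
  left.\<close>

lemma in_closure_side:
  assumes "norm m = 1" "y \<in> ball x r" "m \<bullet> (y - x) \<ge> 0"
  shows "y \<in> closure (side m x r)"
  unfolding closure_approachable
proof (intro allI impI)
  fix e :: real assume "e > 0"
  define d where "d = min e (r - dist x y) / 2"
  have d: "d > 0" "d < e" "d < r - dist x y" using \<open>e > 0\<close> assms(2) by (auto simp: d_def min_def field_simps)
  have "dist x (y + d *\<^sub>R m) \<le> dist x y + d"
    using dist_triangle[of x "y + d *\<^sub>R m" y] assms(1) d by (simp add: dist_norm)
  moreover have "m \<bullet> (y + d *\<^sub>R m - x) = m \<bullet> (y - x) + d"
    using assms(1) by (simp add: inner_diff_right inner_add_right norm_eq_1)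
  ultimately have "y + d *\<^sub>R m \<in> side m x r" using d assms(3) by (simp add: side_def)
  moreover have "dist (y + d *\<^sub>R m) y < e" using d assms(1) by (simp add: dist_norm)
  ultimately show "\<exists>z\<in>side m x r. dist z y < e" by blast
qed

lemma halfspace_at_one_side:
  assumes K: "regular_closed K" and m: "norm m = 1" and r: "r > 0"
    and inn: "side (- m) x r \<subseteq> interior K" and out: "side m x r \<inter> K = {}"
  shows "x \<in> frontier K" "halfspace_at K x m"
proof -
  have cl: "closed K" using K by (rule regular_closed_closed)
  have "closure (side (- m) x r) \<subseteq> K"
    using inn interior_subset[of K] by (intro closure_minimal cl; blast)
  then have le: "y \<in> K" if "y \<in> ball x r" "m \<bullet> (y - x) \<le> 0" for y
    using in_closure_side[of "- m" y x r] that m by auto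
  then have eq: "K \<inter> ball x r = {y \<in> ball x r. m \<bullet> (y - x) \<le> 0}"
    using out by (fastforce simp: side_def not_le)
  then show "halfspace_at K x m" using m r cl by (auto simp: halfspace_at_def)
  have "x \<in> closure (side m x r)" using in_closure_side[OF m, of x x r] r by simp
  then have "x \<in> closure (- K)" using out closure_mono[of "side m x r" "- K"] by blast
  moreover have "x \<in> K" using le r by simp
  ultimately show "x \<in> frontier K" by (simp add: frontier_closures cl)
qed

text \<open>Each open half-ball is inside or outside of \<open>K\<close>. If both are inside, their
  closures fill the ball. If both are outside, \<open>interior K\<close> meets the ball in an open
  subset of a plane, hence not at all, which contradicts that \<open>x\<close> lies in the closure
  of the interior.\<close>

lemma local_structure:
  assumes K: "regular_closed K" and m: "norm m = 1" and r: "r > 0" and x: "x \<in> K"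
    and fr: "frontier K \<inter> ball x r \<subseteq> {y. m \<bullet> (y - x) = 0}"
  obtains "side m x r \<subseteq> interior K" "side (- m) x r \<subseteq> interior K" "x \<in> interior K"
  | "side (- m) x r \<subseteq> interior K" "side m x r \<inter> K = {}" "x \<in> frontier K" "halfspace_at K x m"
  | "side m x r \<subseteq> interior K" "side (- m) x r \<inter> K = {}" "x \<in> frontier K" "halfspace_at K x (- m)"
proof -
  have cl: "closed K" using K by (rule regular_closed_closed)
  have "side m x r \<subseteq> interior K \<or> side m x r \<inter> K = {}" "side (-m) x r \<subseteq> interior K \<or> side (-m) x r \<inter> K = {}"
    using fr by (intro side_dichotomy; force simp: side_def)+
  then consider (both) "side m x r \<subseteq> interior K" "side (- m) x r \<subseteq> interior K"
    | (minus) "side (- m) x r \<subseteq> interior K" "side m x r \<inter> K = {}"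
    | (plus) "side m x r \<subseteq> interior K" "side (- m) x r \<inter> K = {}"
    | (none) "side m x r \<inter> K = {}" "side (- m) x r \<inter> K = {}"
    by blast
  then show ?thesis
  proof cases
    case both
    then have "closure (side m x r) \<subseteq> K" "closure (side (-m) x r) \<subseteq> K"
      using interior_subset[of K] by (intro closure_minimal cl; blast)+
    moreover have "y \<in> closure (side m x r) \<or> y \<in> closure (side (- m) x r)" if "y \<in> ball x r" for y
      using in_closure_side[of m y x r] in_closure_side[of "- m" y x r] m that by (cases "m \<bullet> (y - x) \<ge> 0") auto
    ultimately have "ball x r \<subseteq> K" by blast
    then have "x \<in> interior K" using r by (meson centre_in_ball interior_maximal open_ball subsetD)
    with both that show ?thesis by blast
  next
    case minus
    then show ?thesis using halfspace_at_one_side[OF K m r] that by blast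
  next
    case plus
    then show ?thesis using halfspace_at_one_side[OF K, of "- m" r x] m r that by simp
  next
    case none
    have "x \<in> closure (interior K)" using x K by (simp add: regular_closed_def)
    then have "ball x r \<inter> closure (interior K) \<noteq> {}" using r centre_in_ball by blast
    then have "interior K \<inter> ball x r \<noteq> {}"
      using open_Int_closure_eq_empty[OF open_ball] by blast
    moreover have "open (interior K \<inter> ball x r)" by (intro open_Int open_interior open_ball)
    moreover have "interior K \<inter> ball x r \<subseteq> {y. m \<bullet> y = m \<bullet> x}"
    proof
      fix y assume y: "y \<in> interior K \<inter> ball x r"
      then have "y \<notin> side m x r" "y \<notin> side (- m) x r" using none interior_subset by blast+
      then show "y \<in> {y. m \<bullet> y = m \<bullet> x}" using y by (auto simp: side_def inner_diff_right)
    qed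
    moreover have "interior {y. m \<bullet> y = m \<bullet> x} = {}"
      using m by (intro interior_hyperplane) auto
    ultimately show ?thesis
      using interior_maximal[of "interior K \<inter> ball x r" "{y. m \<bullet> y = m \<bullet> x}"] by simp
  qed
qed

lemma only_plane_ball:
  assumes "finite A" "\<And>Q. Q \<in> A \<Longrightarrow> closed Q" "\<And>Q. Q \<in> A \<Longrightarrow> Q \<noteq> P \<Longrightarrow> x \<notin> Q"
  obtains r where "r > 0" "\<And>y Q. y \<in> ball x r \<Longrightarrow> Q \<in> A \<Longrightarrow> y \<in> Q \<Longrightarrow> Q = P"
proof -
  have "open (- \<Union>(A - {P}))" "x \<in> - \<Union>(A - {P})" using assms by (auto intro: closed_Union)
  then obtain r where "r > 0" "ball x r \<subseteq> - \<Union>(A - {P})"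
    using open_contains_ball[of "- \<Union>(A - {P})"] by metis
  then have "Q = P" if "y \<in> ball x r" "Q \<in> A" "y \<in> Q" for y Q using that by blast
  with \<open>r > 0\<close> show ?thesis using that by blast
qed

lemma closed_is_plane: "is_plane P \<Longrightarrow> closed P"
  by (auto simp: is_plane_def closed_hyperplane)

section \<open>Boundaries contained in finitely many planes\<close>

text \<open>Passing to complements leaves frontiers unchanged and turns the intersection of
  half-spaces into a finite union, whose frontier lies in the union of the frontiers.\<close>

lemma frontier_polyhedron_subset_planes:
  assumes "polyhedron S"
  obtains A where "finite A" "\<forall>P\<in>A. is_plane P" "frontier S \<subseteq> \<Union>A"
proof -
  obtain F where F: "finite F" "S = \<Inter>F" "\<forall>h\<in>F. \<exists>a b. a \<noteq> 0 \<and> h = {x. a \<bullet> x \<le> b}"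
    using assms by (auto simp: polyhedron_def)
  have "\<forall>h\<in>F. is_plane (frontier h)"
    using F(3) by (metis frontier_halfspace_le is_plane_hyperplane)
  moreover have "frontier S \<subseteq> \<Union>(frontier ` F)"
  proof -
    have "frontier (\<Union>h\<in>F. - h) \<subseteq> (\<Union>t\<in>uminus ` F. frontier t)"
      using frontier_Union_subset[of "uminus ` F"] F(1) by simp
    moreover have "frontier S = frontier (\<Union>h\<in>F. - h)"
      using frontier_complement[of S] F(2) by (simp add: uminus_Inf)
    ultimately show ?thesis by (auto simp: frontier_complement)
  qed
  ultimately show ?thesis using F(1) that[of "frontier ` F"] by auto
qed

lemma frontier_Union_polytopes_subset_planes:
  assumes "finite \<P>" "\<forall>P\<in>\<P>. polytope P"
  obtains A where "finite A" "\<forall>P\<in>A. is_plane P" "frontier (\<Union>\<P>) \<subseteq> \<Union>A"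
proof -
  have "\<forall>S\<in>\<P>. \<exists>A. finite A \<and> (\<forall>P\<in>A. is_plane P) \<and> frontier S \<subseteq> \<Union>A"
    using frontier_polyhedron_subset_planes polytope_imp_polyhedron assms(2) by metis
  then obtain f where f: "\<forall>S\<in>\<P>. finite (f S) \<and> (\<forall>P\<in>f S. is_plane P) \<and> frontier S \<subseteq> \<Union>(f S)"
    by metis
  have "frontier (\<Union>\<P>) \<subseteq> \<Union>(\<Union>(f ` \<P>))"
    using frontier_Union_subset[OF assms(1)] f by fastforce
  with f assms(1) show ?thesis by (intro that[of "\<Union>(f ` \<P>)"]) auto
qed

text \<open>A domain with an interior crack would violate this; the crack would be part of the boundary of
  the domain although it is an interface of the mesh.\<close>

lemma interior_closure_lipschitz:
  assumes "open U" "lipschitz_boundary U"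
  shows "interior (closure U) = U"
proof (rule ccontr)
  assume "interior (closure U) \<noteq> U"
  moreover have "U \<subseteq> interior (closure U)" using assms(1) closure_subset interior_maximal by blast
  ultimately obtain p where p: "p \<in> interior (closure U)" "p \<notin> U" by blast
  then have "p \<in> frontier U"
    using assms(1) interior_subset by (auto simp: frontier_def interior_open)
  then obtain e \<phi> L r h where *: "norm e = 1" "r > 0" "h > 0" "L-lipschitz_on {y. y \<bullet> e = 0} \<phi>"
    "\<And>x. norm ((x - p) - ((x - p) \<bullet> e) *\<^sub>R e) < r \<Longrightarrow> \<bar>(x - p) \<bullet> e\<bar> < h \<Longrightarrow>
       (x \<in> U \<longleftrightarrow> (x - p) \<bullet> e < \<phi> ((x - p) - ((x - p) \<bullet> e) *\<^sub>R e))"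
    using bspec[OF assms(2)[unfolded lipschitz_boundary_def Let_def] \<open>p \<in> frontier U\<close>] by blast
  have ee: "e \<bullet> e = 1" using *(1) by (simp add: norm_eq_1)
  have \<phi>0: "\<phi> 0 \<le> 0" using *(5)[of p] *(2,3) p(2) by simp
  obtain d where d: "d > 0" "ball p d \<subseteq> closure U"
    using p(1) unfolding mem_interior by blast
  define s where "s = min d h / 2"
  have s: "s > 0" "s < d" "s < h" using d *(3) by (auto simp: s_def min_def)
  define q where "q = p + s *\<^sub>R e"
  have "q \<in> ball p d" using s *(1) by (simp add: q_def dist_norm)
  then have "q \<in> closure U" using d by blast
  \<comment> \<open>The open cone with vertex \<open>p\<close> and slope \<open>L\<close>. As
    \<open>\<phi> 0 \<le> 0\<close>, the Lipschitz bound keeps the graph below it, so it misses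
    \<open>U\<close>; but it is a neighbourhood of \<open>q\<close>, which lies in the closure of
    \<open>U\<close>.\<close>
  define T where "T = {x. norm ((x - p) - ((x - p) \<bullet> e) *\<^sub>R e) < r \<and> \<bar>(x - p) \<bullet> e\<bar> < h \<and>
    L * norm ((x - p) - ((x - p) \<bullet> e) *\<^sub>R e) < (x - p) \<bullet> e}"
  have "open T" unfolding T_def
    by (intro open_Collect_conj open_Collect_less continuous_intros)
  moreover have "q \<in> T" using s *(2) ee by (simp add: T_def q_def)
  ultimately have "T \<inter> U \<noteq> {}" using \<open>q \<in> closure U\<close>
    using open_Int_closure_eq_empty[of T U] by blast
  then obtain x where x: "x \<in> T" "x \<in> U" by blast
  define y where "y = (x - p) - ((x - p) \<bullet> e) *\<^sub>R e"
  have y: "y \<bullet> e = 0" using ee by (simp add: y_def inner_diff_left)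
  have 1: "(x - p) \<bullet> e < \<phi> y" using *(5)[of x] x by (simp add: T_def y_def)
  have 2: "\<phi> y \<le> \<phi> 0 + L * norm y"
    using lipschitz_onD[OF *(4), of y 0] y by (simp add: dist_norm abs_le_iff)
  have 3: "L * norm y < (x - p) \<bullet> e" using x(1) by (simp add: T_def y_def)
  show False using 1 2 3 \<phi>0 by linarith
qed

lemma frontier_closure_lipschitz:
  "open U \<Longrightarrow> lipschitz_boundary U \<Longrightarrow> frontier (closure U) = frontier U"
  using interior_closure_lipschitz[of U] by (simp add: frontier_def interior_open)

subsection \<open>Integration along lines\<close>

text \<open>A linear map that preserves inner products and takes one standard basis onto the other
  pulls boxes back to boxes of the same volume. Source and target may have different types, as is
  the case for \<open>(real ^ 2) \<times> real\<close> and \<open>point\<close>.\<close>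

lemma lborel_distr_orthonormal:
  fixes f :: "'a::euclidean_space \<Rightarrow> 'b::euclidean_space"
  assumes "linear f" "\<And>x y. f x \<bullet> f y = x \<bullet> y" "f ` Basis = Basis"
  shows "lborel = distr lborel borel f"
proof (rule lborel_eqI)
  have f[measurable]: "f \<in> borel_measurable lborel"
    using assms(1) linear_continuous_on[of f UNIV] linear_conv_bounded_linear
    by (auto intro: borel_measurable_continuous_onI)
  have inj: "inj_on f Basis"
  proof (rule inj_onI)
    fix x y assume "f x = f y"
    then have "(x - y) \<bullet> (x - y) = 0"
      using assms(2)[of "x - y" "x - y"] linear_diff[OF assms(1), of x y] by simp
    then show "x = y" by simp
  qed
  have surj: "\<exists>x. f x = y" for y
  proof -
    have "y \<in> span (f ` Basis)" by (simp add: assms(3))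
    then have "y \<in> f ` span Basis" by (simp add: linear_span_image[OF assms(1)])
    then show ?thesis by blast
  qed
  fix l u :: 'b assume lu: "\<And>b. b \<in> Basis \<Longrightarrow> l \<bullet> b \<le> u \<bullet> b"
  obtain l' u' where l': "f l' = l" and u': "f u' = u" using surj by meson
  have all: "(\<forall>b\<in>Basis. P b) \<longleftrightarrow> (\<forall>b\<in>Basis. P (f b))" for P :: "'b \<Rightarrow> bool"
    by (subst assms(3)[symmetric]) blast
  have "f -` box l u = box l' u'"
    unfolding l'[symmetric] u'[symmetric] box_def by (auto simp: all assms(2))
  moreover have "l' \<bullet> b \<le> u' \<bullet> b" if "b \<in> Basis" for b
    using lu[of "f b"] that assms(3) l' u' assms(2) by (metis image_eqI)
  moreover have "(\<Prod>b\<in>Basis. (u - l) \<bullet> b) = (\<Prod>b\<in>Basis. (u' - l') \<bullet> b)"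
  proof -
    have "(\<Prod>b\<in>Basis. (u - l) \<bullet> b) = (\<Prod>b\<in>f ` Basis. (u - l) \<bullet> b)" by (simp add: assms(3))
    also have "\<dots> = (\<Prod>b\<in>Basis. (u - l) \<bullet> f b)" by (simp add: prod.reindex[OF inj])
    also have "\<dots> = (\<Prod>b\<in>Basis. (u' - l') \<bullet> b)"
      by (simp add: l'[symmetric] u'[symmetric] linear_diff[OF assms(1), symmetric] assms(2))
    finally show ?thesis .
  qed
  ultimately show "emeasure (distr lborel borel f) (box l u) = ennreal (\<Prod>b\<in>Basis. (u - l) \<bullet> b)"
    by (simp add: emeasure_distr)
qed simp

text \<open>Reads a triple of real numbers as a point, \<open>j\<close> being the last coordinate.\<close>

definition coord_map :: "3 \<Rightarrow> 3 \<Rightarrow> 3 \<Rightarrow> (real ^ 2) \<times> real \<Rightarrow> point" where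
  "coord_map j k l = (\<lambda>(y, s). y $ 1 *\<^sub>R axis k 1 + y $ 2 *\<^sub>R axis l 1 + s *\<^sub>R axis j 1)"

text \<open>The triples are the cyclic ones, for instance 3, 1 for \<open>j = 2\<close>. This gives
  the component of the cross product the same formula, without a change of sign, in all three
  cases.\<close>

lemma coordinate_triple:
  fixes j :: 3
  obtains k l where "j \<noteq> k" "j \<noteq> l" "k \<noteq> l" "UNIV = {j, k, l}"
    "\<And>u w :: point. (u \<times>\<^sub>3 w) $ j = u $ k * w $ l - w $ k * u $ l"
proof -
  consider "j = 1" | "j = 2" | "j = 3" using exhaust_3 by blast
  then show ?thesis
  proof cases
    case 1
    show ?thesis
    proof (rule that[of 2 3])
      show "UNIV = {j, 2, 3}" unfolding 1 UNIV_3 by blast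
    qed (simp_all add: 1 cross_components)
  next
    case 2
    show ?thesis
    proof (rule that[of 3 1])
      show "UNIV = {j, 3, 1}" unfolding 2 UNIV_3 by blast
    qed (simp_all add: 2 cross_components)
  next
    case 3
    show ?thesis
    proof (rule that[of 1 2])
      show "UNIV = {j, 1, 2}" unfolding 3 UNIV_3 by blast
    qed (simp_all add: 3 cross_components)
  qed
qed

context
  fixes j k l :: 3
  assumes jkl: "j \<noteq> k" "j \<noteq> l" "k \<noteq> l" and univ: "UNIV = {j, k, l}"
begin

lemma coord_map_nth [simp]:
  "coord_map j k l (y, s) $ j = s" "coord_map j k l (y, s) $ k = y $ 1" "coord_map j k l (y, s) $ l = y $ 2"
  using jkl by (auto simp: coord_map_def axis_def)

lemma inner_jkl: "x \<bullet> y = x $ k * y $ k + x $ l * y $ l + x $ j * y $ j" for x y :: point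
proof -
  have "x \<bullet> y = (\<Sum>i\<in>{j, k, l}. x $ i * y $ i)" by (simp add: inner_vec_def univ[symmetric])
  then show ?thesis using jkl by simp
qed

lemma eq_jkl: "x = y \<longleftrightarrow> x $ j = y $ j \<and> x $ k = y $ k \<and> x $ l = y $ l" for x y :: point
proof -
  have "x = y \<longleftrightarrow> (\<forall>i\<in>{j, k, l}. x $ i = y $ i)" by (simp add: vec_eq_iff univ[symmetric])
  then show ?thesis by auto
qed

lemma linear_coord_map: "linear (coord_map j k l)"
  by (rule linearI) (auto simp: coord_map_def algebra_simps)

lemma lborel_coord_map: "lborel = distr lborel borel (coord_map j k l)"
proof (rule lborel_distr_orthonormal)
  show "coord_map j k l x \<bullet> coord_map j k l y = x \<bullet> y" for x y
    by (cases x; cases y) (simp add: inner_jkl inner_real2)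
  have b2: "(Basis :: (real ^ 2) set) = {axis 1 1, axis 2 1}"
    by (auto simp: Basis_vec_def UNIV_2)
  have b3: "(Basis :: point set) = {axis j 1, axis k 1, axis l 1}"
    by (auto simp: Basis_vec_def univ)
  have "coord_map j k l (axis 1 1, 0) = axis k 1" "coord_map j k l (axis 2 1, 0) = axis l 1"
    "coord_map j k l (0, 1) = axis j 1"
    by (simp_all add: coord_map_def axis_def)
  then show "coord_map j k l ` Basis = Basis"
    unfolding Basis_prod_def b2 b3 by auto
qed (rule linear_coord_map)

lemma coord_map_continuous: "continuous_on S (coord_map j k l)"
  unfolding coord_map_def case_prod_beta by (intro continuous_intros)

lemma coord_map_measurable [measurable]: "coord_map j k l \<in> borel_measurable borel"
  by (intro borel_measurable_continuous_onI coord_map_continuous)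

lemma coord_map_translate: "coord_map j k l (y, s) = coord_map j k l (y, s0) + (s - s0) *\<^sub>R axis j 1"
  by (simp add: coord_map_def algebra_simps)

text \<open>Fubini's theorem with the integral along lines in direction \<open>j\<close>
  innermost.\<close>

lemma integral_coord_map:
  fixes g :: "point \<Rightarrow> real"
  assumes "integrable lborel g"
  shows "integral\<^sup>L lborel g = (\<integral>y. (\<integral>s. g (coord_map j k l (y, s)) \<partial>lborel) \<partial>lborel)"
proof -
  have [measurable]: "g \<in> borel_measurable borel" using assms by simp
  have "integral\<^sup>L lborel g = (\<integral>z. g (coord_map j k l z) \<partial>lborel)"
    by (subst lborel_coord_map) (simp add: integral_distr)
  moreover have "integrable lborel (\<lambda>z. g (coord_map j k l z))"
    using assms by (subst (asm) lborel_coord_map) (simp add: integrable_distr_eq)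
  ultimately show ?thesis
    using lborel_pair.integral_fst[of "\<lambda>y s. g (coord_map j k l (y, s))"] by (simp add: lborel_prod case_prod_beta')
qed

end

section \<open>Regularity of the outer normal and general position\<close>

text \<open>In the ball where \<open>K\<close> is a half-space, points strictly inside the
  half-space are interior to \<open>K\<close>. The remaining boundary points thus lie on the
  bounding plane and see the same half-space in a smaller ball.\<close>

lemma outer_normal_locally_constant:
  assumes "closed K" "halfspace_at K x n"
  obtains r where "r > 0" "\<And>y. y \<in> frontier K \<Longrightarrow> dist x y < r \<Longrightarrow> halfspace_at K y n"
proof -
  obtain r where r: "r > 0" "closure K \<inter> ball x r = {y \<in> ball x r. n \<bullet> (y - x) \<le> 0}" and n: "norm n = 1"
    using assms(2) by (auto simp: halfspace_at_def)
  have K: "z \<in> K \<longleftrightarrow> n \<bullet> (z - x) \<le> 0" if "z \<in> ball x r" for z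
  proof -
    have "z \<in> K \<longleftrightarrow> z \<in> closure K \<inter> ball x r" using that assms(1) by simp
    also have "\<dots> \<longleftrightarrow> n \<bullet> (z - x) \<le> 0" unfolding r(2) using that by simp
    finally show ?thesis .
  qed
  show ?thesis
  proof (rule that[OF r(1)])
    fix y assume y: "y \<in> frontier K" "dist x y < r"
    have "n \<bullet> (y - x) = 0"
    proof (rule ccontr)
      assume "n \<bullet> (y - x) \<noteq> 0"
      moreover have "y \<in> K" using y(1) assms(1) frontier_subset_closed by blast
      ultimately have "n \<bullet> (y - x) < 0" using K[of y] y(2) by simp
      then have "y \<in> ball x r \<inter> {z. n \<bullet> z < n \<bullet> x}" using y(2) by (simp add: inner_diff_right)
      moreover have "open (ball x r \<inter> {z. n \<bullet> z < n \<bullet> x})" by (intro open_Int open_ball open_halfspace_lt)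
      moreover have "ball x r \<inter> {z. n \<bullet> z < n \<bullet> x} \<subseteq> K" using K by (auto simp: inner_diff_right)
      ultimately have "y \<in> interior K" using interiorI by metis
      then show False using y(1) by (simp add: frontier_def)
    qed
    then have eq: "n \<bullet> (z - y) = n \<bullet> (z - x)" for z by (simp add: inner_diff_right)
    have "z \<in> ball x r" if "z \<in> ball y (r - dist x y)" for z
      using that dist_triangle[of x z y] by simp
    then have "closure K \<inter> ball y (r - dist x y) = {z \<in> ball y (r - dist x y). n \<bullet> (z - y) \<le> 0}"
      unfolding eq using K assms(1) by auto
    then show "halfspace_at K y n" using n y(2) unfolding halfspace_at_def
      by (intro conjI exI[of _ "r - dist x y"]) auto
  qed
qed

lemma outer_normal_undefined:
  assumes "\<nexists>n. halfspace_at K x n"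
  shows "outer_normal K x = (THE n. False)"
proof -
  have "halfspace_at K x = (\<lambda>n. False)" using assms by auto
  then show ?thesis unfolding outer_normal_alt by simp
qed


text \<open>The points without a normal do no harm: there the description \<open>THE\<close> has an empty predicate, and
  hence the same value at all of them.\<close>

lemma outer_normal_measurable:
  assumes "closed K"
  shows "(\<lambda>x. indicator (frontier K) x *\<^sub>R outer_normal K x) \<in> borel_measurable borel"
proof -
  define G where "G = {x \<in> frontier K. \<exists>n. halfspace_at K x n}"
  have "\<forall>x\<in>G. \<exists>r>0. \<forall>y. y \<in> frontier K \<longrightarrow> dist x y < r \<longrightarrow> y \<in> G \<and> outer_normal K y = outer_normal K x"
  proof
    fix x assume "x \<in> G"
    then obtain n where n: "halfspace_at K x n" by (auto simp: G_def)
    obtain r where "r > 0" "\<And>y. y \<in> frontier K \<Longrightarrow> dist x y < r \<Longrightarrow> halfspace_at K y n"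
      using outer_normal_locally_constant[OF assms n] by blast
    then show "\<exists>r>0. \<forall>y. y \<in> frontier K \<longrightarrow> dist x y < r \<longrightarrow> y \<in> G \<and> outer_normal K y = outer_normal K x"
      using outer_normal_eq n by (intro exI[of _ r]) (auto simp: G_def)
  qed
  then obtain r where r: "\<And>x. x \<in> G \<Longrightarrow> r x > 0"
    "\<And>x y. x \<in> G \<Longrightarrow> y \<in> frontier K \<Longrightarrow> dist x y < r x \<Longrightarrow> y \<in> G \<and> outer_normal K y = outer_normal K x"
    by metis
  \<comment> \<open>\<open>G\<close> is relatively open in the closed set \<open>frontier K\<close>,
    hence Borel.\<close>
  have "G = frontier K \<inter> (\<Union>x\<in>G. ball x (r x))"
  proof (intro set_eqI iffI)
    fix x assume "x \<in> G"
    then have "x \<in> frontier K" "x \<in> ball x (r x)" using r(1) by (simp_all add: G_def)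
    with \<open>x \<in> G\<close> show "x \<in> frontier K \<inter> (\<Union>x\<in>G. ball x (r x))" by blast
  next
    fix x assume "x \<in> frontier K \<inter> (\<Union>x\<in>G. ball x (r x))"
    then show "x \<in> G" using r(2) by auto
  qed
  moreover have "frontier K \<inter> (\<Union>x\<in>G. ball x (r x)) \<in> sets borel"
    by (intro sets.Int borel_open open_UN ballI open_ball borel_closed frontier_closed)
  ultimately have G[measurable]: "G \<in> sets borel" by simp
  have fr[measurable]: "frontier K \<in> sets borel" by (intro borel_closed frontier_closed)
  have "continuous_on G (outer_normal K)"
    unfolding continuous_on_iff
  proof (intro ballI allI impI)
    fix x and e :: real assume x: "x \<in> G" "0 < e"
    show "\<exists>d>0. \<forall>x'\<in>G. dist x' x < d \<longrightarrow> dist (outer_normal K x') (outer_normal K x) < e"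
      using r[OF x(1)] x(2) by (intro exI[of _ "r x"]) (auto simp: dist_commute G_def)
  qed
  then have "(\<lambda>x. indicator G x *\<^sub>R outer_normal K x) \<in> borel_measurable borel"
    by (intro borel_measurable_continuous_on_indicator G)
  then have "(\<lambda>x. indicator G x *\<^sub>R outer_normal K x + indicator (frontier K - G) x *\<^sub>R (THE n. False)) \<in> borel_measurable borel"
    by measurable
  also have "(\<lambda>x. indicator G x *\<^sub>R outer_normal K x + indicator (frontier K - G) x *\<^sub>R (THE n. False))
     = (\<lambda>x. indicator (frontier K) x *\<^sub>R outer_normal K x)"
    using outer_normal_undefined[of K] by (auto simp: fun_eq_iff indicator_def G_def)
  finally show ?thesis .
qed

lemma outer_normal_nth_measurable:
  assumes "closed K"
  shows "(\<lambda>x. indicator (frontier K) x * outer_normal K x $ j) \<in> borel_measurable borel"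
proof -
  have "(\<lambda>x. (indicator (frontier K) x *\<^sub>R outer_normal K x) \<bullet> axis j 1) \<in> borel_measurable borel"
    by (intro borel_measurable_inner outer_normal_measurable assms) simp
  then show ?thesis by (simp add: inner_axis)
qed

text \<open>The bound includes the value of the description at points without a normal, so that it
  holds on the whole boundary.\<close>

lemma norm_outer_normal_le: "norm (outer_normal K x) \<le> max 1 (norm (THE n :: point. False))"
proof (cases "\<exists>n. halfspace_at K x n")
  case True
  then obtain n where "halfspace_at K x n" by blast
  then show ?thesis using outer_normal_eq[of K x n] by (simp add: halfspace_at_def)
next
  case False
  then show ?thesis using outer_normal_undefined by simp
qed

text \<open>Points in general position with respect to the family: the other planes are null sets
  for the area of \<open>P\<close>, and this measure is concentrated on the range of the
  parametrization, which is \<open>P\<close>.\<close>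

lemma AE_plane_area_only:
  assumes "finite A" "\<forall>P\<in>A. is_plane P" "is_plane P"
  shows "AE x in plane_area P. x \<in> P \<and> (\<forall>Q\<in>A. Q \<noteq> P \<longrightarrow> x \<notin> Q)"
proof -
  have "AE x in plane_area P. x \<notin> Q" if "Q \<in> A" "Q \<noteq> P" for Q
  proof (rule AE_not_in)
    have "is_plane Q" "P \<noteq> Q" using assms that by auto
    then show "Q \<in> null_sets (plane_area P)"
      using emeasure_plane_area_other_plane[OF assms(3)] closed_is_plane by (auto simp: null_sets_def)
  qed
  then have "AE x in plane_area P. \<forall>Q\<in>A - {P}. x \<notin> Q"
    using assms(1) by (intro AE_finite_allI) auto
  moreover have "AE x in plane_area P. x \<in> P"
  proof -
    obtain m c where m: "norm m = 1" "P = {x. m \<bullet> x = c}" using assms(3) by (auto simp: is_plane_def)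
    obtain p u w where *: "plane_area P = distr lborel borel (plane_map p u w)" "range (plane_map p u w) = P"
      using plane_areaE[OF m(1)] m(2) by metis
    have "P \<in> sets borel" using closed_is_plane[OF assms(3)] by simp
    then show ?thesis unfolding *(1) using *(2) by (subst AE_distr_iff) auto
  qed
  ultimately show ?thesis by eventually_elim auto
qed

text \<open>Near \<open>x\<close> the boundary of \<open>K\<close> lies in \<open>P\<close> alone,
  so \<open>local_structure\<close> leaves only the two half-spaces bounded by
  \<open>P\<close>.\<close>

lemma outer_normal_at_only_plane:
  assumes "regular_closed K" "finite A" "\<forall>P\<in>A. is_plane P" "frontier K \<subseteq> \<Union>A"
    and m: "norm m = 1" "P = {y. m \<bullet> y = c}" and x: "x \<in> P" "\<forall>Q\<in>A. Q \<noteq> P \<longrightarrow> x \<notin> Q" "x \<in> frontier K"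
  obtains "halfspace_at K x m" | "halfspace_at K x (- m)"
proof -
  obtain r where r: "r > 0" "\<And>y Q. y \<in> ball x r \<Longrightarrow> Q \<in> A \<Longrightarrow> y \<in> Q \<Longrightarrow> Q = P"
    using only_plane_ball[of A P x] assms(2,3) x(2) closed_is_plane by metis
  have fr: "frontier K \<inter> ball x r \<subseteq> {y. m \<bullet> (y - x) = 0}"
  proof
    fix y assume y: "y \<in> frontier K \<inter> ball x r"
    then obtain Q where "Q \<in> A" "y \<in> Q" using assms(4) by blast
    then have "y \<in> P" using r(2) y by blast
    then show "y \<in> {y. m \<bullet> (y - x) = 0}" using x(1) m(2) by (simp add: inner_diff_right)
  qed
  have "x \<in> K" using x(3) assms(1) regular_closed_closed frontier_subset_closed by blast
  from local_structure[OF assms(1) m(1) r(1) this fr] show ?thesis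
    using that x(3) by (metis DiffE frontier_def)
qed

section \<open>Planes and lines in a coordinate direction\<close>

context
  fixes j k l :: 3
  assumes jkl: "j \<noteq> k" "j \<noteq> l" "k \<noteq> l" and univ: "UNIV = {j, k, l}"
begin


text \<open>The last coordinate of the point of a plane over \<open>y\<close>.\<close>

definition plane_height :: "point \<Rightarrow> real \<Rightarrow> real ^ 2 \<Rightarrow> real" where
  "plane_height m c y = (c - m $ k * y $ 1 - m $ l * y $ 2) / m $ j"

lemma plane_height_iff:
  assumes "m $ j \<noteq> 0"
  shows "m \<bullet> coord_map j k l (y, s) = c \<longleftrightarrow> s = plane_height m c y"
  using assms jkl by (auto simp: inner_jkl[OF jkl univ] coord_map_nth[OF jkl univ] plane_height_def field_simps)

text \<open>Composed with the isometric parametrization, the projection along direction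
  \<open>j\<close> is the affine map \<open>q + M z\<close>. By \<open>cross\<close>, its
  determinant is the \<open>j\<close>-th component of \<open>u \<times>\<^sub>3 w\<close>, which is
  that of \<open>m\<close> up to sign; this is the Jacobian on the right-hand side.\<close>

lemma integral_plane_height:
  fixes G :: "point \<Rightarrow> real"
  assumes cross: "\<And>u w :: point. (u \<times>\<^sub>3 w) $ j = u $ k * w $ l - w $ k * u $ l"
    and m: "norm m = 1" "m $ j \<noteq> 0" and [measurable]: "G \<in> borel_measurable borel"
  shows "(\<integral>y. G (coord_map j k l (y, plane_height m c y)) \<partial>lborel) = (\<integral>x. G x * \<bar>m $ j\<bar> \<partial>plane_area {x. m \<bullet> x = c})"
proof -
  obtain p u w where *: "norm u = 1" "norm w = 1" "u \<bullet> w = 0" "u \<times>\<^sub>3 w = m \<or> u \<times>\<^sub>3 w = - m"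
    "range (plane_map p u w) = {x. m \<bullet> x = c}"
    "plane_area {x. m \<bullet> x = c} = distr lborel borel (plane_map p u w)"
    by (rule plane_areaE[OF m(1), of c], rule that; assumption)
  define M :: "real ^ 2 \<Rightarrow> real ^ 2" where
    "M z = vector [z $ 1 * u $ k + z $ 2 * w $ k, z $ 1 * u $ l + z $ 2 * w $ l]" for z
  define q :: "real ^ 2" where "q = vector [p $ k, p $ l]"
  have lin: "linear M" by (rule linearI) (auto simp: M_def vec_eq_iff forall_2 algebra_simps)
  have "det (matrix M) = u $ k * w $ l - w $ k * u $ l"
    by (simp add: det_2 matrix_def M_def axis_def)
  then have det: "\<bar>det (matrix M)\<bar> = \<bar>m $ j\<bar>" using *(4) cross[of u w] by auto
  \<comment> \<open>Lifting the projected point back into the plane recovers the point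
    itself.\<close>
  have coord: "coord_map j k l (q + M z, plane_height m c (q + M z)) = plane_map p u w z" (is "coord_map j k l ?z = _") for z
  proof -
    have "m \<bullet> plane_map p u w z = c" using *(5) by auto
    moreover have "coord_map j k l (q + M z, plane_map p u w z $ j) = plane_map p u w z"
      by (simp add: eq_jkl[OF jkl univ] coord_map_nth[OF jkl univ] q_def M_def plane_map_def)
    ultimately have "plane_map p u w z $ j = plane_height m c (q + M z)"
      using plane_height_iff[OF m(2), of "q + M z"] by metis
    then show ?thesis using \<open>coord_map j k l (q + M z, plane_map p u w z $ j) = plane_map p u w z\<close> by simp
  qed
  have [measurable]: "coord_map j k l \<in> borel_measurable borel" by (rule coord_map_measurable[OF jkl univ])
  have [measurable]: "plane_height m c \<in> borel_measurable borel"
    unfolding plane_height_def by (intro borel_measurable_continuous_onI continuous_intros) (use m in auto)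
  have [measurable]: "(\<lambda>y. (y, plane_height m c y)) \<in> borel_measurable borel"
    unfolding plane_height_def by (intro borel_measurable_continuous_onI continuous_intros) (use m in auto)
  have [measurable]: "(\<lambda>z. q + M z) \<in> borel_measurable borel"
    using lin linear_continuous_on[of M UNIV] linear_conv_bounded_linear
    by (intro borel_measurable_add) (auto intro: borel_measurable_continuous_onI)
  have "(\<lambda>y. G (coord_map j k l (y, plane_height m c y))) \<in> borel_measurable borel" (is "?H \<in> _") by measurable
  then have "(\<integral>y. ?H y \<partial>lborel) = (\<integral>y. ?H y \<partial>density (distr lborel borel (\<lambda>z. q + M z)) (\<lambda>_. ennreal \<bar>det (matrix M)\<bar>))"
    using lborel_affine_matrix[OF lin, of q] det m(2) by auto
  also have "\<dots> = (\<integral>z. \<bar>m $ j\<bar> * ?H (q + M z) \<partial>lborel)"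
    unfolding det by (subst integral_density) (auto simp: integral_distr)
  also have "\<dots> = (\<integral>z. \<bar>m $ j\<bar> * G (plane_map p u w z) \<partial>lborel)" by (simp add: coord)
  also have "\<dots> = (\<integral>x. G x * \<bar>m $ j\<bar> \<partial>plane_area {x. m \<bullet> x = c})"
    unfolding *(6) by (simp add: integral_distr mult.commute)
  finally show ?thesis .
qed

end

lemma is_plane_normal:
  assumes "\<forall>P\<in>A. is_plane P"
  obtains m c where "\<And>P. P \<in> A \<Longrightarrow> norm (m P) = 1" "\<And>P. P \<in> A \<Longrightarrow> {x. m P \<bullet> x = c P} = P"
  using assms unfolding is_plane_def by metis

context
  fixes j k l :: 3
  assumes jkl: "j \<noteq> k" "j \<noteq> l" "k \<noteq> l" and univ: "UNIV = {j, k, l}"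
begin

text \<open>For two planes, a combination of their equations eliminates the coordinate
  \<open>j\<close>; the equation of a plane parallel to direction \<open>j\<close> is free of it
  anyway. Either way the lines to be avoided have their base points \<open>y\<close> on the solution
  set of one linear equation, a null set.\<close>

lemma AE_line_generic:
  assumes A: "finite A" and m: "\<And>P. P \<in> A \<Longrightarrow> norm (m P) = 1" "\<And>P. P \<in> A \<Longrightarrow> {x. m P \<bullet> x = c P} = P"
  shows "AE y in lborel. \<forall>P\<in>A. \<forall>Q\<in>A. \<forall>s. P \<noteq> Q \<or> m P $ j = 0 \<longrightarrow>
      coord_map j k l (y, s) \<notin> P \<inter> Q"
proof (intro AE_finite_allI A)
  fix P Q assume PQ: "P \<in> A" "Q \<in> A"
  define a where "a = m Q $ j *\<^sub>R m P - m P $ j *\<^sub>R m Q"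
  define b where "b = m Q $ j * c P - m P $ j * c Q"
  define a' :: "point" where "a' = (if m P $ j = 0 then m P else a)"
  define b' where "b' = (if m P $ j = 0 then c P else b)"
  define d :: "real ^ 2" where "d = vector [a' $ k, a' $ l]"
  have a'j: "a' $ j = 0" by (simp add: a'_def a_def mult.commute)
  have d: "a' \<bullet> coord_map j k l (y, s) = d \<bullet> y" for y s
    using a'j by (simp add: inner_jkl[OF jkl univ] coord_map_nth[OF jkl univ] d_def inner_real2)
  have on: "a' \<bullet> x = b'" if "x \<in> P" "x \<in> Q" for x
  proof -
    have "x \<in> {x. m P \<bullet> x = c P}" "x \<in> {x. m Q \<bullet> x = c Q}" using that m(2) PQ by blast+
    then have "m P \<bullet> x = c P" "m Q \<bullet> x = c Q" by simp_all
    then show ?thesis by (simp add: a'_def b'_def a_def b_def inner_diff_left)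
  qed
  show "AE y in lborel. \<forall>s. P \<noteq> Q \<or> m P $ j = 0 \<longrightarrow> coord_map j k l (y, s) \<notin> P \<inter> Q"
  proof (cases "P \<noteq> Q \<or> m P $ j = 0")
    case True
    \<comment> \<open>If the resulting equation were trivial, the equations of the two planes would
      be proportional and the planes equal.\<close>
    have "d \<noteq> 0 \<or> b' \<noteq> 0"
    proof (rule ccontr)
      assume "\<not> ?thesis"
      then have "d $ 1 = 0" "d $ 2 = 0" and b': "b' = 0" by auto
      then have "a' = 0" using a'j by (simp add: eq_jkl[OF jkl univ] d_def)
      have mP: "m P $ j \<noteq> 0" using \<open>a' = 0\<close> m(1)[OF PQ(1)] by (auto simp: a'_def)
      then have "a = 0" "b = 0" using \<open>a' = 0\<close> b' by (auto simp: a'_def b'_def)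
      define t where "t = m Q $ j / m P $ j"
      have mQ: "m Q = t *\<^sub>R m P"
        using \<open>a = 0\<close> mP by (auto simp: a_def t_def vec_eq_iff field_simps)
      have cQ: "c Q = t * c P" using \<open>b = 0\<close> mP by (simp add: b_def t_def field_simps)
      have "t \<noteq> 0" using mQ m(1)[OF PQ(2)] by auto
      then have "{x. m P \<bullet> x = c P} = {x. m Q \<bullet> x = c Q}" by (simp add: mQ cQ)
      then have "P = Q" using m(2)[OF PQ(1)] m(2)[OF PQ(2)] by simp
      then show False using True mP by simp
    qed
    then have "negligible {y. d \<bullet> y = b'}" by (rule negligible_hyperplane)
    then have "emeasure lborel {y. d \<bullet> y = b'} = 0"
      by (rule emeasure_lborel_negligible_closed[OF closed_hyperplane])
    then have "AE y in lborel. y \<notin> {y. d \<bullet> y = b'}"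
      by (intro AE_not_in) (simp add: null_sets_def closed_hyperplane)
    then show ?thesis
    proof eventually_elim
      case (elim y)
      then show ?case using on[of "coord_map j k l (y, s)" for s] d by auto
    qed
  qed simp
qed

text \<open>On a generic line the parameters in \<open>K\<close> form a compact set, whose boundary
  consists of the parameters where the line meets the boundary of \<open>K\<close>. Each of them
  belongs to exactly one plane of \<open>A\<close>, which is transversal to the line: this gives the
  sign needed for \<open>one_sided\<close> and an enumeration of the end points by planes.\<close>

lemma line_integral:
  fixes f g :: "point \<Rightarrow> real"
  assumes K: "compact K" "regular_closed K"
    and A: "finite A" "\<And>P. P \<in> A \<Longrightarrow> norm (m P) = 1" "\<And>P. P \<in> A \<Longrightarrow> {x. m P \<bullet> x = c P} = P" "frontier K \<subseteq> \<Union>A"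
    and f: "continuous_on K f" "continuous_on K g"
      "\<And>x. x \<in> interior K \<Longrightarrow> ((\<lambda>s. f (x + s *\<^sub>R axis j 1)) has_real_derivative g x) (at 0)"
    and y: "\<forall>P\<in>A. \<forall>Q\<in>A. \<forall>s. P \<noteq> Q \<or> m P $ j = 0 \<longrightarrow> coord_map j k l (y, s) \<notin> P \<inter> Q"
  defines "X \<equiv> \<lambda>P. coord_map j k l (y, plane_height j k l (m P) (c P) y)"
  shows "(LINT s|lborel. indicator K (coord_map j k l (y, s)) * g (coord_map j k l (y, s)))
    = (\<Sum>P\<in>{P\<in>A. m P $ j \<noteq> 0}. indicator (frontier K) (X P) * (sgn (outer_normal K (X P) $ j) * f (X P)))"
proof -
  define L where "L s = coord_map j k l (y, s)" for s
  define B where "B = {s. L s \<in> K}"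
  define A1 where "A1 = {P\<in>A. m P $ j \<noteq> 0}"
  define h where "h P = plane_height j k l (m P) (c P) y" for P
  define \<sigma> where "\<sigma> s = outer_normal K (L s) $ j" for s
  have clK: "closed K" using K by (simp add: compact_imp_closed)
  have L_cont: "continuous_on S L" for S
    unfolding L_def by (intro continuous_on_compose2[OF coord_map_continuous[OF jkl univ, of UNIV]] continuous_intros) auto
  have L_tr: "L s = L s0 + (s - s0) *\<^sub>R axis j 1" for s s0
    unfolding L_def by (rule coord_map_translate[OF jkl univ])
  have L_dist: "dist (L s) (L s0) = \<bar>s - s0\<bar>" for s s0
    using L_tr[of s s0] by (simp add: dist_norm norm_axis_1)
  have height: "L s \<in> P \<longleftrightarrow> s = h P" if "P \<in> A1" for s P
  proof -
    have P: "{x. m P \<bullet> x = c P} = P" "m P $ j \<noteq> 0" using that A(3) by (simp_all add: A1_def)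
    have "L s \<in> P \<longleftrightarrow> m P \<bullet> L s = c P" by (subst P(1)[symmetric]) simp
    then show ?thesis using plane_height_iff[OF jkl univ P(2), of y s "c P"] by (simp add: L_def h_def)
  qed
  have fr_plane: "\<exists>P\<in>A1. s = h P \<and> (\<forall>Q\<in>A. Q \<noteq> P \<longrightarrow> L s \<notin> Q)" if "L s \<in> frontier K" for s
  proof -
    obtain P where P: "P \<in> A" "L s \<in> P" using A(4) \<open>L s \<in> frontier K\<close> by blast
    then have "m P $ j \<noteq> 0" using y by (auto simp: L_def)
    then have "P \<in> A1" using P by (simp add: A1_def)
    moreover have "\<forall>Q\<in>A. Q \<noteq> P \<longrightarrow> L s \<notin> Q" using y P by (auto simp: L_def)
    ultimately show ?thesis using height P by blast
  qed
  \<comment> \<open>At such a crossing, \<open>K\<close> is locally a half-space whose normal is not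
    orthogonal to the line, so that it cuts out a half-line.\<close>
  have loc: "\<sigma> s \<noteq> 0 \<and> (\<exists>r>0. \<forall>x. \<bar>x - s\<bar> < r \<longrightarrow> (x \<in> B \<longleftrightarrow> \<sigma> s * (x - s) \<le> 0))" if s: "L s \<in> frontier K" for s
  proof -
    obtain P where P: "P \<in> A1" "s = h P" "\<forall>Q\<in>A. Q \<noteq> P \<longrightarrow> L s \<notin> Q" using fr_plane[OF s] by blast
    have PA: "P \<in> A" "m P $ j \<noteq> 0" using P(1) by (auto simp: A1_def)
    have isP: "\<forall>P\<in>A. is_plane P" using A(2) A(3)[symmetric] unfolding is_plane_def by blast
    have LP: "L s \<in> P" using height P by simp
    obtain n where n: "halfspace_at K (L s) n" "n $ j \<noteq> 0"
      by (rule outer_normal_at_only_plane[OF K(2) A(1) isP A(4) A(2)[OF PA(1)] A(3)[OF PA(1), symmetric] LP P(3) s])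
        (use PA(2) in \<open>auto intro: that\<close>)
    have \<sigma>: "\<sigma> s = n $ j" unfolding \<sigma>_def using outer_normal_eq[OF n(1)] by simp
    obtain r where r: "r > 0" "closure K \<inter> ball (L s) r = {z \<in> ball (L s) r. n \<bullet> (z - L s) \<le> 0}"
      using n(1) by (auto simp: halfspace_at_def)
    have "x \<in> B \<longleftrightarrow> \<sigma> s * (x - s) \<le> 0" if "\<bar>x - s\<bar> < r" for x
    proof -
      have Lx: "L x \<in> ball (L s) r" using that L_dist[of s x] by simp
      have "x \<in> B \<longleftrightarrow> L x \<in> closure K \<inter> ball (L s) r" using Lx clK by (simp add: B_def)
      also have "\<dots> \<longleftrightarrow> n \<bullet> (L x - L s) \<le> 0" unfolding r(2) using Lx by simp
      also have "n \<bullet> (L x - L s) = \<sigma> s * (x - s)"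
        using L_tr[of x s] by (simp add: \<sigma> inner_axis)
      finally show ?thesis .
    qed
    then show ?thesis using r(1) n(2) \<sigma> by auto
  qed
  have closedB: "closed B"
    unfolding B_def using continuous_closed_vimage[OF clK] L_cont by (metis continuous_on_eq_continuous_at open_UNIV UNIV_I vimage_def)
  have compB: "compact B"
  proof -
    obtain M where M: "\<And>x. x \<in> K \<Longrightarrow> norm x \<le> M" using compact_imp_bounded[OF K(1)] by (auto simp: bounded_iff)
    have "\<bar>s\<bar> \<le> M + norm (L 0)" if "s \<in> B" for s
      using M[of "L s"] that L_dist[of s 0] norm_triangle_ineq4[of "L s" "L 0"] by (simp add: B_def dist_norm)
    then have "bounded B" by (auto simp: bounded_iff)
    then show ?thesis using closedB by (simp add: compact_eq_bounded_closed)
  qed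
  have intB: "L s \<in> interior K" if "s \<in> B" "L s \<notin> frontier K" for s
    using that clK by (simp add: B_def frontier_def)
  have fr_iff: "s \<in> frontier B \<longleftrightarrow> L s \<in> frontier K" for s
  proof
    assume s: "s \<in> frontier B"
    show "L s \<in> frontier K"
    proof (rule ccontr)
      assume "L s \<notin> frontier K"
      moreover have "s \<in> B" using s closedB frontier_subset_closed by blast
      ultimately have "L s \<in> interior K" by (rule intB[rotated])
      then have "s \<in> L -` interior K" by simp
      moreover have "open (L -` interior K)" using L_cont open_vimage by blast
      moreover have "L -` interior K \<subseteq> B" using interior_subset by (auto simp: B_def)
      ultimately have "s \<in> interior B" by (metis interiorI)
      then show False using s by (simp add: frontier_def)
    qed
  next
    assume s: "L s \<in> frontier K"
    then have sB: "s \<in> B" using clK frontier_subset_closed by (auto simp: B_def)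
    obtain r where r: "r > 0" "\<forall>x. \<bar>x - s\<bar> < r \<longrightarrow> (x \<in> B \<longleftrightarrow> \<sigma> s * (x - s) \<le> 0)" and \<sigma>: "\<sigma> s \<noteq> 0"
      using loc[OF s] by blast
    show "s \<in> frontier B"
      unfolding frontier_straddle mem_Collect_eq
    proof (intro allI impI conjI)
      fix e :: real assume e: "e > 0"
      show "\<exists>x\<in>B. dist s x < e" using sB e by (intro bexI[of _ s]) auto
      \<comment> \<open>A short step in the direction of the sign of \<open>\<sigma> s\<close>
        leaves \<open>B\<close>.\<close>
      define x where "x = s + sgn (\<sigma> s) * (min e r / 2)"
      have "\<bar>x - s\<bar> = min e r / 2" using e r(1) \<sigma> by (simp add: x_def abs_mult abs_sgn_eq)
      moreover have "\<sigma> s * (x - s) = \<bar>\<sigma> s\<bar> * (min e r / 2)" by (simp add: x_def abs_sgn mult.assoc)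
      moreover have "\<bar>\<sigma> s\<bar> * (min e r / 2) > 0" using e r(1) \<sigma> by (intro mult_pos_pos) auto
      moreover have "min e r / 2 < r" "min e r / 2 < e" using e r(1) by (auto simp: min_def)
      ultimately have "\<bar>x - s\<bar> < r" "\<bar>x - s\<bar> < e" "\<not> \<sigma> s * (x - s) \<le> 0" by linarith+
      then have "x \<notin> B" "dist s x < e" using r(2) by (auto simp: dist_real_def abs_minus_commute)
      then show "\<exists>x. x \<notin> B \<and> dist s x < e" by blast
    qed
  qed
  have osB: "one_sided B \<sigma>" unfolding one_sided_def using fr_iff loc by blast
  have fin: "finite A1" using A(1) by (simp add: A1_def)
  have frB: "frontier B = h ` {P\<in>A1. L (h P) \<in> frontier K}"
  proof
    show "frontier B \<subseteq> h ` {P\<in>A1. L (h P) \<in> frontier K}"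
    proof
      fix s assume "s \<in> frontier B"
      then have s: "L s \<in> frontier K" using fr_iff by blast
      then obtain P where "P \<in> A1" "s = h P" using fr_plane by blast
      with s show "s \<in> h ` {P\<in>A1. L (h P) \<in> frontier K}" by blast
    qed
  qed (use fr_iff in auto)
  have inj: "inj_on h {P\<in>A1. L (h P) \<in> frontier K}"
  proof (rule inj_onI)
    fix P Q assume "P \<in> {P\<in>A1. L (h P) \<in> frontier K}" "Q \<in> {P\<in>A1. L (h P) \<in> frontier K}" "h P = h Q"
    then have "P \<in> A1" "Q \<in> A1" "L (h P) \<in> P" "L (h P) \<in> Q" using height by auto
    then show "P = Q" using y unfolding A1_def L_def by blast
  qed
  have "(LINT s:B|lborel. g (L s)) = (\<Sum>s\<in>frontier B. sgn (\<sigma> s) * f (L s))"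
  proof (rule integral_derivative_one_sided[OF compB _ osB])
    show "finite (frontier B)" using frB fin by simp
    show "continuous_on B (\<lambda>s. f (L s))" "continuous_on B (\<lambda>s. g (L s))"
      by (rule continuous_on_compose2[OF f(1) L_cont] continuous_on_compose2[OF f(2) L_cont]; auto simp: B_def)+
    fix s assume s: "s \<in> interior B"
    then have "L s \<notin> frontier K" using fr_iff[of s] by (simp add: frontier_def)
    then have "L s \<in> interior K" using s interior_subset intB by blast
    from f(3)[OF this] have "((\<lambda>x. f (L s + x *\<^sub>R axis j 1)) has_real_derivative g (L s)) (at (s + - s))" by simp
    then have "((\<lambda>x. f (L s + (x - s) *\<^sub>R axis j 1)) has_real_derivative g (L s)) (at s)"
      by (simp only: DERIV_shift) simp
    then show "((\<lambda>s. f (L s)) has_real_derivative g (L s)) (at s)"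
      by (simp only: L_tr[of _ s, symmetric])
  qed
  also have "\<dots> = (\<Sum>P\<in>{P\<in>A1. L (h P) \<in> frontier K}. sgn (\<sigma> (h P)) * f (L (h P)))"
    unfolding frB by (rule sum.reindex[OF inj, unfolded o_def])
  also have "\<dots> = (\<Sum>P\<in>A1. indicator (frontier K) (L (h P)) * (sgn (\<sigma> (h P)) * f (L (h P))))"
    using fin by (intro sum.mono_neutral_cong_left) (auto simp: indicator_def)
  finally show ?thesis
    by (simp add: set_lebesgue_integral_def B_def L_def h_def \<sigma>_def X_def A1_def indicator_def)
qed

end

section \<open>The divergence theorem in one coordinate direction\<close>

text \<open>\<open>line_integral\<close> is integrated over all base points, and the sum over
  crossings is returned to area integrals by \<open>integral_plane_height\<close>. The Jacobian
  arising there completes the sign of the normal component to the component itself, which is why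
  \<open>G\<close> carries only \<open>sgn\<close>.\<close>

lemma integral_derivative_direction:
  fixes f g :: "point \<Rightarrow> real" and j :: 3
  assumes K: "compact K" "regular_closed K"
    and A: "finite A" "\<forall>P\<in>A. is_plane P" "frontier K \<subseteq> \<Union>A"
    and f: "continuous_on K f" "continuous_on K g"
      "\<And>x. x \<in> interior K \<Longrightarrow> ((\<lambda>s. f (x + s *\<^sub>R axis j 1)) has_real_derivative g x) (at 0)"
  shows "(LINT x:K|lborel. g x) = (\<Sum>P\<in>A. LINT x|plane_area P. indicator (frontier K) x * (outer_normal K x $ j * f x))"
proof -
  obtain k l where jkl: "j \<noteq> k" "j \<noteq> l" "k \<noteq> l" "UNIV = {j, k, l}"
    and cross: "\<And>u w :: point. (u \<times>\<^sub>3 w) $ j = u $ k * w $ l - w $ k * u $ l"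
    by (rule coordinate_triple[of j], rule that; assumption)
  obtain m c where m: "\<And>P. P \<in> A \<Longrightarrow> norm (m P) = 1" "\<And>P. P \<in> A \<Longrightarrow> {x. m P \<bullet> x = c P} = P"
    using is_plane_normal[OF A(2)] by metis
  define X where "X P y = coord_map j k l (y, plane_height j k l (m P) (c P) y)" for P y
  define G where "G x = indicator (frontier K) x * (sgn (outer_normal K x $ j) * f x)" for x
  define A1 where "A1 = {P\<in>A. m P $ j \<noteq> 0}"
  have clK: "closed K" using K by (simp add: compact_imp_closed)
  have frK: "frontier K \<subseteq> K" using clK frontier_subset_closed by blast
  have compF: "compact (frontier K)" using K(1) by (rule compact_frontier)
  have [measurable]: "frontier K \<in> sets borel" by (intro borel_closed frontier_closed)
  have N[measurable]: "(\<lambda>x. indicator (frontier K) x * outer_normal K x $ j) \<in> borel_measurable borel"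
    by (rule outer_normal_nth_measurable[OF clK])
  have "(\<lambda>x. indicator (frontier K) x *\<^sub>R f x) \<in> borel_measurable borel"
    using f(1) frK by (intro borel_measurable_continuous_on_indicator) (auto intro: continuous_on_subset)
  then have [measurable]: "(\<lambda>x. indicator (frontier K) x * f x) \<in> borel_measurable borel" by simp
  \<comment> \<open>With an indicator inside \<open>sgn\<close>, only functions of known
    measurability occur; off the boundary both sides are zero.\<close>
  have "G = (\<lambda>x. sgn (indicator (frontier K) x * outer_normal K x $ j) * (indicator (frontier K) x * f x))"
    by (auto simp: G_def indicator_def)
  also have "\<dots> \<in> borel_measurable borel" by measurable
  finally have G[measurable]: "G \<in> borel_measurable borel" .
  obtain B where B: "\<And>x. x \<in> frontier K \<Longrightarrow> \<bar>f x\<bar> \<le> B" "B \<ge> 0"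
  proof -
    have "bounded (f ` frontier K)"
      using compF f(1) frK by (intro compact_imp_bounded compact_continuous_image) (auto intro: continuous_on_subset)
    then show ?thesis using that by (force simp: bounded_iff intro: order_trans[OF _ abs_ge_self])
  qed
  have GB: "\<bar>G x\<bar> \<le> B" "x \<notin> frontier K \<Longrightarrow> G x = 0" for x
    using B by (auto simp: G_def indicator_def abs_mult abs_sgn_eq)
  have X_cont: "continuous_on UNIV (X P)" for P
  proof -
    \<comment> \<open>As a product with \<open>inverse\<close>, the height is visibly continuous
      also for planes parallel to direction \<open>j\<close>, where division by zero makes it the
      constant 0.\<close>
    have "plane_height j k l (m P) (c P) = (\<lambda>y. (c P - m P $ k * y $ 1 - m P $ l * y $ 2) * inverse (m P $ j))"
      by (simp add: fun_eq_iff plane_height_def[OF jkl] divide_inverse)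
    then have "continuous_on UNIV (\<lambda>y. plane_height j k l (m P) (c P) y)"
      by (simp only:) (intro continuous_intros)
    then show ?thesis
      unfolding X_def
      by (intro continuous_on_compose2[OF coord_map_continuous[OF jkl, of UNIV]] continuous_intros) auto
  qed
  have int_G: "integrable lborel (\<lambda>y. G (X P y))" for P
  proof (rule integrableI_bounded_set[where A="X P -` frontier K" and B=B])
    have "closed (X P -` frontier K)" using X_cont by (metis closed_vimage frontier_closed)
    then show "X P -` frontier K \<in> sets lborel" by simp
    obtain M where M: "\<And>x. x \<in> frontier K \<Longrightarrow> norm x \<le> M" using compact_imp_bounded[OF compF] by (auto simp: bounded_iff)
    \<comment> \<open>The coordinates of \<open>y\<close> are the components \<open>k\<close> and
      \<open>l\<close> of \<open>X P y\<close>, so a bounded boundary confines \<open>y\<close> as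
      well.\<close>
    have "norm y \<le> 2 * M" if "X P y \<in> frontier K" for y
    proof -
      have "\<bar>y $ 1\<bar> \<le> norm (X P y)" "\<bar>y $ 2\<bar> \<le> norm (X P y)"
        using component_le_norm_cart[of "X P y" k] component_le_norm_cart[of "X P y" l]
        by (simp_all add: X_def coord_map_nth[OF jkl])
      moreover have "norm y \<le> \<bar>y $ 1\<bar> + \<bar>y $ 2\<bar>" using norm_le_l1_cart[of y] by (simp add: sum_2)
      ultimately show ?thesis using M[OF that] by linarith
    qed
    then have "bounded (X P -` frontier K)" by (auto simp: bounded_iff)
    then show "emeasure lborel (X P -` frontier K) < \<infinity>" by (rule emeasure_bounded_finite)
    have "X P \<in> borel_measurable borel" using X_cont by (rule borel_measurable_continuous_onI)
    then show "(\<lambda>y. G (X P y)) \<in> borel_measurable lborel" by measurable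
  qed (use GB in auto)
  have ae: "AE y in lborel. \<forall>P\<in>A. \<forall>Q\<in>A. \<forall>s. P \<noteq> Q \<or> m P $ j = 0 \<longrightarrow> coord_map j k l (y, s) \<notin> P \<inter> Q"
    by (rule AE_line_generic[OF jkl A(1)]) (use m in auto)
  have "integrable lborel (\<lambda>x. indicator K x * g x)"
    using borel_integrable_compact[OF K(1) f(2)] by simp
  then have "(LINT x:K|lborel. g x) = (\<integral>y. (\<integral>s. indicator K (coord_map j k l (y, s)) * g (coord_map j k l (y, s)) \<partial>lborel) \<partial>lborel)"
    unfolding set_lebesgue_integral_def by (simp add: integral_coord_map[OF jkl])
  also have "\<dots> = (\<integral>y. (\<Sum>P\<in>A1. G (X P y)) \<partial>lborel)"
  proof (rule integral_cong_AE)
    have "(\<lambda>x. indicator K x * g x) \<in> borel_measurable borel"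
      using \<open>integrable lborel (\<lambda>x. indicator K x * g x)\<close> by simp
    then have "(\<lambda>z. indicator K (coord_map j k l z) * g (coord_map j k l z)) \<in> borel_measurable (borel :: ((real^2) \<times> real) measure)"
      using coord_map_measurable[OF jkl] by measurable
    then show "(\<lambda>y. \<integral>s. indicator K (coord_map j k l (y, s)) * g (coord_map j k l (y, s)) \<partial>lborel) \<in> borel_measurable lborel"
      by (intro lborel.borel_measurable_lebesgue_integral) (simp add: lborel_prod case_prod_beta')
    show "(\<lambda>y. \<Sum>P\<in>A1. G (X P y)) \<in> borel_measurable lborel"
      using int_G by (intro borel_measurable_sum) auto
    show "AE y in lborel. (\<integral>s. indicator K (coord_map j k l (y, s)) * g (coord_map j k l (y, s)) \<partial>lborel) = (\<Sum>P\<in>A1. G (X P y))"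
      using ae
    proof eventually_elim
      case (elim y)
      show ?case
        by (rule trans[OF line_integral[OF jkl K A(1) _ _ A(3) f elim]])
          (simp_all add: m G_def X_def A1_def)
    qed
  qed
  also have "\<dots> = (\<Sum>P\<in>A1. \<integral>y. G (X P y) \<partial>lborel)"
    by (intro Bochner_Integration.integral_sum int_G)
  also have "\<dots> = (\<Sum>P\<in>A1. LINT x|plane_area P. indicator (frontier K) x * (outer_normal K x $ j * f x))"
  proof (rule sum.cong[OF refl])
    fix P assume "P \<in> A1"
    then have P: "P \<in> A" "m P $ j \<noteq> 0" by (auto simp: A1_def)
    have "(\<integral>y. G (X P y) \<partial>lborel) = (\<integral>x. G x * \<bar>m P $ j\<bar> \<partial>plane_area P)"
      unfolding X_def using integral_plane_height[OF jkl cross m(1)[OF P(1)] P(2) G, of "c P"] m(2)[OF P(1)] by simp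
    also have "\<dots> = (LINT x|plane_area P. indicator (frontier K) x * (outer_normal K x $ j * f x))"
    proof (rule integral_cong_AE)
      show "AE x in plane_area P. G x * \<bar>m P $ j\<bar> = indicator (frontier K) x * (outer_normal K x $ j * f x)"
        using AE_plane_area_only[OF A(1,2) bspec[OF A(2) P(1)]]
      proof eventually_elim
        case (elim x)
        show ?case
        proof (cases "x \<in> frontier K")
          case True
          obtain n where n: "halfspace_at K x n" "n = m P \<or> n = - m P"
            using outer_normal_at_only_plane[OF K(2) A m(1)[OF P(1)] m(2)[OF P(1), symmetric] _ _ True] elim by metis
          then have "sgn (outer_normal K x $ j) * \<bar>m P $ j\<bar> = outer_normal K x $ j"
            using outer_normal_eq[OF n(1)] by (auto simp: sgn_if)
          then show ?thesis using True by (simp add: G_def mult.commute mult.left_commute)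
        qed (simp add: G_def)
      qed
      have "(\<lambda>x. (indicator (frontier K) x * outer_normal K x $ j) * (indicator (frontier K) x * f x)) \<in> borel_measurable borel"
        by measurable
      also have "(\<lambda>x. (indicator (frontier K) x * outer_normal K x $ j) * (indicator (frontier K) x * f x))
        = (\<lambda>x. indicator (frontier K) x * (outer_normal K x $ j * f x))" by (auto simp: indicator_def)
      finally show "(\<lambda>x. indicator (frontier K) x * (outer_normal K x $ j * f x)) \<in> borel_measurable (plane_area P)"
        by (simp cong: measurable_cong_sets)
    qed (simp cong: measurable_cong_sets)
    finally show "(\<integral>y. G (X P y) \<partial>lborel) = (LINT x|plane_area P. indicator (frontier K) x * (outer_normal K x $ j * f x))" .
  qed
  \<comment> \<open>The planes parallel to direction \<open>j\<close> may be added: their normal has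
    no \<open>j\<close>-th component, so their integrands vanish almost everywhere.\<close>
  also have "\<dots> = (\<Sum>P\<in>A. LINT x|plane_area P. indicator (frontier K) x * (outer_normal K x $ j * f x))"
  proof (rule sum.mono_neutral_left[OF A(1)])
    show "\<forall>P\<in>A - A1. (LINT x|plane_area P. indicator (frontier K) x * (outer_normal K x $ j * f x)) = 0"
    proof
      fix P assume "P \<in> A - A1"
      then have P: "P \<in> A" "m P $ j = 0" by (auto simp: A1_def)
      show "(LINT x|plane_area P. indicator (frontier K) x * (outer_normal K x $ j * f x)) = 0"
      proof (rule integral_eq_zero_AE)
        show "AE x in plane_area P. indicator (frontier K) x * (outer_normal K x $ j * f x) = 0"
          using AE_plane_area_only[OF A(1,2) bspec[OF A(2) P(1)]]
        proof eventually_elim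
          case (elim x)
          show ?case
          proof (cases "x \<in> frontier K")
            case True
            obtain n where n: "halfspace_at K x n" "n = m P \<or> n = - m P"
              using outer_normal_at_only_plane[OF K(2) A m(1)[OF P(1)] m(2)[OF P(1), symmetric] _ _ True] elim by metis
            then have "outer_normal K x $ j = 0" using outer_normal_eq[OF n(1)] P(2) by auto
            then show ?thesis by simp
          qed simp
        qed
      qed
    qed
  qed (auto simp: A1_def)
  finally show ?thesis .
qed

subsection \<open>Surface-time integrals\<close>

text \<open>A class of integrands that is closed under sums and products and, over a Borel set of
  finite measure, implies integrability. Measurability is taken relative to \<open>D\<close> because
  fields and normals are arbitrary elsewhere.\<close>

definition bdd_meas_on :: "'a::topological_space set \<Rightarrow> ('a \<Rightarrow> 'b::euclidean_space) \<Rightarrow> bool" where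
  "bdd_meas_on D h \<longleftrightarrow> h \<in> borel_measurable (restrict_space borel D) \<and> bounded (h ` D)"

lemma bdd_meas_on_indicator:
  assumes "bdd_meas_on D h" "D \<in> sets borel"
  shows "(\<lambda>z. indicator D z *\<^sub>R h z) \<in> borel_measurable borel"
  using assms by (subst (asm) bdd_meas_on_def) (simp add: borel_measurable_restrict_space_iff mult.commute)

lemma bdd_meas_on_continuous:
  "compact D \<Longrightarrow> continuous_on D h \<Longrightarrow> bdd_meas_on D h"
  unfolding bdd_meas_on_def
  by (intro conjI borel_measurable_continuous_on_restrict compact_imp_bounded compact_continuous_image)

lemma bdd_meas_on_subset: "bdd_meas_on D h \<Longrightarrow> D' \<subseteq> D \<Longrightarrow> bdd_meas_on D' h"
  unfolding bdd_meas_on_def using measurable_restrict_mono bounded_subset image_mono by metis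

lemma bdd_meas_on_cong: "(\<And>z. z \<in> D \<Longrightarrow> h z = h' z) \<Longrightarrow> bdd_meas_on D h \<longleftrightarrow> bdd_meas_on D h'"
  unfolding bdd_meas_on_def
  by (intro conj_cong measurable_cong arg_cong[where f=bounded] image_cong) (auto simp: space_restrict_space)

lemma bdd_meas_on_const: "bdd_meas_on D (\<lambda>z. c)"
  unfolding bdd_meas_on_def by (auto simp: bounded_iff)

lemma bdd_meas_on_add:
  fixes f g :: "'a::topological_space \<Rightarrow> 'b::euclidean_space"
  shows "bdd_meas_on D f \<Longrightarrow> bdd_meas_on D g \<Longrightarrow> bdd_meas_on D (\<lambda>z. f z + g z)"
  unfolding bdd_meas_on_def by (auto intro!: borel_measurable_add bounded_plus_comp)

lemma bdd_meas_on_diff: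
  fixes f g :: "'a::topological_space \<Rightarrow> 'b::euclidean_space"
  shows "bdd_meas_on D f \<Longrightarrow> bdd_meas_on D g \<Longrightarrow> bdd_meas_on D (\<lambda>z. f z - g z)"
  unfolding bdd_meas_on_def by (auto intro!: borel_measurable_diff bounded_minus_comp)

text \<open>Covers inner, scalar and cross products at once: a bounded bilinear map is jointly
  continuous and takes bounded pairs to bounded values.\<close>

lemma bdd_meas_on_bilinear:
  fixes f :: "'a::topological_space \<Rightarrow> 'b::euclidean_space" and g :: "'a \<Rightarrow> 'c::euclidean_space"
    and h :: "'b \<Rightarrow> 'c \<Rightarrow> 'd::euclidean_space"
  assumes h: "bounded_bilinear h" and f: "bdd_meas_on D f" "bdd_meas_on D g"
  shows "bdd_meas_on D (\<lambda>z. h (f z) (g z))"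
  unfolding bdd_meas_on_def
proof
  show "(\<lambda>z. h (f z) (g z)) \<in> borel_measurable (restrict_space borel D)"
  proof (rule borel_measurable_continuous_Pair[where H=h])
    show "continuous_on UNIV (\<lambda>x. h (fst x) (snd x))"
      by (intro bounded_bilinear.continuous_on[OF h] continuous_intros)
  qed (use f in \<open>auto simp: bdd_meas_on_def\<close>)
  obtain B C where BC: "\<And>z. z \<in> D \<Longrightarrow> norm (f z) \<le> B" "\<And>z. z \<in> D \<Longrightarrow> norm (g z) \<le> C"
    using f unfolding bdd_meas_on_def bounded_iff by (metis imageI)
  obtain k where k: "\<And>x y. norm (h x y) \<le> norm x * norm y * k" "k \<ge> 0"
    using bounded_bilinear.nonneg_bounded[OF h] by auto
  have "norm (h (f z) (g z)) \<le> \<bar>B\<bar> * \<bar>C\<bar> * k" if "z \<in> D" for z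
  proof -
    have "norm (f z) * norm (g z) \<le> \<bar>B\<bar> * \<bar>C\<bar>"
      using BC[OF that] by (intro mult_mono) auto
    then show ?thesis using k by (meson mult_right_mono order_trans)
  qed
  then show "bounded ((\<lambda>z. h (f z) (g z)) ` D)" by (auto simp: bounded_iff)
qed

lemmas bdd_meas_on_inner = bdd_meas_on_bilinear[OF bounded_bilinear_inner]
lemmas bdd_meas_on_mult = bdd_meas_on_bilinear[OF bounded_bilinear_mult]
lemmas bdd_meas_on_scaleR = bdd_meas_on_bilinear[OF bounded_bilinear_scaleR]

lemma bounded_bilinear_cross3: "bounded_bilinear cross3"
  using bilinear_cross bilinear_conv_bounded_bilinear by blast

lemmas bdd_meas_on_cross = bdd_meas_on_bilinear[OF bounded_bilinear_cross3]

text \<open>Intended for functions given by choices or case distinctions, which are well-behaved on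
  each of finitely many Borel pieces.\<close>

lemma bdd_meas_on_piecewise:
  fixes h :: "'a::topological_space \<Rightarrow> 'b::euclidean_space"
  assumes "finite J" "D \<subseteq> (\<Union>i\<in>J. C i)" "\<And>i. i \<in> J \<Longrightarrow> C i \<in> sets borel" "\<And>i. i \<in> J \<Longrightarrow> bdd_meas_on (D \<inter> C i) h"
  shows "bdd_meas_on D h"
  unfolding bdd_meas_on_def
proof
  show "h \<in> borel_measurable (restrict_space borel D)"
  proof (rule measurable_piecewise_restrict[of "C ` J"])
    fix c assume "c \<in> C ` J"
    then obtain i where i: "i \<in> J" "c = C i" by blast
    then show "c \<inter> space (restrict_space borel D) \<in> sets (restrict_space borel D)"
      using assms(3)[of i] by (auto simp: space_restrict_space sets_restrict_space)
    show "h \<in> borel_measurable (restrict_space (restrict_space borel D) c)"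
      using assms(4)[OF i(1)] measurable_cong_sets[OF sets_restrict_restrict_space refl] i(2)
      unfolding bdd_meas_on_def by blast
  qed (use assms in \<open>auto simp: space_restrict_space countable_finite\<close>)
  have "h ` D \<subseteq> (\<Union>i\<in>J. h ` (D \<inter> C i))" using assms(2) by blast
  moreover have "bounded (\<Union>i\<in>J. h ` (D \<inter> C i))"
    using assms(1,4) by (auto simp: bdd_meas_on_def)
  ultimately show "bounded (h ` D)" using bounded_subset by blast
qed

lemma bdd_meas_on_fst:
  fixes f :: "'a::second_countable_topology \<Rightarrow> 'b::euclidean_space" and I :: "'c::second_countable_topology set"
  assumes "bdd_meas_on S f"
  shows "bdd_meas_on (S \<times> I) (\<lambda>z. f (fst z))"
  unfolding bdd_meas_on_def
proof
  have "fst \<in> measurable (restrict_space borel (S \<times> I)) (restrict_space borel S)"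
    by (intro measurable_restrict_space3 borel_measurable_continuous_onI continuous_on_fst continuous_on_id) auto
  then show "(\<lambda>z. f (fst z)) \<in> borel_measurable (restrict_space borel (S \<times> I))"
    using assms unfolding bdd_meas_on_def by (auto intro: measurable_compose)
  have "(\<lambda>z. f (fst z)) ` (S \<times> I) \<subseteq> f ` S" by auto
  then show "bounded ((\<lambda>z. f (fst z)) ` (S \<times> I))"
    using assms bounded_subset by (auto simp: bdd_meas_on_def)
qed

lemma bdd_meas_on_outer_normal: 
  assumes "closed K"
  shows "bdd_meas_on (frontier K) (outer_normal K)"
  unfolding bdd_meas_on_def
proof
  have "frontier K \<inter> space borel \<in> sets borel" by simp
  then show "outer_normal K \<in> borel_measurable (restrict_space borel (frontier K))"
    using outer_normal_measurable[OF assms] by (simp add: borel_measurable_restrict_space_iff)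
  show "bounded (outer_normal K ` frontier K)" using norm_outer_normal_le unfolding bounded_iff by blast
qed

abbreviation plane_time :: "point set \<Rightarrow> (point \<times> real) measure" where
  "plane_time P \<equiv> plane_area P \<Otimes>\<^sub>M lborel"

lemma sets_plane_time [measurable_cong]: "sets (plane_time P) = sets borel"
proof -
  have "sets (plane_time P) = sets (borel \<Otimes>\<^sub>M borel)" by (intro sets_pair_measure_cong) auto
  then show ?thesis unfolding borel_prod .
qed

lemma space_plane_time [simp]: "space (plane_time P) = UNIV"
  by (simp add: space_pair_measure)

lemma pair_sigma_finite_plane_time: "is_plane P \<Longrightarrow> pair_sigma_finite (plane_area P) lborel"
  unfolding pair_sigma_finite_def by (auto intro: sigma_finite_plane_area lborel.sigma_finite_measure_axioms)

lemma set_integrable_plane_time: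
  fixes h :: "point \<times> real \<Rightarrow> real"
  assumes "is_plane P" "bounded S" "S \<in> sets borel" "bdd_meas_on (S \<times> {a..b}) h"
  shows "set_integrable (plane_time P) (S \<times> {a..b}) h"
  unfolding set_integrable_def
proof -
  obtain B where B: "\<And>x. x \<in> S \<times> {a..b} \<Longrightarrow> norm (h x) \<le> B"
    using assms(4) by (auto simp: bdd_meas_on_def bounded_iff)
  have D: "S \<times> {a..b} \<in> sets borel"
    unfolding borel_prod[symmetric] by (intro pair_measureI assms(3)) simp
  show "integrable (plane_time P) (\<lambda>x. indicator (S \<times> {a..b}) x *\<^sub>R h x)"
  proof (rule integrableI_bounded_set[where A="S \<times> {a..b}" and B=B])
    show "S \<times> {a..b} \<in> sets (plane_time P)" unfolding sets_plane_time by (rule D)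
    show "(\<lambda>x. indicator (S \<times> {a..b}) x *\<^sub>R h x) \<in> borel_measurable (plane_time P)"
      using bdd_meas_on_indicator[OF assms(4) D] measurable_cong_sets[OF sets_plane_time refl] by blast
    have "emeasure (plane_time P) (S \<times> {a..b}) = emeasure (plane_area P) S * emeasure lborel {a..b}"
      using assms(3) by (intro lborel.emeasure_pair_measure_Times) auto
    also have "\<dots> < \<infinity>"
      using emeasure_plane_area_finite[OF assms(1-3)] emeasure_bounded_finite[of "{a..b}"]
      by (auto simp: ennreal_mult_less_top)
    finally show "emeasure (plane_time P) (S \<times> {a..b}) < \<infinity>" .
  qed (use B in \<open>auto simp: indicator_def\<close>)
qed

text \<open>Lets the surface integrals over all elements and over the domain run through the same
  family \<open>A\<close>. In a plane outside \<open>A\<close>, the set \<open>S\<close> has area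
  zero because the planes of \<open>A\<close> cover it; and a plane of \<open>A\<close> in which
  \<open>S\<close> has area zero contributes nothing.\<close>

lemma surface_time_integral_planes:
  assumes A: "finite A" "\<forall>P\<in>A. is_plane P" "S \<subseteq> \<Union>A" and S: "closed S"
  shows "surface_time_integral S {a..b} g = (\<Sum>P\<in>A. LINT z:(S \<times> {a..b})|plane_time P. g z)"
  unfolding surface_time_integral_def
proof (rule sum.mono_neutral_left[OF A(1)])
  have Sb: "S \<in> sets borel" using S by simp
  show "face_planes S \<subseteq> A"
  proof
    fix P assume "P \<in> face_planes S"
    then have P: "is_plane P" "emeasure (plane_area P) S \<noteq> 0" by (auto simp: face_planes_def is_plane_iff_affine)
    show "P \<in> A"
    proof (rule ccontr)
      assume "P \<notin> A"
      then have "(\<Union>Q\<in>A. Q) \<in> null_sets (plane_area P)"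
        using A(1,2) P(1) closed_is_plane emeasure_plane_area_other_plane[OF P(1)]
        by (intro null_sets.finite_UN) (auto simp: null_sets_def)
      moreover have "S \<subseteq> (\<Union>Q\<in>A. Q)" using A(3) by blast
      ultimately have "S \<in> null_sets (plane_area P)" using Sb null_sets_subset[of _ "plane_area P" S] by simp
      then show False using P(2) by auto
    qed
  qed
  show "\<forall>P\<in>A - face_planes S. (LINT z:(S \<times> {a..b})|plane_time P. g z) = 0"
  proof
    fix P assume P: "P \<in> A - face_planes S"
    then have "emeasure (plane_area P) S = 0" using A(2) by (auto simp: face_planes_def is_plane_iff_affine)
    then have "S \<in> null_sets (plane_area P)" using Sb by (auto simp: null_sets_def)
    then have "S \<times> {a..b} \<in> null_sets (plane_time P)"
      by (intro lborel.times_in_null_sets1) auto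
    then have "AE z in plane_time P. z \<notin> S \<times> {a..b}" by (rule AE_not_in)
    then show "(LINT z:(S \<times> {a..b})|plane_time P. g z) = 0"
      unfolding set_lebesgue_integral_def
      by (intro integral_eq_zero_AE) (auto elim!: eventually_mono simp: indicator_def)
  qed
qed

text \<open>Both orders of integration occur: space innermost for the curl terms, time innermost for
  the time derivatives.\<close>

lemma set_integral_slices:
  fixes g :: "'a::euclidean_space \<times> real \<Rightarrow> real"
  assumes "compact K" "continuous_on (K \<times> {a..b}) g"
  shows "(LINT z:(K \<times> {a..b})|lborel. g z) = (LINT s:{a..b}|lborel. (LINT x:K|lborel. g (x, s)))"
    and "(LINT z:(K \<times> {a..b})|lborel. g z) = (LINT x:K|lborel. (LINT s:{a..b}|lborel. g (x, s)))"
proof -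
  have "integrable lborel (\<lambda>z. indicator (K \<times> {a..b}) z *\<^sub>R g z)"
    using assms by (intro borel_integrable_compact compact_Times) auto
  then have int: "integrable (lborel \<Otimes>\<^sub>M lborel) (\<lambda>(x, s). indicator (K \<times> {a..b}) (x, s) *\<^sub>R g (x, s))"
    by (simp add: lborel_prod case_prod_beta')
  have "(LINT z:(K \<times> {a..b})|lborel. g z) = (\<integral>s. (\<integral>x. indicator {a..b} s * (indicator K x * g (x, s)) \<partial>lborel) \<partial>lborel)"
    using lborel_pair.integral_snd[OF int]
    by (simp add: set_lebesgue_integral_def lborel_prod case_prod_beta' indicator_times mult.assoc mult.left_commute)
  then show "(LINT z:(K \<times> {a..b})|lborel. g z) = (LINT s:{a..b}|lborel. (LINT x:K|lborel. g (x, s)))"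
    by (simp add: set_lebesgue_integral_def)
  have "(LINT z:(K \<times> {a..b})|lborel. g z) = (\<integral>x. (\<integral>s. indicator K x * (indicator {a..b} s * g (x, s)) \<partial>lborel) \<partial>lborel)"
    using lborel_pair.integral_fst[OF int]
    by (simp add: set_lebesgue_integral_def lborel_prod case_prod_beta' indicator_times mult.assoc)
  then show "(LINT z:(K \<times> {a..b})|lborel. g z) = (LINT x:K|lborel. (LINT s:{a..b}|lborel. g (x, s)))"
    by (simp add: set_lebesgue_integral_def)
qed

text \<open>\<open>integral_derivative_direction\<close> holds at each fixed time; Fubini's theorem
  on each \<open>plane_time P\<close> collects the time slices.\<close>

lemma integral_derivative_direction_time:
  fixes f g :: "point \<times> real \<Rightarrow> real" and j :: 3
  assumes K: "compact K" "regular_closed K"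
    and A: "finite A" "\<forall>P\<in>A. is_plane P" "frontier K \<subseteq> \<Union>A"
    and f: "continuous_on (K \<times> {a..b}) f" "continuous_on (K \<times> {a..b}) g"
      "\<And>x s. x \<in> interior K \<Longrightarrow> s \<in> {a..b} \<Longrightarrow> ((\<lambda>r. f (x + r *\<^sub>R axis j 1, s)) has_real_derivative g (x, s)) (at 0)"
  shows "(LINT z:(K \<times> {a..b})|lborel. g z)
    = (\<Sum>P\<in>A. LINT z:(frontier K \<times> {a..b})|plane_time P. outer_normal K (fst z) $ j * f z)"
proof -
  let ?h = "\<lambda>z. outer_normal K (fst z) $ j * f z"
  have clK: "closed K" using K by (simp add: compact_imp_closed)
  then have sub: "frontier K \<times> {a..b} \<subseteq> K \<times> {a..b}" using frontier_subset_closed by blast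
  have "bdd_meas_on (frontier K \<times> {a..b}) f"
    using bdd_meas_on_continuous[OF compact_Times[OF K(1) compact_Icc] f(1)] bdd_meas_on_subset[OF _ sub] by blast
  moreover have "bdd_meas_on (frontier K \<times> {a..b}) (\<lambda>z. outer_normal K (fst z) \<bullet> axis j 1)"
    by (intro bdd_meas_on_inner bdd_meas_on_const bdd_meas_on_fst bdd_meas_on_outer_normal clK)
  ultimately have "bdd_meas_on (frontier K \<times> {a..b}) (\<lambda>z. (outer_normal K (fst z) \<bullet> axis j 1) * f z)"
    by (intro bdd_meas_on_mult)
  then have h: "bdd_meas_on (frontier K \<times> {a..b}) ?h" by (simp add: inner_axis)
  have bF: "bounded (frontier K)" using K(1) compact_frontier compact_imp_bounded by blast
  have slice: "continuous_on K (\<lambda>x. u (x, s))" if "continuous_on (K \<times> {a..b}) u" "s \<in> {a..b}" for u :: "point \<times> real \<Rightarrow> real" and s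
    using that by (intro continuous_on_compose2[OF that(1)] continuous_intros) auto
  have int: "integrable (plane_time P) (\<lambda>(x, s). indicator (frontier K \<times> {a..b}) (x, s) *\<^sub>R ?h (x, s))" if "P \<in> A" for P
    using set_integrable_plane_time[OF _ bF _ h, of P] that A(2) by (simp add: set_integrable_def case_prod_beta')
  have eq: "(LINT z:(frontier K \<times> {a..b})|plane_time P. ?h z)
      = (\<integral>s. (\<integral>x. indicator (frontier K \<times> {a..b}) (x, s) *\<^sub>R ?h (x, s) \<partial>plane_area P) \<partial>lborel)" if "P \<in> A" for P
    using pair_sigma_finite.integral_snd[OF pair_sigma_finite_plane_time int[OF that]] that A(2)
    by (simp add: set_lebesgue_integral_def case_prod_beta')
  have "(LINT z:(K \<times> {a..b})|lborel. g z) = (LINT s:{a..b}|lborel. (LINT x:K|lborel. g (x, s)))"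
    by (rule set_integral_slices(1)[OF K(1) f(2)])
  also have "\<dots> = (\<integral>s. (\<Sum>P\<in>A. (\<integral>x. indicator (frontier K \<times> {a..b}) (x, s) *\<^sub>R ?h (x, s) \<partial>plane_area P)) \<partial>lborel)"
    unfolding set_lebesgue_integral_def[of lborel "{a..b}"]
  proof (rule Bochner_Integration.integral_cong[OF refl])
    fix s :: real
    show "indicator {a..b} s *\<^sub>R (LINT x:K|lborel. g (x, s))
      = (\<Sum>P\<in>A. (\<integral>x. indicator (frontier K \<times> {a..b}) (x, s) *\<^sub>R ?h (x, s) \<partial>plane_area P))"
    proof (cases "s \<in> {a..b}")
      case True
      then have "(LINT x:K|lborel. g (x, s)) = (\<Sum>P\<in>A. LINT x|plane_area P. indicator (frontier K) x * (outer_normal K x $ j * f (x, s)))"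
        by (intro integral_derivative_direction K A slice f)
      then show ?thesis using True by (simp add: indicator_times)
    qed (simp add: indicator_times)
  qed
  also have "\<dots> = (\<Sum>P\<in>A. \<integral>s. (\<integral>x. indicator (frontier K \<times> {a..b}) (x, s) *\<^sub>R ?h (x, s) \<partial>plane_area P) \<partial>lborel)"
    using pair_sigma_finite.integrable_snd[OF pair_sigma_finite_plane_time int] A(2)
    by (intro Bochner_Integration.integral_sum) auto
  also have "\<dots> = (\<Sum>P\<in>A. LINT z:(frontier K \<times> {a..b})|plane_time P. ?h z)"
    using eq by simp
  finally show ?thesis .
qed

subsection \<open>Energy and curl on one element\<close>

lemma set_integral_sum_finite:
  fixes f :: "'i \<Rightarrow> 'a \<Rightarrow> 'b::{banach, second_countable_topology}"
  assumes "\<And>i. i \<in> J \<Longrightarrow> set_integrable M S (f i)"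
  shows "(LINT x:S|M. (\<Sum>i\<in>J. f i x)) = (\<Sum>i\<in>J. LINT x:S|M. f i x)"
  using assms unfolding set_lebesgue_integral_def set_integrable_def scaleR_sum_right
  by (rule Bochner_Integration.integral_sum)

lemma smooth_onD:
  assumes "smooth_on D F"
  shows "continuous_on D F"
    and "z \<in> D \<Longrightarrow> (F has_derivative frechet_derivative F (at z within D)) (at z within D)"
    and "continuous_on D (\<lambda>z. frechet_derivative F (at z within D) d)"
proof -
  have "Ck_on 0 D F" "Ck_on (Suc 0) D F" using assms unfolding smooth_on_def by blast+
  then show "continuous_on D F"
    "z \<in> D \<Longrightarrow> (F has_derivative frechet_derivative F (at z within D)) (at z within D)"
    "continuous_on D (\<lambda>z. frechet_derivative F (at z within D) d)"
    using frechet_derivative_works by auto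
qed

text \<open>The chain rule for a derivative relative to \<open>D\<close>, valid because the curve
  stays in \<open>D\<close>. Partial derivatives of fields on a closed space-time element are
  obtained from it.\<close>

lemma has_vector_derivative_along:
  fixes F :: "'a::real_normed_vector \<Rightarrow> 'b::real_normed_vector"
  assumes "(F has_derivative F') (at (\<gamma> r) within D)" "(\<gamma> has_vector_derivative d) (at r within U)" "\<gamma> ` U \<subseteq> D"
  shows "((\<lambda>r. F (\<gamma> r)) has_vector_derivative F' d) (at r within U)"
proof -
  have "(F has_derivative F') (at (\<gamma> r) within \<gamma> ` U)" using assms(1,3) by (rule has_derivative_subset)
  then have "((\<lambda>r. F (\<gamma> r)) has_derivative (\<lambda>h. F' (h *\<^sub>R d))) (at r within U)"
    using has_derivative_in_compose[of \<gamma> "\<lambda>h. h *\<^sub>R d" r U F F'] assms(2)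
    by (simp add: has_vector_derivative_def)
  moreover have "F' (h *\<^sub>R d) = h *\<^sub>R F' d" for h
    using has_derivative_linear[OF assms(1)] linear_scale by blast
  ultimately show ?thesis by (simp add: has_vector_derivative_def)
qed

text \<open>A line through an interior point stays in \<open>K\<close> for small \<open>r\<close>,
  so the derivative relative to the closed element becomes an ordinary two-sided one.\<close>

lemma dx_derivative:
  assumes "smooth_on (K \<times> {a..b}) F" "x \<in> interior K" "s \<in> {a..b}"
  shows "((\<lambda>r. F (x + r *\<^sub>R axis j 1, s)) has_vector_derivative dx (K \<times> {a..b}) j F (x, s)) (at 0)"
proof -
  let ?g = "\<lambda>r :: real. (x + r *\<^sub>R axis j 1, s)"
  let ?U = "(\<lambda>r :: real. x + r *\<^sub>R axis j 1) -` interior K"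
  have "open ?U" by (intro open_vimage open_interior continuous_intros)
  moreover have "0 \<in> ?U" using assms(2) by simp
  ultimately have at: "at 0 within ?U = at 0" by (rule at_within_open[rotated])
  have g1: "(?g has_vector_derivative (axis j 1, 0)) (at 0 within ?U)"
    by (auto intro!: derivative_eq_intros simp: has_vector_derivative_def)
  have g2: "?g ` ?U \<subseteq> K \<times> {a..b}" using assms(3) interior_subset by auto
  have g3: "?g 0 \<in> K \<times> {a..b}" using assms(2,3) interior_subset by auto
  have "((\<lambda>r. F (?g r)) has_vector_derivative frechet_derivative F (at (?g 0) within K \<times> {a..b}) (axis j 1, 0)) (at 0 within ?U)"
    by (rule has_vector_derivative_along[OF smooth_onD(2)[OF assms(1) g3] g1 g2])
  then show ?thesis unfolding at dx_def by simp
qed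

lemma dt_derivative:
  assumes "smooth_on (K \<times> {a..b}) F" "x \<in> K" "s \<in> {a..b}"
  shows "((\<lambda>s. F (x, s)) has_vector_derivative dt (K \<times> {a..b}) F (x, s)) (at s within {a..b})"
proof -
  have "((\<lambda>s. (x, s)) has_vector_derivative (0, 1)) (at s within {a..b})"
    by (auto intro!: derivative_eq_intros simp: has_vector_derivative_def)
  moreover have "(\<lambda>s. (x, s)) ` {a..b} \<subseteq> K \<times> {a..b}" using assms(2) by auto
  ultimately show ?thesis
    using has_vector_derivative_along[OF smooth_onD(2)[OF assms(1)], of "\<lambda>s. (x, s)" s] assms(2,3)
    unfolding dt_def by simp
qed

text \<open>The integrand is half the time derivative of \<open>F \<bullet> F\<close>. Time is
  integrated first, with one-sided derivatives at both ends.\<close>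

lemma set_integral_dt:
  assumes K: "compact K" and F: "smooth_on (K \<times> {a..b}) F" and ab: "a \<le> b"
  shows "(LINT z:(K \<times> {a..b})|lborel. dt (K \<times> {a..b}) F z \<bullet> F z)
    = ((LINT x:K|lborel. F (x, b) \<bullet> F (x, b)) - (LINT x:K|lborel. F (x, a) \<bullet> F (x, a))) / 2"
proof -
  let ?D = "K \<times> {a..b}"
  have c: "continuous_on ?D (\<lambda>z. dt ?D F z \<bullet> F z)"
    unfolding dt_def by (intro continuous_intros smooth_onD F)
  have slice: "continuous_on K (\<lambda>x. F (x, s))" if "s \<in> {a..b}" for s
    using that by (intro continuous_on_compose2[OF smooth_onD(1)[OF F]] continuous_intros) auto
  have int: "set_integrable lborel K (\<lambda>x. F (x, s) \<bullet> F (x, s))" if "s \<in> {a..b}" for s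
    unfolding set_integrable_def by (intro borel_integrable_compact K continuous_intros slice that)
  have "(LINT z:?D|lborel. dt ?D F z \<bullet> F z) = (LINT x:K|lborel. (LINT s:{a..b}|lborel. dt ?D F (x, s) \<bullet> F (x, s)))"
    by (rule set_integral_slices(2)[OF K c])
  also have "\<dots> = (LINT x:K|lborel. (F (x, b) \<bullet> F (x, b) - F (x, a) \<bullet> F (x, a)) / 2)"
  proof (rule set_lebesgue_integral_cong)
    show "K \<in> sets lborel" using K by (simp add: compact_imp_closed)
    have "(LINT s:{a..b}|lborel. dt ?D F (x, s) \<bullet> F (x, s)) = F (x, b) \<bullet> F (x, b) / 2 - F (x, a) \<bullet> F (x, a) / 2" if x: "x \<in> K" for x
      unfolding set_lebesgue_integral_def
    proof (rule integral_FTC_atLeastAtMost[OF ab])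
      show "continuous_on {a..b} (\<lambda>s. dt ?D F (x, s) \<bullet> F (x, s))"
        using x by (intro continuous_on_compose2[OF c] continuous_intros) auto
      fix s assume "a \<le> s" "s \<le> b"
      then have "((\<lambda>s. F (x, s)) has_vector_derivative dt ?D F (x, s)) (at s within {a..b})"
        by (intro dt_derivative F x) auto
      from bounded_bilinear.has_vector_derivative[OF bounded_bilinear_inner this this]
      have "((\<lambda>s. F (x, s) \<bullet> F (x, s)) has_vector_derivative 2 * (dt ?D F (x, s) \<bullet> F (x, s))) (at s within {a..b})"
        by (simp add: inner_commute)
      from has_vector_derivative_divide[OF this, of 2]
      show "((\<lambda>s. F (x, s) \<bullet> F (x, s) / 2) has_vector_derivative dt ?D F (x, s) \<bullet> F (x, s)) (at s within {a..b})"
        by simp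
    qed
    then show "\<forall>x. x \<in> K \<longrightarrow> (LINT s:{a..b}|lborel. dt ?D F (x, s) \<bullet> F (x, s)) = (F (x, b) \<bullet> F (x, b) - F (x, a) \<bullet> F (x, a)) / 2"
      by (simp add: diff_divide_distrib)
  qed
  also have "\<dots> = ((LINT x:K|lborel. F (x, b) \<bullet> F (x, b)) - (LINT x:K|lborel. F (x, a) \<bullet> F (x, a))) / 2"
    using int ab by simp
  finally show ?thesis .
qed

text \<open>The left side is the divergence of \<open>v \<times>\<^sub>3 w\<close> after the product
  rule.\<close>

lemma sum_cross_derivative:
  "(\<Sum>j\<in>UNIV. (dx D j v z \<times>\<^sub>3 w z + v z \<times>\<^sub>3 dx D j w z) $ j) = curl D v z \<bullet> w z - curl D w z \<bullet> v z"
  by (simp add: sum_3 cross_components curl_def inner_vec_def algebra_simps)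

text \<open>The divergence theorem for \<open>v \<times>\<^sub>3 w\<close>, one direction at a time.
  Integrability on every plane allows the three components to be reassembled into an inner product
  with the normal.\<close>

lemma set_integral_curl:
  assumes K: "compact K" "regular_closed K"
    and A: "finite A" "\<forall>P\<in>A. is_plane P" "frontier K \<subseteq> \<Union>A"
    and F: "smooth_on (K \<times> {a..b}) v" "smooth_on (K \<times> {a..b}) w"
  shows "(LINT z:(K \<times> {a..b})|lborel. curl (K \<times> {a..b}) v z \<bullet> w z - curl (K \<times> {a..b}) w z \<bullet> v z)
    = (\<Sum>P\<in>A. LINT z:(frontier K \<times> {a..b})|plane_time P. outer_normal K (fst z) \<bullet> (v z \<times>\<^sub>3 w z))"
proof -
  let ?D = "K \<times> {a..b}" and ?S = "frontier K \<times> {a..b}"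
  let ?g = "\<lambda>j z. (dx ?D j v z \<times>\<^sub>3 w z + v z \<times>\<^sub>3 dx ?D j w z) $ j"
  have cont: "continuous_on ?D v" "continuous_on ?D w" using F smooth_onD(1) by blast+
  have cf: "continuous_on ?D (\<lambda>z. (v z \<times>\<^sub>3 w z) $ j)" for j
    by (intro continuous_on_component continuous_on_cross cont)
  have cg: "continuous_on ?D (?g j)" for j
    unfolding dx_def by (intro continuous_on_component continuous_on_add continuous_on_cross cont smooth_onD(3) F)
  have compD: "compact ?D" using K(1) by (intro compact_Times) auto
  have clK: "closed K" using K by (simp add: compact_imp_closed)
  then have sub: "?S \<subseteq> ?D" using frontier_subset_closed by blast
  have deriv: "((\<lambda>r. (v (x + r *\<^sub>R axis j 1, s) \<times>\<^sub>3 w (x + r *\<^sub>R axis j 1, s)) $ j) has_real_derivative ?g j (x, s)) (at 0)"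
    if "x \<in> interior K" "s \<in> {a..b}" for x s j
  proof -
    from bounded_bilinear.has_vector_derivative[OF bounded_bilinear_cross3 dx_derivative[OF F(1) that] dx_derivative[OF F(2) that], of j j]
    have "((\<lambda>r. v (x + r *\<^sub>R axis j 1, s) \<times>\<^sub>3 w (x + r *\<^sub>R axis j 1, s)) has_vector_derivative
        (dx ?D j v (x, s) \<times>\<^sub>3 w (x, s) + v (x, s) \<times>\<^sub>3 dx ?D j w (x, s))) (at 0)"
      by (simp add: add.commute)
    from bounded_linear.has_vector_derivative[OF bounded_linear_vec_nth[of j] this]
    show ?thesis by (simp add: has_real_derivative_iff_has_vector_derivative)
  qed
  have bF: "bounded (frontier K)" using K(1) compact_frontier compact_imp_bounded by blast
  have bm: "bdd_meas_on ?S (\<lambda>z. outer_normal K (fst z) $ j * (v z \<times>\<^sub>3 w z) $ j)" for j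
  proof -
    have "bdd_meas_on ?S (\<lambda>z. (v z \<times>\<^sub>3 w z) $ j)"
      using bdd_meas_on_continuous[OF compD cf] bdd_meas_on_subset[OF _ sub] by blast
    moreover have "bdd_meas_on ?S (\<lambda>z. outer_normal K (fst z) \<bullet> axis j 1)"
      by (intro bdd_meas_on_inner bdd_meas_on_const bdd_meas_on_fst bdd_meas_on_outer_normal clK)
    ultimately have "bdd_meas_on ?S (\<lambda>z. (outer_normal K (fst z) \<bullet> axis j 1) * (v z \<times>\<^sub>3 w z) $ j)"
      by (rule bdd_meas_on_mult[rotated])
    then show ?thesis by (simp add: inner_axis)
  qed
  have int: "set_integrable (plane_time P) ?S (\<lambda>z. outer_normal K (fst z) $ j * (v z \<times>\<^sub>3 w z) $ j)" if "P \<in> A" for P j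
    using that A(2) by (intro set_integrable_plane_time bF bm) auto
  have "(LINT z:?D|lborel. curl ?D v z \<bullet> w z - curl ?D w z \<bullet> v z) = (LINT z:?D|lborel. (\<Sum>j\<in>UNIV. ?g j z))"
    by (simp only: sum_cross_derivative)
  also have "\<dots> = (\<Sum>j\<in>UNIV. LINT z:?D|lborel. ?g j z)"
    by (intro set_integral_sum_finite) (unfold set_integrable_def, rule borel_integrable_compact[OF compD cg])
  also have "\<dots> = (\<Sum>j\<in>UNIV. \<Sum>P\<in>A. LINT z:?S|plane_time P. outer_normal K (fst z) $ j * (v z \<times>\<^sub>3 w z) $ j)"
    by (intro sum.cong refl integral_derivative_direction_time K A cf cg deriv)
  also have "\<dots> = (\<Sum>P\<in>A. \<Sum>j\<in>UNIV. LINT z:?S|plane_time P. outer_normal K (fst z) $ j * (v z \<times>\<^sub>3 w z) $ j)"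
    by (rule sum.swap)
  also have "\<dots> = (\<Sum>P\<in>A. LINT z:?S|plane_time P. (\<Sum>j\<in>UNIV. outer_normal K (fst z) $ j * (v z \<times>\<^sub>3 w z) $ j))"
    using int by (intro sum.cong refl set_integral_sum_finite[symmetric])
  finally show ?thesis by (simp add: inner_vec_def)
qed

lemma set_integral_element:
  assumes K: "compact K" "regular_closed K"
    and A: "finite A" "\<forall>P\<in>A. is_plane P" "frontier K \<subseteq> \<Union>A" and ab: "a \<le> b"
    and F: "smooth_on (K \<times> {a..b}) v" "smooth_on (K \<times> {a..b}) w"
  shows "(LINT z:(K \<times> {a..b})|lborel.
      (e *\<^sub>R dt (K \<times> {a..b}) v z - curl (K \<times> {a..b}) w z) \<bullet> v z + (m *\<^sub>R dt (K \<times> {a..b}) w z + curl (K \<times> {a..b}) v z) \<bullet> w z)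
    = e * ((LINT x:K|lborel. v (x, b) \<bullet> v (x, b)) - (LINT x:K|lborel. v (x, a) \<bullet> v (x, a))) / 2
    + m * ((LINT x:K|lborel. w (x, b) \<bullet> w (x, b)) - (LINT x:K|lborel. w (x, a) \<bullet> w (x, a))) / 2
    + (\<Sum>P\<in>A. LINT z:(frontier K \<times> {a..b})|plane_time P. outer_normal K (fst z) \<bullet> (v z \<times>\<^sub>3 w z))"
proof -
  let ?D = "K \<times> {a..b}"
  have compD: "compact ?D" using K(1) by (intro compact_Times) auto
  have cont: "continuous_on ?D v" "continuous_on ?D w" using F smooth_onD(1) by blast+
  have ccurl: "continuous_on ?D (curl ?D u)" if "smooth_on ?D u" for u
  proof -
    have "continuous_on ?D (\<lambda>z. dx ?D j u z $ i)" for i j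
      unfolding dx_def by (intro continuous_on_component smooth_onD(3) that)
    then have "continuous_on ?D (\<lambda>z. curl ?D u z $ i)" for i
      using exhaust_3[of i] by (elim disjE) (simp_all add: curl_def continuous_on_diff)
    then show ?thesis using continuous_on_vec_lambda[of ?D "\<lambda>i z. curl ?D u z $ i"] by simp
  qed
  have int: "set_integrable lborel ?D g" if "continuous_on ?D g" for g :: "point \<times> real \<Rightarrow> real"
    unfolding set_integrable_def by (intro borel_integrable_compact compD that)
  have i1: "set_integrable lborel ?D (\<lambda>z. e * (dt ?D v z \<bullet> v z))" "set_integrable lborel ?D (\<lambda>z. m * (dt ?D w z \<bullet> w z))"
    "set_integrable lborel ?D (\<lambda>z. curl ?D v z \<bullet> w z - curl ?D w z \<bullet> v z)"
    unfolding dt_def by (intro int continuous_intros cont ccurl smooth_onD(3) F)+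
  have "(LINT z:?D|lborel. (e *\<^sub>R dt ?D v z - curl ?D w z) \<bullet> v z + (m *\<^sub>R dt ?D w z + curl ?D v z) \<bullet> w z)
    = (LINT z:?D|lborel. (e * (dt ?D v z \<bullet> v z) + m * (dt ?D w z \<bullet> w z)) + (curl ?D v z \<bullet> w z - curl ?D w z \<bullet> v z))"
    by (simp add: inner_diff_left inner_add_left algebra_simps)
  also have "\<dots> = e * (LINT z:?D|lborel. dt ?D v z \<bullet> v z) + m * (LINT z:?D|lborel. dt ?D w z \<bullet> w z)
      + (LINT z:?D|lborel. curl ?D v z \<bullet> w z - curl ?D w z \<bullet> v z)"
    using i1 by (simp add: set_integral_add)
  also have "\<dots> = e * (((LINT x:K|lborel. v (x, b) \<bullet> v (x, b)) - (LINT x:K|lborel. v (x, a) \<bullet> v (x, a))) / 2)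
    + m * (((LINT x:K|lborel. w (x, b) \<bullet> w (x, b)) - (LINT x:K|lborel. w (x, a) \<bullet> w (x, a))) / 2)
    + (\<Sum>P\<in>A. LINT z:(frontier K \<times> {a..b})|plane_time P. outer_normal K (fst z) \<bullet> (v z \<times>\<^sub>3 w z))"
    by (simp only: set_integral_dt[OF K(1) F(1) ab] set_integral_dt[OF K(1) F(2) ab] set_integral_curl[OF K A F])
  finally show ?thesis by simp
qed

subsection \<open>Interfaces and boundary faces\<close>

text \<open>With one family \<open>A\<close> for all boundaries, general position with respect to
  \<open>A\<close> serves all elements at once. By \<open>int_cl\<close>, the boundary of the domain
  is that of its closure, the union of the elements.\<close>

locale mesh =
  fixes \<Omega> :: "point set" and \<Omega>h :: "point set set" and A :: "point set set"
  assumes open_\<Omega>: "open \<Omega>" and int_cl: "interior (closure \<Omega>) = \<Omega>"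
    and fin: "finite \<Omega>h" and compact_K: "\<And>K. K \<in> \<Omega>h \<Longrightarrow> compact K"
    and regular_K: "\<And>K. K \<in> \<Omega>h \<Longrightarrow> regular_closed K"
    and union: "\<Union>\<Omega>h = closure \<Omega>"
    and disjoint: "\<And>K K'. K \<in> \<Omega>h \<Longrightarrow> K' \<in> \<Omega>h \<Longrightarrow> K \<noteq> K' \<Longrightarrow> interior K \<inter> interior K' = {}"
    and finA: "finite A" and planes: "\<forall>P\<in>A. is_plane P"
    and frontier_K: "\<And>K. K \<in> \<Omega>h \<Longrightarrow> frontier K \<subseteq> \<Union>A" and frontier_\<Omega>: "frontier \<Omega> \<subseteq> \<Union>A"
begin

lemma closed_K: "K \<in> \<Omega>h \<Longrightarrow> closed K"
  using regular_K regular_closed_closed by blast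

lemma frontier_cl: "frontier (closure \<Omega>) = frontier \<Omega>"
  using int_cl open_\<Omega> by (simp add: frontier_def interior_open)

lemma regular_cl: "regular_closed (closure \<Omega>)"
  by (simp add: regular_closed_def int_cl)

text \<open>An open set disjoint from \<open>interior K'\<close> is also disjoint from its closure,
  which is \<open>K'\<close>.\<close>

lemma interior_unique:
  assumes "K \<in> \<Omega>h" "K' \<in> \<Omega>h" "x \<in> interior K" "x \<in> K'"
  shows "K = K'"
proof (rule ccontr)
  assume "K \<noteq> K'"
  then have "interior K \<inter> interior K' = {}" using disjoint assms by blast
  moreover have "x \<in> interior K \<inter> closure (interior K')"
    using assms regular_K[OF assms(2)] by (simp add: regular_closed_def)
  ultimately show False using open_Int_closure_eq_empty[OF open_interior] by blast
qed

text \<open>If no other element contained \<open>x\<close>, removing the finitely many other closed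
  elements from \<open>\<Omega>\<close> would leave an open neighbourhood of \<open>x\<close> inside
  \<open>K\<close>.\<close>

lemma neighbour_exists:
  assumes "K \<in> \<Omega>h" "x \<in> frontier K" "x \<notin> frontier \<Omega>"
  obtains K' where "K' \<in> \<Omega>h" "K' \<noteq> K" "x \<in> frontier K'"
proof -
  have xK: "x \<in> K" using assms closed_K frontier_subset_closed by blast
  then have "x \<in> closure \<Omega>" using union assms(1) by blast
  then have x\<Omega>: "x \<in> \<Omega>" using assms(3) open_\<Omega> by (simp add: frontier_def interior_open)
  have "\<exists>K'\<in>\<Omega>h - {K}. x \<in> K'"
  proof (rule ccontr)
    assume no: "\<not> ?thesis"
    have "closed (\<Union>(\<Omega>h - {K}))" using fin closed_K by (intro closed_Union) auto
    then have op: "open (\<Omega> - \<Union>(\<Omega>h - {K}))" using open_\<Omega> by (rule open_Diff[rotated])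
    have "\<Omega> - \<Union>(\<Omega>h - {K}) \<subseteq> K" using union closure_subset[of \<Omega>] by blast
    then have "\<Omega> - \<Union>(\<Omega>h - {K}) \<subseteq> interior K" using op by (rule interior_maximal)
    moreover have "x \<in> \<Omega> - \<Union>(\<Omega>h - {K})" using x\<Omega> no by blast
    ultimately have "x \<in> interior K" by blast
    then show False using assms(2) by (simp add: frontier_def)
  qed
  then obtain K' where K': "K' \<in> \<Omega>h" "K' \<noteq> K" "x \<in> K'" by blast
  have "x \<notin> interior K'" using interior_unique[OF K'(1) assms(1) _ xK] K'(2) by blast
  then have "x \<in> frontier K'" using K' closed_K by (simp add: frontier_def)
  with K' that show ?thesis by blast
qed

lemma neighbour_in:
  assumes "K \<in> \<Omega>h" "x \<in> frontier K" "x \<notin> frontier \<Omega>"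
  shows "neighbour \<Omega>h K x \<in> \<Omega>h \<and> neighbour \<Omega>h K x \<noteq> K \<and> x \<in> frontier (neighbour \<Omega>h K x)"
  unfolding neighbour_def
  by (rule someI_ex) (use neighbour_exists[OF assms] in blast)

lemma element_at_in: "x \<in> closure \<Omega> \<Longrightarrow> element_at \<Omega>h x \<in> \<Omega>h \<and> x \<in> element_at \<Omega>h x"
  unfolding element_at_def by (rule someI_ex) (use union in blast)

context
  fixes P :: "point set" and x :: point
  assumes P: "P \<in> A" and x: "x \<in> P" "\<forall>Q\<in>A. Q \<noteq> P \<longrightarrow> x \<notin> Q"
begin

text \<open>The normal \<open>m\<close> and the radius \<open>r\<close> do not depend on
  \<open>S\<close>, so that the half-balls occupied by different elements can be compared.\<close>

lemma local_plane:
  obtains m r where "norm m = 1" "r > 0"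
    "\<And>S. frontier S \<subseteq> \<Union>A \<Longrightarrow> frontier S \<inter> ball x r \<subseteq> {y. m \<bullet> (y - x) = 0}"
proof -
  obtain m c where m: "norm m = 1" "P = {y. m \<bullet> y = c}"
    using planes P unfolding is_plane_def by blast
  obtain r where r: "r > 0" "\<And>y Q. y \<in> ball x r \<Longrightarrow> Q \<in> A \<Longrightarrow> y \<in> Q \<Longrightarrow> Q = P"
    using only_plane_ball[OF finA, of P x] planes x(2) closed_is_plane by metis
  have "frontier S \<inter> ball x r \<subseteq> {y. m \<bullet> (y - x) = 0}" if S: "frontier S \<subseteq> \<Union>A" for S
  proof
    fix y assume y: "y \<in> frontier S \<inter> ball x r"
    then obtain Q where "Q \<in> A" "y \<in> Q" using S by blast
    then have "y \<in> P" using r(2) y by blast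
    then show "y \<in> {y. m \<bullet> (y - x) = 0}" using x(1) m(2) by (simp add: inner_diff_right)
  qed
  with m(1) r(1) that show ?thesis by blast
qed

text \<open>One half-ball is outside of the closed domain and hence of every element, so each
  element at \<open>x\<close> contains the opposite half-ball and has the normal of the domain.
  Since the interiors are disjoint, there is only one such element.\<close>

lemma boundary_point:
  assumes "x \<in> frontier \<Omega>"
  obtains K n where "K \<in> \<Omega>h" "{K'\<in>\<Omega>h. x \<in> frontier K'} = {K}" "{K'\<in>\<Omega>h. x \<in> K'} = {K}"
    "halfspace_at K x n" "halfspace_at \<Omega> x n"
proof -
  obtain m r where m: "norm m = 1" "r > 0"
    "\<And>S. frontier S \<subseteq> \<Union>A \<Longrightarrow> frontier S \<inter> ball x r \<subseteq> {y. m \<bullet> (y - x) = 0}" using local_plane by blast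
  have xcl: "x \<in> closure \<Omega>" using assms by (simp add: frontier_def)
  note result = that
  \<comment> \<open>Formulated for an arbitrary normal, since the outside may be on the side of
    either \<open>m\<close> or \<open>- m\<close>.\<close>
  have one: thesis if m: "norm m = 1"
    "\<And>S. frontier S \<subseteq> \<Union>A \<Longrightarrow> frontier S \<inter> ball x r \<subseteq> {y. m \<bullet> (y - x) = 0}"
    and out: "side m x r \<inter> closure \<Omega> = {}" and h: "halfspace_at (closure \<Omega>) x m" for m
  proof -
    obtain K where K: "K \<in> \<Omega>h" "x \<in> K" using xcl union by blast
    have sides: "side (- m) x r \<subseteq> interior K' \<and> x \<in> frontier K' \<and> halfspace_at K' x m" if K': "K' \<in> \<Omega>h" "x \<in> K'" for K'
    proof -
      have "side m x r \<inter> K' = {}" using out K'(1) union by blast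
      then have no: "\<not> side m x r \<subseteq> interior K'"
        using side_nonempty[OF m(1) \<open>r > 0\<close>] interior_subset[of K'] by blast
      show ?thesis
        by (rule local_structure[OF regular_K[OF K'(1)] m(1) \<open>r > 0\<close> K'(2) m(2)[OF frontier_K[OF K'(1)]]])
          (use no in blast)+
    qed
    have uniq: "K' = K" if K': "K' \<in> \<Omega>h" "x \<in> K'" for K'
    proof -
      obtain z where "z \<in> side (- m) x r" using side_nonempty[of "- m" r x] m(1) \<open>r > 0\<close> by auto
      then have "z \<in> interior K'" "z \<in> K" using sides[OF K'] sides[OF K] interior_subset by blast+
      then show ?thesis using interior_unique K' K by blast
    qed
    have e1: "{K'\<in>\<Omega>h. x \<in> K'} = {K}" using uniq K by blast
    have e2: "{K'\<in>\<Omega>h. x \<in> frontier K'} = {K}"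
    proof -
      have "x \<in> K'" if "K' \<in> \<Omega>h" "x \<in> frontier K'" for K'
        using frontier_subset_closed[OF closed_K[OF that(1)]] that(2) by blast
      then show ?thesis using uniq K sides[OF K] by blast
    qed
    have e3: "halfspace_at K x m" using sides[OF K] by simp
    show thesis by (rule result[OF K(1) e2 e1 e3 h[unfolded halfspace_at_closure]])
  qed
  show ?thesis
  proof (rule local_structure[OF regular_cl m(1,2) xcl m(3)])
    show "frontier (closure \<Omega>) \<subseteq> \<Union>A" using frontier_\<Omega> frontier_cl by simp
  next
    assume "x \<in> interior (closure \<Omega>)"
    then show thesis using assms by (simp add: int_cl frontier_def interior_open open_\<Omega>)
  next
    assume "side m x r \<inter> closure \<Omega> = {}" "halfspace_at (closure \<Omega>) x m"
    then show thesis using one[of m] m by blast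
  next
    assume "side (- m) x r \<inter> closure \<Omega> = {}" "halfspace_at (closure \<Omega>) x (- m)"
    then show thesis using one[of "- m"] m by simp
  qed
qed

text \<open>Every element with \<open>x\<close> on its boundary contains one of the two half-balls,
  and different elements cannot contain the same one. With \<open>K\<close> and the second element
  from \<open>neighbour_exists\<close> both half-balls are taken.\<close>

lemma interface_point:
  assumes K: "K \<in> \<Omega>h" "x \<in> frontier K" and "x \<notin> frontier \<Omega>"
  obtains K' n where "K' \<in> \<Omega>h" "K' \<noteq> K" "{L\<in>\<Omega>h. x \<in> frontier L} = {K, K'}"
    "halfspace_at K x n" "halfspace_at K' x (- n)"
proof -
  obtain m r where m: "norm m = 1" "r > 0"
    "\<And>S. frontier S \<subseteq> \<Union>A \<Longrightarrow> frontier S \<inter> ball x r \<subseteq> {y. m \<bullet> (y - x) = 0}" using local_plane by blast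
  obtain K' where K': "K' \<in> \<Omega>h" "K' \<noteq> K" "x \<in> frontier K'" using neighbour_exists assms by blast
  have sides: "(side (- m) x r \<subseteq> interior L \<and> halfspace_at L x m) \<or> (side m x r \<subseteq> interior L \<and> halfspace_at L x (- m))"
    if L: "L \<in> \<Omega>h" "x \<in> frontier L" for L
  proof -
    have "x \<in> L" "x \<notin> interior L" using L closed_K frontier_subset_closed by (auto simp: frontier_def)
    then show ?thesis
      using local_structure[OF regular_K[OF L(1)] m(1,2) _ m(3)[OF frontier_K[OF L(1)]]] by metis
  qed
  have sep: "L = L'" if "L \<in> \<Omega>h" "L' \<in> \<Omega>h" "side m' x r \<subseteq> interior L" "side m' x r \<subseteq> interior L'" "norm m' = 1" for L L' m'
  proof -
    have "side m' x r \<noteq> {}" using that(5) m(2) by (rule side_nonempty)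
    then obtain z where "z \<in> side m' x r" by blast
    then have "z \<in> interior L" "z \<in> L'" using that interior_subset by blast+
    then show ?thesis using interior_unique that by blast
  qed
  have m': "norm (- m) = 1" using m(1) by simp
  have only: "L = K \<or> L = K'" if "L \<in> \<Omega>h" "x \<in> frontier L" for L
    using sides[OF K] sides[OF K'(1,3)] sides[OF that] sep[OF K(1) K'(1) _ _ m(1)] sep[OF K(1) K'(1) _ _ m']
      sep[OF that(1) K(1) _ _ m(1)] sep[OF that(1) K(1) _ _ m'] sep[OF that(1) K'(1) _ _ m(1)] sep[OF that(1) K'(1) _ _ m']
      K'(2) by blast
  \<comment> \<open>The second case is the first one with \<open>- m\<close> in place of
    \<open>m\<close>; the double negation is kept so that both match the pattern \<open>n\<close>,
    \<open>- n\<close>.\<close>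
  have opp: "halfspace_at K x m \<and> halfspace_at K' x (- m) \<or> halfspace_at K x (- m) \<and> halfspace_at K' x (- (- m))"
    using sides[OF K] sides[OF K'(1,3)] sep[OF K(1) K'(1) _ _ m(1)] sep[OF K(1) K'(1) _ _ m'] K'(2) by auto
  have "{L\<in>\<Omega>h. x \<in> frontier L} = {K, K'}" using only K K' by blast
  then show ?thesis using that[OF K'(1,2)] opp by blast
qed

end

end

section \<open>Algebra of the fluxes and null sets\<close>

text \<open>The jump of the second field is zero, and the part with \<open>v\<close> alone cancels
  the energy flux \<open>n \<bullet> (v \<times>\<^sub>3 w)\<close>. What is left is the impedance
  term, the square of the tangential part of \<open>w\<close>.\<close>

lemma cross3_boundary:
  assumes "norm n = 1"
  shows "(n \<times>\<^sub>3 (w - w)) \<bullet> v - (n \<times>\<^sub>3 (v - \<beta> *\<^sub>R (w \<times>\<^sub>3 n))) \<bullet> w + n \<bullet> (v \<times>\<^sub>3 w) = \<beta> * (norm (n \<times>\<^sub>3 w))\<^sup>2"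
proof -
  have "(n \<times>\<^sub>3 v) \<bullet> w = n \<bullet> (v \<times>\<^sub>3 w)"
    by (simp add: cross_components inner_vec_def sum_3 algebra_simps)
  moreover have "(n \<times>\<^sub>3 (w \<times>\<^sub>3 n)) \<bullet> w = (norm (n \<times>\<^sub>3 w))\<^sup>2"
    unfolding power2_norm_eq_inner by (simp add: cross_components inner_vec_def sum_3 algebra_simps)
  ultimately show ?thesis
    by (simp add: Cross3.right_diff_distrib cross_mult_right inner_diff_left)
qed

text \<open>The contribution of one side simplifies to \<open>n \<bullet> (v \<times>\<^sub>3 w' +
  v' \<times>\<^sub>3 w) / 2\<close>. The vector in parentheses is unchanged when the sides are
  exchanged, whereas the normal changes sign.\<close>

lemma cross3_interface:
  fixes n v w v' w' :: point
  shows "(n \<times>\<^sub>3 (w - (1 / 2) *\<^sub>R (w + w'))) \<bullet> v - (n \<times>\<^sub>3 (v - (1 / 2) *\<^sub>R (v + v'))) \<bullet> w + n \<bullet> (v \<times>\<^sub>3 w)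
    + (((- n) \<times>\<^sub>3 (w' - (1 / 2) *\<^sub>R (w' + w))) \<bullet> v' - ((- n) \<times>\<^sub>3 (v' - (1 / 2) *\<^sub>R (v' + v))) \<bullet> w' + (- n) \<bullet> (v' \<times>\<^sub>3 w')) = 0"
  by (simp add: cross_components inner_vec_def sum_3 field_simps)

lemma borel_Times_UNIV: "C \<in> sets borel \<Longrightarrow> C \<times> (UNIV :: real set) \<in> sets borel" for C :: "point set"
  unfolding borel_prod[symmetric] by (intro pair_measureI) auto

lemma bdd_meas_on_empty: "bdd_meas_on {} h"
  by (simp add: bdd_meas_on_def measurable_def space_restrict_space)

text \<open>A choice among the indices whose sets contain a point depends on the point only through
  this incidence set. These Borel pieces are what makes such choices measurable.\<close>

lemma sets_incidence:
  assumes "finite J" "\<And>i. i \<in> J \<Longrightarrow> B i \<in> sets borel"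
  shows "{x. {i \<in> J. x \<in> B i} = \<S>} \<in> sets borel"
proof (cases "\<S> \<subseteq> J")
  case True
  then have "{x. {i \<in> J. x \<in> B i} = \<S>} = (\<Inter>i\<in>J. if i \<in> \<S> then B i else - B i) \<inter> UNIV"
    by (auto split: if_splits)
  also have "\<dots> \<in> sets borel"
  proof (cases "J = {}")
    case False
    then show ?thesis using assms by (intro sets.Int sets.finite_INT) auto
  qed simp
  finally show ?thesis .
next
  case False
  then have "{x. {i \<in> J. x \<in> B i} = \<S>} = {}" by auto
  then show ?thesis by simp
qed

lemma AE_plane_time_fst:
  assumes "AE x in plane_area P. Q x"
  shows "AE z in plane_time P. Q (fst z)"
proof -
  obtain N where N: "{x \<in> space (plane_area P). \<not> Q x} \<subseteq> N" "emeasure (plane_area P) N = 0" "N \<in> sets (plane_area P)"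
    using assms by (rule AE_E)
  then have "N \<times> UNIV \<in> null_sets (plane_time P)"
    by (intro lborel.times_in_null_sets1) auto
  then have "AE z in plane_time P. z \<notin> N \<times> UNIV" by (rule AE_not_in)
  then show ?thesis by eventually_elim (use N(1) in auto)
qed

text \<open>Planes have no volume, so volume integrals ignore the points shared by several
  elements.\<close>

lemma AE_lborel_planes:
  assumes "finite A" "\<forall>P\<in>A. is_plane P"
  shows "AE x in lborel. x \<notin> \<Union>A"
proof -
  have "AE x in lborel. x \<notin> P" if P: "P \<in> A" for P
  proof (rule AE_not_in)
    obtain m c where m: "norm m = 1" "P = {x. m \<bullet> x = c}" using assms(2) P unfolding is_plane_def by blast
    have "m \<noteq> 0" using m(1) by auto
    then have "negligible P" unfolding m(2) by (intro negligible_hyperplane) simp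
    moreover have "closed P" using assms(2) that closed_is_plane by blast
    ultimately show "P \<in> null_sets lborel"
      using emeasure_lborel_negligible_closed[of P] by (simp add: null_sets_def)
  qed
  then have "AE x in lborel. \<forall>P\<in>A. x \<notin> P" using assms(1) by (intro AE_finite_allI)
  then show ?thesis by eventually_elim auto
qed

section \<open>Integrability of the surface terms\<close>

locale mesh_fields = mesh +
  fixes a b :: real and v w :: field and \<beta> :: real
  assumes ab: "a \<le> b"
    and smooth_v: "\<And>K. K \<in> \<Omega>h \<Longrightarrow> smooth_on (K \<times> {a..b}) (v K)"
    and smooth_w: "\<And>K. K \<in> \<Omega>h \<Longrightarrow> smooth_on (K \<times> {a..b}) (w K)"
begin

abbreviation I :: "real set" where "I \<equiv> {a..b}"

lemma bounded_\<Omega>: "bounded (closure \<Omega>)"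
  unfolding union[symmetric] using fin compact_K compact_imp_bounded by (intro bounded_Union) auto

lemma bdd_meas_on_field:
  assumes "K \<in> \<Omega>h" "smooth_on (K \<times> I) (u K)" "D \<subseteq> K \<times> I"
  shows "bdd_meas_on D (u K)"
proof -
  have "compact (K \<times> I)" using assms(1) compact_K by (intro compact_Times) auto
  then have "bdd_meas_on (K \<times> I) (u K)"
    using smooth_onD(1)[OF assms(2)] by (rule bdd_meas_on_continuous)
  then show ?thesis using assms(3) by (rule bdd_meas_on_subset)
qed

lemma frontier_Times_subset: "K \<in> \<Omega>h \<Longrightarrow> frontier K \<times> I \<subseteq> K \<times> I"
  using closed_K frontier_subset_closed by blast

text \<open>The neighbour is a choice that depends only on which elements have the point on their boundary.
  Hence it is constant on each of the finitely many Borel sets where this incidence is constant.\<close>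

lemma bdd_meas_on_average:
  assumes K: "K \<in> \<Omega>h" and u: "\<And>K. K \<in> \<Omega>h \<Longrightarrow> smooth_on (K \<times> I) (u K)"
  shows "bdd_meas_on (frontier K \<times> I \<inter> (- frontier \<Omega>) \<times> UNIV) (average \<Omega>h u K)" (is "bdd_meas_on ?D _")
proof -
  define C where "C \<S> = {x. {K'\<in>\<Omega>h. x \<in> frontier K'} = \<S>} \<times> (UNIV :: real set)" for \<S>
  show ?thesis
  proof (rule bdd_meas_on_piecewise[where J="Pow \<Omega>h" and C=C])
    show "finite (Pow \<Omega>h)" using fin by simp
    show "?D \<subseteq> (\<Union>i\<in>Pow \<Omega>h. C i)"
    proof
      fix z
      have "z \<in> C {K'\<in>\<Omega>h. fst z \<in> frontier K'}" by (simp add: C_def mem_Times_iff)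
      then show "z \<in> (\<Union>i\<in>Pow \<Omega>h. C i)" by (rule UN_I[rotated]) simp
    qed
    show "C \<S> \<in> sets borel" for \<S>
      unfolding C_def by (intro borel_Times_UNIV sets_incidence fin borel_closed frontier_closed)
    fix \<S>
    show "bdd_meas_on (?D \<inter> C \<S>) (average \<Omega>h u K)"
    proof (cases "?D \<inter> C \<S> = {}")
      case True
      then show ?thesis by (simp only: bdd_meas_on_empty)
    next
      case False
      define K' where "K' = (SOME K'. K' \<in> \<S> \<and> K' \<noteq> K)"
      have nb: "neighbour \<Omega>h K x = K'" if "(x, s) \<in> ?D \<inter> C \<S>" for x s
      proof -
        have "\<S> = {K'\<in>\<Omega>h. x \<in> frontier K'}" using that by (auto simp: C_def)
        then show ?thesis unfolding neighbour_def K'_def by (intro arg_cong[where f=Eps]) auto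
      qed
      have fr: "x \<in> frontier K'" "K' \<in> \<Omega>h" if "(x, s) \<in> ?D \<inter> C \<S>" for x s
        using neighbour_in[OF K, of x] nb[OF that] that by auto
      obtain z where "z \<in> ?D \<inter> C \<S>" using False by blast
      then have K': "K' \<in> \<Omega>h" using fr(2)[of "fst z" "snd z"] by simp
      have "?D \<inter> C \<S> \<subseteq> frontier K' \<times> I" using fr(1) by auto
      then have sub': "?D \<inter> C \<S> \<subseteq> K' \<times> I" using frontier_Times_subset[OF K'] by blast
      have sub: "?D \<inter> C \<S> \<subseteq> K \<times> I" using frontier_Times_subset[OF K] by blast
      have "bdd_meas_on (?D \<inter> C \<S>) (\<lambda>z. (1 / 2) *\<^sub>R (u K z + u K' z))"
        by (intro bdd_meas_on_scaleR bdd_meas_on_const bdd_meas_on_add bdd_meas_on_field K K' u sub sub')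
      then show ?thesis
        by (rule bdd_meas_on_cong[THEN iffD1, rotated]) (auto simp: average_def nb)
    qed
  qed
qed

text \<open>Both numerical fluxes have this shape, with \<open>g\<close> the prescription on
  boundary faces. The closed set \<open>frontier \<Omega>\<close> splits the boundary of the element
  into two Borel pieces.\<close>

lemma bdd_meas_on_flux:
  assumes K: "K \<in> \<Omega>h" and u: "\<And>K. K \<in> \<Omega>h \<Longrightarrow> smooth_on (K \<times> I) (u K)"
    and g: "bdd_meas_on (frontier K \<times> I) g"
  shows "bdd_meas_on (frontier K \<times> I) (\<lambda>(x, s). if x \<in> frontier \<Omega> then g (x, s) else average \<Omega>h u K (x, s))" (is "bdd_meas_on ?D ?h")
proof (rule bdd_meas_on_piecewise[where J="{frontier \<Omega>, - frontier \<Omega>}" and C="\<lambda>F. F \<times> UNIV"])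
  fix F assume F: "F \<in> {frontier \<Omega>, - frontier \<Omega>}"
  have "frontier \<Omega> \<in> sets borel" by (intro borel_closed frontier_closed)
  with F show "F \<times> (UNIV :: real set) \<in> sets borel" by (intro borel_Times_UNIV) auto
  have "bdd_meas_on (?D \<inter> frontier \<Omega> \<times> UNIV) g" by (rule bdd_meas_on_subset[OF g]) auto
  then have 1: "bdd_meas_on (?D \<inter> frontier \<Omega> \<times> UNIV) ?h"
    by (rule bdd_meas_on_cong[THEN iffD1, rotated]) auto
  from bdd_meas_on_average[OF K u] have 2: "bdd_meas_on (?D \<inter> (- frontier \<Omega>) \<times> UNIV) ?h"
    by (rule bdd_meas_on_cong[THEN iffD1, rotated]) auto
  show "bdd_meas_on (?D \<inter> F \<times> UNIV) ?h" using F 1 2 by blast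
qed auto

definition flux_term :: "point set \<Rightarrow> point \<times> real \<Rightarrow> real" where
  "flux_term K = (\<lambda>(x, s). (outer_normal K x \<times>\<^sub>3 (w K (x, s) - flux_H \<Omega> \<Omega>h w K (x, s))) \<bullet> v K (x, s) -
        (outer_normal K x \<times>\<^sub>3 (v K (x, s) - flux_E \<Omega> \<Omega>h \<beta> v w K (x, s))) \<bullet> w K (x, s))"

text \<open>The normal component of the Poynting vector.\<close>

definition energy_flux :: "point set \<Rightarrow> point \<times> real \<Rightarrow> real" where
  "energy_flux K z = outer_normal K (fst z) \<bullet> (v K z \<times>\<^sub>3 w K z)"

definition boundary_loss :: "point \<times> real \<Rightarrow> real" where
  "boundary_loss = (\<lambda>(x, s). (norm (outer_normal \<Omega> x \<times>\<^sub>3 w (element_at \<Omega>h x) (x, s)))\<^sup>2)"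

lemma bdd_meas_on_normal: "K \<in> \<Omega>h \<Longrightarrow> bdd_meas_on (frontier K \<times> I) (\<lambda>z. outer_normal K (fst z))"
  by (intro bdd_meas_on_fst bdd_meas_on_outer_normal closed_K)

lemma bdd_meas_on_flux_term:
  assumes K: "K \<in> \<Omega>h"
  shows "bdd_meas_on (frontier K \<times> I) (flux_term K)"
proof -
  have vw: "bdd_meas_on (frontier K \<times> I) (v K)" "bdd_meas_on (frontier K \<times> I) (w K)"
    using bdd_meas_on_field[OF K _ frontier_Times_subset[OF K]] smooth_v[OF K] smooth_w[OF K] by blast+
  have H: "bdd_meas_on (frontier K \<times> I) (flux_H \<Omega> \<Omega>h w K)"
    unfolding flux_H_def by (rule bdd_meas_on_flux[OF K smooth_w vw(2)])
  have "bdd_meas_on (frontier K \<times> I) (\<lambda>z. \<beta> *\<^sub>R (w K z \<times>\<^sub>3 outer_normal K (fst z)))"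
    by (intro bdd_meas_on_scaleR bdd_meas_on_const bdd_meas_on_cross vw bdd_meas_on_normal K)
  from bdd_meas_on_flux[OF K smooth_v this] have E: "bdd_meas_on (frontier K \<times> I) (flux_E \<Omega> \<Omega>h \<beta> v w K)"
    unfolding flux_E_def by (simp cong del: if_weak_cong)
  have "bdd_meas_on (frontier K \<times> I) (\<lambda>z. (outer_normal K (fst z) \<times>\<^sub>3 (w K z - flux_H \<Omega> \<Omega>h w K z)) \<bullet> v K z -
        (outer_normal K (fst z) \<times>\<^sub>3 (v K z - flux_E \<Omega> \<Omega>h \<beta> v w K z)) \<bullet> w K z)"
    by (intro bdd_meas_on_diff bdd_meas_on_inner bdd_meas_on_cross bdd_meas_on_normal K vw H E)
  then show ?thesis unfolding flux_term_def by (simp add: case_prod_beta')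
qed

lemma bdd_meas_on_energy_flux:
  assumes K: "K \<in> \<Omega>h"
  shows "bdd_meas_on (frontier K \<times> I) (energy_flux K)"
  unfolding energy_flux_def
  by (intro bdd_meas_on_inner bdd_meas_on_cross bdd_meas_on_normal K bdd_meas_on_field smooth_v smooth_w frontier_Times_subset)

lemma element_at_piece:
  assumes "{K\<in>\<Omega>h. x \<in> K} = \<S>"
  shows "element_at \<Omega>h x = (SOME K. K \<in> \<S>)"
  unfolding element_at_def assms[symmetric] by simp

text \<open>The chosen element is constant wherever the set of elements containing the point is. The
  map \<open>p\<close> lets the result serve points of space as well as points of
  space-time.\<close>

lemma bdd_meas_on_element_at:
  fixes F :: "point set \<Rightarrow> 'a::second_countable_topology \<Rightarrow> 'b::euclidean_space" and p :: "'a \<Rightarrow> point"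
  assumes D: "p ` D \<subseteq> closure \<Omega>" and p: "p \<in> borel_measurable borel"
    and F: "\<And>K. K \<in> \<Omega>h \<Longrightarrow> bdd_meas_on (D \<inter> p -` K) (F K)"
  shows "bdd_meas_on D (\<lambda>z. F (element_at \<Omega>h (p z)) z)"
proof (rule bdd_meas_on_piecewise[where J="Pow \<Omega>h" and C="\<lambda>\<S>. p -` {x. {K\<in>\<Omega>h. x \<in> K} = \<S>}"])
  show "finite (Pow \<Omega>h)" using fin by simp
  show "D \<subseteq> (\<Union>\<S>\<in>Pow \<Omega>h. p -` {x. {K\<in>\<Omega>h. x \<in> K} = \<S>})"
  proof
    fix z
    have "z \<in> p -` {x. {K\<in>\<Omega>h. x \<in> K} = {K\<in>\<Omega>h. p z \<in> K}}" by simp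
    then show "z \<in> (\<Union>\<S>\<in>Pow \<Omega>h. p -` {x. {K\<in>\<Omega>h. x \<in> K} = \<S>})" by (rule UN_I[rotated]) simp
  qed
  fix \<S>
  have "{x. {K\<in>\<Omega>h. x \<in> K} = \<S>} \<in> sets borel"
    by (intro sets_incidence fin borel_closed closed_K)
  from measurable_sets[OF p this] show "p -` {x. {K\<in>\<Omega>h. x \<in> K} = \<S>} \<in> sets borel" by simp
  let ?D = "D \<inter> p -` {x. {K\<in>\<Omega>h. x \<in> K} = \<S>}"
  show "bdd_meas_on ?D (\<lambda>z. F (element_at \<Omega>h (p z)) z)"
  proof (cases "?D = {}")
    case True
    then show ?thesis by (simp only: bdd_meas_on_empty)
  next
    case False
    define K where "K = (SOME K. K \<in> \<S>)"
    have el: "element_at \<Omega>h (p z) = K" if "z \<in> ?D" for z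
      using element_at_piece[of "p z" \<S>] that by (simp add: K_def)
    have K: "K \<in> \<Omega>h" "p z \<in> K" if "z \<in> ?D" for z
      using element_at_in[of "p z"] el[OF that] that D by auto
    have "bdd_meas_on (D \<inter> p -` K) (F K)" using False K(1) by (intro F) auto
    then have "bdd_meas_on ?D (F K)" by (rule bdd_meas_on_subset) (use K(2) in auto)
    then show ?thesis by (rule bdd_meas_on_cong[THEN iffD1, rotated]) (simp add: el)
  qed
qed

lemma bdd_meas_on_boundary_loss: "bdd_meas_on (frontier \<Omega> \<times> I) boundary_loss"
proof -
  have n: "bdd_meas_on (frontier \<Omega> \<times> I) (\<lambda>z. outer_normal \<Omega> (fst z))"
  proof -
    \<comment> \<open>\<open>outer_normal\<close> refers to the closure of its argument only, so the
      result for closed sets carries over to the open domain.\<close>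
    have "bdd_meas_on (frontier \<Omega> \<times> I) (\<lambda>z. outer_normal (closure \<Omega>) (fst z))"
      using bdd_meas_on_fst[OF bdd_meas_on_outer_normal[of "closure \<Omega>"]] frontier_cl by simp
    then show ?thesis by (simp add: outer_normal_def)
  qed
  have "bdd_meas_on (frontier \<Omega> \<times> I) (\<lambda>z. w (element_at \<Omega>h (fst z)) z)"
  proof (rule bdd_meas_on_element_at)
    show "fst ` (frontier \<Omega> \<times> I) \<subseteq> closure \<Omega>" by (auto simp: frontier_def)
    show "fst \<in> borel_measurable borel"
      by (intro borel_measurable_continuous_onI continuous_on_fst continuous_on_id)
    show "bdd_meas_on (frontier \<Omega> \<times> I \<inter> fst -` K) (w K)" if "K \<in> \<Omega>h" for K
      using that by (intro bdd_meas_on_field smooth_w) auto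
  qed
  then have "bdd_meas_on (frontier \<Omega> \<times> I) (\<lambda>z. (outer_normal \<Omega> (fst z) \<times>\<^sub>3 w (element_at \<Omega>h (fst z)) z) \<bullet> (outer_normal \<Omega> (fst z) \<times>\<^sub>3 w (element_at \<Omega>h (fst z)) z))"
    by (intro bdd_meas_on_inner bdd_meas_on_cross n)
  then show ?thesis unfolding boundary_loss_def by (simp add: case_prod_beta' power2_norm_eq_inner)
qed

section \<open>Cancellation in the sum over all elements\<close>

lemma sum_elements_eq:
  assumes "{K\<in>\<Omega>h. Q K} = S"
  shows "(\<Sum>K\<in>\<Omega>h. of_bool (Q K) * g K) = (\<Sum>K\<in>S. g K :: real)"
  unfolding assms[symmetric] using fin
  by (intro sum.mono_neutral_cong_right) auto

text \<open>At a point in general position the sum has a single nonzero term on a boundary face, at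
  most two on an interface and none elsewhere, so that it reduces to \<open>cross3_boundary\<close>
  or \<open>cross3_interface\<close>.\<close>

lemma sum_surface_pointwise:
  assumes P: "P \<in> A" and x: "x \<in> P" "\<forall>Q\<in>A. Q \<noteq> P \<longrightarrow> x \<notin> Q"
  shows "(\<Sum>K\<in>\<Omega>h. indicator (frontier K) x * (flux_term K (x, s) + energy_flux K (x, s))) = indicator (frontier \<Omega>) x * (\<beta> * boundary_loss (x, s))"
proof -
  have ind: "(\<Sum>K\<in>\<Omega>h. indicator (frontier K) x * g K) = (\<Sum>K\<in>S. g K)" if "{K\<in>\<Omega>h. x \<in> frontier K} = S" for g :: "point set \<Rightarrow> real" and S
    using sum_elements_eq[OF that] by (simp add: indicator_def)
  show ?thesis
  proof (cases "x \<in> frontier \<Omega>")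
    case True
    obtain K n where K: "K \<in> \<Omega>h" "{K'\<in>\<Omega>h. x \<in> frontier K'} = {K}" "{K'\<in>\<Omega>h. x \<in> K'} = {K}"
      "halfspace_at K x n" "halfspace_at \<Omega> x n"
      using boundary_point[OF P x True] .
    have el: "element_at \<Omega>h x = K" using element_at_piece[OF K(3)] by simp
    have n: "outer_normal K x = n" "outer_normal \<Omega> x = n" "norm n = 1"
      using K(4,5) outer_normal_eq by (auto simp: halfspace_at_def)
    show ?thesis
      using True cross3_boundary[OF n(3), of "w K (x, s)" "v K (x, s)" \<beta>]
      by (simp add: ind[OF K(2)] flux_term_def energy_flux_def boundary_loss_def flux_E_def flux_H_def el n)
  next
    case False
    show ?thesis
    proof (cases "\<exists>K\<in>\<Omega>h. x \<in> frontier K")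
      case True
      then obtain K where K: "K \<in> \<Omega>h" "x \<in> frontier K" by blast
      obtain K' n where K': "K' \<in> \<Omega>h" "K' \<noteq> K" "{L\<in>\<Omega>h. x \<in> frontier L} = {K, K'}"
        "halfspace_at K x n" "halfspace_at K' x (- n)"
        using interface_point[OF P x K False] .
      have "x \<in> frontier K'" using K'(3) by blast
      then have nb: "neighbour \<Omega>h K x = K'" "neighbour \<Omega>h K' x = K"
        using neighbour_in[OF K False] neighbour_in[OF K'(1) _ False] K'(2,3) by blast+
      have n: "outer_normal K x = n" "outer_normal K' x = - n"
        using K'(4,5) outer_normal_eq by auto
      have "(\<Sum>K\<in>\<Omega>h. indicator (frontier K) x * (flux_term K (x, s) + energy_flux K (x, s)))
        = (flux_term K (x, s) + energy_flux K (x, s)) + (flux_term K' (x, s) + energy_flux K' (x, s))"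
        using K'(2) by (simp only: ind[OF K'(3)]) (simp)
      also have "\<dots> = 0"
        using cross3_interface[of n "w K (x, s)" "w K' (x, s)" "v K (x, s)" "v K' (x, s)"] False
        by (simp only: flux_term_def energy_flux_def flux_E_def flux_H_def average_def nb n case_prod_conv fst_conv if_False)
      finally show ?thesis using False by simp
    next
      case none: False
      then have "(\<Sum>K\<in>\<Omega>h. indicator (frontier K) x * (flux_term K (x, s) + energy_flux K (x, s))) = 0"
        by (intro sum.neutral) (auto simp: indicator_def)
      then show ?thesis using False by simp
    qed
  qed
qed

text \<open>The cancellation is between terms of different elements, so on each plane the sum over
  the elements is first brought under one integral and then evaluated almost everywhere.\<close>

lemma sum_surface:
  "(\<Sum>K\<in>\<Omega>h. \<Sum>P\<in>A. LINT z:(frontier K \<times> I)|plane_time P. flux_term K z) +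
   (\<Sum>K\<in>\<Omega>h. \<Sum>P\<in>A. LINT z:(frontier K \<times> I)|plane_time P. energy_flux K z)
   = \<beta> * (\<Sum>P\<in>A. LINT z:(frontier \<Omega> \<times> I)|plane_time P. boundary_loss z)"
proof -
  have bF: "bounded (frontier K)" "frontier K \<in> sets borel" if "K \<in> \<Omega>h" for K
    using compact_imp_bounded[OF compact_frontier[OF compact_K[OF that]]] by (auto intro: borel_closed frontier_closed)
  have iX: "set_integrable (plane_time P) (frontier K \<times> I) (flux_term K)"
    and iY: "set_integrable (plane_time P) (frontier K \<times> I) (energy_flux K)" if "P \<in> A" "K \<in> \<Omega>h" for P K
    using that planes by (intro set_integrable_plane_time bF bdd_meas_on_flux_term bdd_meas_on_energy_flux; simp)+
  have bfr: "bounded (frontier \<Omega>)" "frontier \<Omega> \<in> sets borel"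
    using bounded_\<Omega> bounded_subset[of "closure \<Omega>" "frontier \<Omega>"] by (auto simp: frontier_def intro: borel_closed)
  have iR: "set_integrable (plane_time P) (frontier \<Omega> \<times> I) boundary_loss" if "P \<in> A" for P
    using that planes by (intro set_integrable_plane_time bfr bdd_meas_on_boundary_loss) simp
  have eq: "(\<Sum>K\<in>\<Omega>h. (LINT z:(frontier K \<times> I)|plane_time P. flux_term K z) + (LINT z:(frontier K \<times> I)|plane_time P. energy_flux K z))
    = \<beta> * (LINT z:(frontier \<Omega> \<times> I)|plane_time P. boundary_loss z)" if P: "P \<in> A" for P
  proof -
    let ?g = "\<lambda>K z. indicator (frontier K \<times> I) z *\<^sub>R (flux_term K z + energy_flux K z)"
    have ig: "integrable (plane_time P) (?g K)" if "K \<in> \<Omega>h" for K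
      using set_integral_add(1)[OF iX[OF P that] iY[OF P that]] by (simp add: set_integrable_def)
    have "(\<Sum>K\<in>\<Omega>h. (LINT z:(frontier K \<times> I)|plane_time P. flux_term K z) + (LINT z:(frontier K \<times> I)|plane_time P. energy_flux K z))
      = (\<Sum>K\<in>\<Omega>h. LINT z|plane_time P. ?g K z)"
      using iX[OF P] iY[OF P] by (intro sum.cong refl) (simp add: set_integral_add(2)[symmetric] set_lebesgue_integral_def[of _ _ "\<lambda>z. flux_term _ z + energy_flux _ z"])
    also have "\<dots> = (LINT z|plane_time P. (\<Sum>K\<in>\<Omega>h. ?g K z))"
      using ig by (rule Bochner_Integration.integral_sum[symmetric])
    also have "\<dots> = (LINT z|plane_time P. \<beta> * (indicator (frontier \<Omega> \<times> I) z *\<^sub>R boundary_loss z))"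
    proof (rule integral_cong_AE)
      show "(\<lambda>z. \<Sum>K\<in>\<Omega>h. ?g K z) \<in> borel_measurable (plane_time P)"
        using ig by (intro borel_measurable_sum) auto
      show "(\<lambda>z. \<beta> * (indicator (frontier \<Omega> \<times> I) z *\<^sub>R boundary_loss z)) \<in> borel_measurable (plane_time P)"
        using iR[OF P] by (intro borel_measurable_times) (auto simp: set_integrable_def)
      have "AE x in plane_area P. x \<in> P \<and> (\<forall>Q\<in>A. Q \<noteq> P \<longrightarrow> x \<notin> Q)"
        using planes P by (intro AE_plane_area_only finA) auto
      from AE_plane_time_fst[OF this]
      show "AE z in plane_time P. (\<Sum>K\<in>\<Omega>h. ?g K z) = \<beta> * (indicator (frontier \<Omega> \<times> I) z *\<^sub>R boundary_loss z)"
      proof eventually_elim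
        case (elim z)
        obtain x s where z: "z = (x, s)" by (cases z)
        have "(\<Sum>K\<in>\<Omega>h. ?g K z) = indicator I s * (\<Sum>K\<in>\<Omega>h. indicator (frontier K) x * (flux_term K (x, s) + energy_flux K (x, s)))"
          unfolding sum_distrib_left by (intro sum.cong refl) (simp add: z indicator_times)
        also have "(\<Sum>K\<in>\<Omega>h. indicator (frontier K) x * (flux_term K (x, s) + energy_flux K (x, s))) = indicator (frontier \<Omega>) x * (\<beta> * boundary_loss (x, s))"
          using elim z by (intro sum_surface_pointwise[OF P]) auto
        finally show ?case by (simp add: z indicator_times)
      qed
    qed
    also have "\<dots> = \<beta> * (LINT z:(frontier \<Omega> \<times> I)|plane_time P. boundary_loss z)"
      unfolding set_lebesgue_integral_def by simp
    finally show ?thesis .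
  qed
  show ?thesis
    unfolding sum.swap[of _ A \<Omega>h] sum.distrib[symmetric] sum_distrib_left
    by (intro sum.cong refl eq)
qed

text \<open>Off the planes, a point of the domain lies in exactly one element, so the choice in
  \<open>element_at\<close> is forced there, and the integral over the open domain splits into
  integrals over the closed elements.\<close>

lemma L2_norm_weighted_trace:
  assumes u: "\<And>K. K \<in> \<Omega>h \<Longrightarrow> smooth_on (K \<times> I) (u K)" and s: "s \<in> I" and c: "\<And>K. K \<in> \<Omega>h \<Longrightarrow> c K > 0"
  shows "(L2_norm_on \<Omega> (weighted_trace \<Omega>h c u s))\<^sup>2 = (\<Sum>K\<in>\<Omega>h. c K * (LINT x:K|lborel. u K (x, s) \<bullet> u K (x, s)))"
proof -
  let ?f = "\<lambda>x. (norm (weighted_trace \<Omega>h c u s x))\<^sup>2"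
  let ?g = "\<lambda>K x. indicator K x *\<^sub>R (c K * (u K (x, s) \<bullet> u K (x, s)))"
  have cont: "continuous_on K (\<lambda>x. u K (x, s))" if "K \<in> \<Omega>h" for K
    using s by (intro continuous_on_compose2[OF smooth_onD(1)[OF u[OF that]]] continuous_intros) auto
  have ig: "integrable lborel (?g K)" if "K \<in> \<Omega>h" for K
    using compact_K that by (intro borel_integrable_compact continuous_intros cont)
  have \<Omega>b: "\<Omega> \<in> sets borel" using open_\<Omega> by simp
  have wt: "?f x = c (element_at \<Omega>h x) * (u (element_at \<Omega>h x) (x, s) \<bullet> u (element_at \<Omega>h x) (x, s))" if "x \<in> \<Omega>" for x
    using element_at_in[of x] closure_subset[of \<Omega>] that c[of "element_at \<Omega>h x"]
    by (auto simp: weighted_trace_def Let_def power_mult_distrib power2_norm_eq_inner)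
  \<comment> \<open>Because of the choice in \<open>element_at\<close>, the measurability required
    for comparing the two integrands almost everywhere needs an argument of its own.\<close>
  have "bdd_meas_on \<Omega> (\<lambda>x. c (element_at \<Omega>h x) * (u (element_at \<Omega>h x) (x, s) \<bullet> u (element_at \<Omega>h x) (x, s)))"
  proof (rule bdd_meas_on_element_at[where p="\<lambda>x. x" and F="\<lambda>K x. c K * (u K (x, s) \<bullet> u K (x, s))"])
    show "(\<lambda>x. x) ` \<Omega> \<subseteq> closure \<Omega>" using closure_subset by auto
    fix K assume K: "K \<in> \<Omega>h"
    have "bdd_meas_on K (\<lambda>x. c K * (u K (x, s) \<bullet> u K (x, s)))"
      by (intro bdd_meas_on_continuous compact_K K continuous_intros cont)
    then show "bdd_meas_on (\<Omega> \<inter> (\<lambda>x. x) -` K) (\<lambda>x. c K * (u K (x, s) \<bullet> u K (x, s)))"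
      by (rule bdd_meas_on_subset) auto
  qed simp
  then have "bdd_meas_on \<Omega> ?f" by (rule bdd_meas_on_cong[THEN iffD1, rotated]) (simp add: wt)
  then have meas: "(\<lambda>x. indicator \<Omega> x *\<^sub>R ?f x) \<in> borel_measurable borel"
    using \<Omega>b by (rule bdd_meas_on_indicator)
  have "(L2_norm_on \<Omega> (weighted_trace \<Omega>h c u s))\<^sup>2 = (LINT x:\<Omega>|lborel. ?f x)"
    unfolding L2_norm_on_def set_lebesgue_integral_def by (intro real_sqrt_pow2 integral_nonneg) simp
  also have "\<dots> = (LINT x|lborel. (\<Sum>K\<in>\<Omega>h. ?g K x))"
    unfolding set_lebesgue_integral_def
  proof (rule integral_cong_AE)
    show "(\<lambda>x. \<Sum>K\<in>\<Omega>h. ?g K x) \<in> borel_measurable lborel" using ig by (intro borel_measurable_sum) auto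
    show "AE x in lborel. indicator \<Omega> x *\<^sub>R ?f x = (\<Sum>K\<in>\<Omega>h. ?g K x)"
      using AE_lborel_planes[OF finA planes]
    proof eventually_elim
      case (elim x)
      show ?case
      proof (cases "x \<in> \<Omega>")
        case True
        define K where "K = element_at \<Omega>h x"
        have K: "K \<in> \<Omega>h" "x \<in> K" using element_at_in[of x] closure_subset True by (auto simp: K_def)
        have "x \<notin> frontier K" using elim frontier_K[OF K(1)] by blast
        then have "x \<in> interior K" using K closed_K by (simp add: frontier_def)
        then have "{K'\<in>\<Omega>h. x \<in> K'} = {K}" using interior_unique K by blast
        from sum_elements_eq[OF this, of "\<lambda>K. c K * (u K (x, s) \<bullet> u K (x, s))"]
        have "(\<Sum>K\<in>\<Omega>h. ?g K x) = c K * (u K (x, s) \<bullet> u K (x, s))" by (simp add: indicator_def)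
        then show ?thesis using True wt[OF True] by (simp add: K_def)
      next
        case False
        moreover have "x \<notin> frontier \<Omega>" using elim frontier_\<Omega> by blast
        ultimately have "x \<notin> closure \<Omega>" by (simp add: frontier_def interior_open open_\<Omega>)
        then have "x \<notin> K" if "K \<in> \<Omega>h" for K using union that by blast
        then have "(\<Sum>K\<in>\<Omega>h. ?g K x) = 0" by (intro sum.neutral) (auto simp: indicator_def)
        then show ?thesis using False by simp
      qed
    qed
  qed (use meas in simp)
  also have "\<dots> = (\<Sum>K\<in>\<Omega>h. LINT x|lborel. ?g K x)"
    using ig by (rule Bochner_Integration.integral_sum)
  also have "\<dots> = (\<Sum>K\<in>\<Omega>h. c K * (LINT x:K|lborel. u K (x, s) \<bullet> u K (x, s)))"
    unfolding set_lebesgue_integral_def by (intro sum.cong refl) (simp add: mult.left_commute)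
  finally show ?thesis .
qed

section \<open>The energy identity\<close>

text \<open>The initial terms turn half the difference of the energies at the two ends into half
  their sum. The surface terms leave \<open>\<beta>\<close> times the boundary integral, which is
  matched by the factor 2 in front of \<open>\<beta>\<close> in the norm.\<close>

lemma dg_form_eq_half_norm:
  assumes \<epsilon>: "\<And>K. K \<in> \<Omega>h \<Longrightarrow> \<epsilon> K > 0" and \<mu>: "\<And>K. K \<in> \<Omega>h \<Longrightarrow> \<mu> K > 0"
  shows "dg_form \<Omega> \<Omega>h \<epsilon> \<mu> \<beta> a b v w v w = 1 / 2 * dg_norm_sq \<Omega> \<Omega>h \<epsilon> \<mu> \<beta> a b v w"
proof -
  define q where "q u s K = (LINT x:K|lborel. u K (x, s) \<bullet> u K (x, s))" for u :: field and s K
  have aI: "a \<in> I" and bI: "b \<in> I" using ab by auto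
  have vol: "(\<Sum>K\<in>\<Omega>h. let D = K \<times> {a..b} in LINT z:D|lborel.
        (\<epsilon> K *\<^sub>R dt D (v K) z - curl D (w K) z) \<bullet> v K z + (\<mu> K *\<^sub>R dt D (w K) z + curl D (v K) z) \<bullet> w K z)
    = (\<Sum>K\<in>\<Omega>h. \<epsilon> K * (q v b K - q v a K) / 2 + \<mu> K * (q w b K - q w a K) / 2
        + (\<Sum>P\<in>A. LINT z:(frontier K \<times> I)|plane_time P. energy_flux K z))"
    unfolding Let_def q_def energy_flux_def
    by (intro sum.cong refl set_integral_element compact_K regular_K finA planes frontier_K ab smooth_v smooth_w)
  have init: "(LINT x:K|lborel. \<epsilon> K * (v K (x, a) \<bullet> v K (x, a)) + \<mu> K * (w K (x, a) \<bullet> w K (x, a)))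
    = \<epsilon> K * q v a K + \<mu> K * q w a K" if K: "K \<in> \<Omega>h" for K
  proof -
    have "set_integrable lborel K (\<lambda>x. e * (u K (x, a) \<bullet> u K (x, a)))" if "smooth_on (K \<times> I) (u K)" for u :: field and e :: real
    proof -
      have "continuous_on K (\<lambda>x. u K (x, a))"
        using aI by (intro continuous_on_compose2[OF smooth_onD(1)[OF that]] continuous_intros) auto
      then show ?thesis unfolding set_integrable_def
        by (intro borel_integrable_compact compact_K K continuous_intros)
    qed
    from this[of v, OF smooth_v[OF K]] this[of w, OF smooth_w[OF K]] show ?thesis
      by (simp add: set_integral_add(2) q_def)
  qed
  have surf: "(\<Sum>K\<in>\<Omega>h. surface_time_integral (frontier K) {a..b} (\<lambda>(x, s).
        (outer_normal K x \<times>\<^sub>3 (w K (x, s) - flux_H \<Omega> \<Omega>h w K (x, s))) \<bullet> v K (x, s) -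
        (outer_normal K x \<times>\<^sub>3 (v K (x, s) - flux_E \<Omega> \<Omega>h \<beta> v w K (x, s))) \<bullet> w K (x, s)))
    = (\<Sum>K\<in>\<Omega>h. \<Sum>P\<in>A. LINT z:(frontier K \<times> I)|plane_time P. flux_term K z)"
    unfolding flux_term_def[symmetric]
    by (intro sum.cong refl surface_time_integral_planes finA planes frontier_K frontier_closed)
  have "(L2_norm_surface_time (frontier \<Omega>) {a..b} (\<lambda>(x, s). outer_normal \<Omega> x \<times>\<^sub>3 w (element_at \<Omega>h x) (x, s)))\<^sup>2
    = (sqrt (surface_time_integral (frontier \<Omega>) {a..b} boundary_loss))\<^sup>2"
    unfolding L2_norm_surface_time_def boundary_loss_def by (simp add: case_prod_beta')
  also have "surface_time_integral (frontier \<Omega>) {a..b} boundary_loss = (\<Sum>P\<in>A. LINT z:(frontier \<Omega> \<times> I)|plane_time P. boundary_loss z)"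
    by (intro surface_time_integral_planes finA planes frontier_\<Omega> frontier_closed)
  also have "(sqrt \<dots>)\<^sup>2 = \<dots>"
    unfolding set_lebesgue_integral_def
    by (intro real_sqrt_pow2 sum_nonneg integral_nonneg) (simp add: boundary_loss_def case_prod_beta')
  finally have bdry: "(L2_norm_surface_time (frontier \<Omega>) {a..b} (\<lambda>(x, s). outer_normal \<Omega> x \<times>\<^sub>3 w (element_at \<Omega>h x) (x, s)))\<^sup>2
    = (\<Sum>P\<in>A. LINT z:(frontier \<Omega> \<times> I)|plane_time P. boundary_loss z)" .
  have norms: "(L2_norm_on \<Omega> (weighted_trace \<Omega>h \<epsilon> v s))\<^sup>2 = (\<Sum>K\<in>\<Omega>h. \<epsilon> K * q v s K)"
    "(L2_norm_on \<Omega> (weighted_trace \<Omega>h \<mu> w s))\<^sup>2 = (\<Sum>K\<in>\<Omega>h. \<mu> K * q w s K)" if "s \<in> I" for s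
    unfolding q_def by (rule L2_norm_weighted_trace; use smooth_v smooth_w that \<epsilon> \<mu> in simp)+
  have "dg_form \<Omega> \<Omega>h \<epsilon> \<mu> \<beta> a b v w v w
    = (\<Sum>K\<in>\<Omega>h. \<epsilon> K * (q v b K - q v a K) / 2 + \<mu> K * (q w b K - q w a K) / 2
        + (\<Sum>P\<in>A. LINT z:(frontier K \<times> I)|plane_time P. energy_flux K z))
    + (\<Sum>K\<in>\<Omega>h. \<epsilon> K * q v a K + \<mu> K * q w a K)
    + (\<Sum>K\<in>\<Omega>h. \<Sum>P\<in>A. LINT z:(frontier K \<times> I)|plane_time P. flux_term K z)"
    unfolding dg_form_def vol surf by (simp add: init)
  also have "\<dots> = (\<Sum>K\<in>\<Omega>h. (\<epsilon> K * q v b K + \<mu> K * q w b K + \<epsilon> K * q v a K + \<mu> K * q w a K) / 2)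
    + \<beta> * (\<Sum>P\<in>A. LINT z:(frontier \<Omega> \<times> I)|plane_time P. boundary_loss z)"
  proof -
    \<comment> \<open>Here \<open>y\<close> and \<open>x\<close> stand for the integrals of
      \<open>energy_flux\<close> and \<open>flux_term\<close>, so the rearrangement involves only
      sums of real numbers.\<close>
    have "(\<Sum>K\<in>\<Omega>h. \<epsilon> K * (q v b K - q v a K) / 2 + \<mu> K * (q w b K - q w a K) / 2 + y K)
        + (\<Sum>K\<in>\<Omega>h. \<epsilon> K * q v a K + \<mu> K * q w a K) + (\<Sum>K\<in>\<Omega>h. x K)
      = (\<Sum>K\<in>\<Omega>h. (\<epsilon> K * q v b K + \<mu> K * q w b K + \<epsilon> K * q v a K + \<mu> K * q w a K) / 2)
        + ((\<Sum>K\<in>\<Omega>h. x K) + (\<Sum>K\<in>\<Omega>h. y K))" for x y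
      unfolding sum.distrib[symmetric] by (intro sum.cong refl) (simp add: field_simps)
    then show ?thesis unfolding sum_surface[symmetric] .
  qed
  also have "\<dots> = 1 / 2 * dg_norm_sq \<Omega> \<Omega>h \<epsilon> \<mu> \<beta> a b v w"
    unfolding dg_norm_sq_def bdry norms[OF aI] norms[OF bI]
    by (simp add: sum.distrib sum_divide_distrib[symmetric] add_divide_distrib)
  finally show ?thesis .
qed

end

section \<open>Polyhedral partitions as meshes\<close>

lemma polyhedral_frontier_planes:
  assumes "polyhedral_lipschitz_domain U"
  obtains A where "finite A" "\<forall>P\<in>A. is_plane P" "frontier (closure U) \<subseteq> \<Union>A"
proof -
  obtain \<P> where "finite \<P>" "\<forall>P\<in>\<P>. polytope P" "closure U = \<Union>\<P>"
    using assms unfolding polyhedral_lipschitz_domain_def by blast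
  then show ?thesis using frontier_Union_polytopes_subset_planes[of \<P>] that by metis
qed

text \<open>The family unites the planes of the domain with those of all elements. Polytopes control
  the boundary of a closure; for the open domain, the Lipschitz condition identifies this with its
  own boundary.\<close>

lemma mesh_polyhedral_partition:
  assumes \<Omega>: "polyhedral_lipschitz_domain \<Omega>" and part: "polyhedral_partition \<Omega> \<Omega>h"
  obtains A where "mesh \<Omega> \<Omega>h A"
proof -
  have op: "open \<Omega>" "lipschitz_boundary \<Omega>" using \<Omega> by (auto simp: polyhedral_lipschitz_domain_def)
  have el: "polyhedral_lipschitz_domain (interior K)" "closure (interior K) = K" if "K \<in> \<Omega>h" for K
    using part that by (auto simp: polyhedral_partition_def polyhedral_element_def)
  have "\<exists>A. finite A \<and> (\<forall>P\<in>A. is_plane P) \<and> frontier K \<subseteq> \<Union>A" if "K \<in> \<Omega>h" for K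
    using polyhedral_frontier_planes[OF el(1)[OF that]] el(2)[OF that] by metis
  then obtain B where B: "\<And>K. K \<in> \<Omega>h \<Longrightarrow> finite (B K) \<and> (\<forall>P\<in>B K. is_plane P) \<and> frontier K \<subseteq> \<Union>(B K)" by metis
  obtain B0 where B0: "finite B0" "\<forall>P\<in>B0. is_plane P" "frontier \<Omega> \<subseteq> \<Union>B0"
    using polyhedral_frontier_planes[OF \<Omega>] frontier_closure_lipschitz[OF op] by metis
  have fin: "finite \<Omega>h" "\<Union>\<Omega>h = closure \<Omega>" using part by (auto simp: polyhedral_partition_def)
  have "mesh \<Omega> \<Omega>h (B0 \<union> \<Union>(B ` \<Omega>h))"
  proof
    show "open \<Omega>" "interior (closure \<Omega>) = \<Omega>" using op interior_closure_lipschitz by auto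
    show "finite \<Omega>h" "\<Union>\<Omega>h = closure \<Omega>" by fact+
    show "compact K" if "K \<in> \<Omega>h" for K
      using el[OF that] by (metis polyhedral_lipschitz_domain_def compact_closure)
    show "regular_closed K" if "K \<in> \<Omega>h" for K using el(2)[OF that] by (simp add: regular_closed_def)
    show "interior K \<inter> interior K' = {}" if "K \<in> \<Omega>h" "K' \<in> \<Omega>h" "K \<noteq> K'" for K K'
      using part that by (auto simp: polyhedral_partition_def)
    show "finite (B0 \<union> \<Union>(B ` \<Omega>h))" "\<forall>P\<in>B0 \<union> \<Union>(B ` \<Omega>h). is_plane P" using B B0 fin by auto
    show "frontier K \<subseteq> \<Union>(B0 \<union> \<Union>(B ` \<Omega>h))" if "K \<in> \<Omega>h" for K using B[OF that] that by blast
    show "frontier \<Omega> \<subseteq> \<Union>(B0 \<union> \<Union>(B ` \<Omega>h))" using B0 by blast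
  qed
  then show ?thesis by (rule that)
qed

theorem theorem4:
  fixes \<Omega> :: "point set" and \<Omega>h :: "point set set"
    and \<epsilon> \<mu> :: "point set \<Rightarrow> real" and \<beta> T :: real
    and t :: "nat \<Rightarrow> real" and n N :: nat
    and V :: "(field \<times> field) set"
  assumes "polyhedral_lipschitz_domain \<Omega>"
    and "polyhedral_partition \<Omega> \<Omega>h"
    and "\<And>K. K \<in> \<Omega>h \<Longrightarrow> \<epsilon> K > 0" and "\<And>K. K \<in> \<Omega>h \<Longrightarrow> \<mu> K > 0" and "\<beta> \<ge> 0"
    and "t 0 = 0" and "strict_mono_on {0..N} t" and "t N = T"
    and "1 \<le> n" and "n \<le> N"
    and "piecewise_smooth_space \<Omega>h {t (n - 1)..t n} V"
  shows "\<forall>(v, w)\<in>V. dg_form \<Omega> \<Omega>h \<epsilon> \<mu> \<beta> (t (n - 1)) (t n) v w v w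
           \<ge> 1 / 2 * dg_norm_sq \<Omega> \<Omega>h \<epsilon> \<mu> \<beta> (t (n - 1)) (t n) v w"
proof clarify
  fix v w assume "(v, w) \<in> V"
  then have smooth: "piecewise_smooth \<Omega>h {t (n - 1)..t n} v" "piecewise_smooth \<Omega>h {t (n - 1)..t n} w"
    using assms(11) by (auto simp: piecewise_smooth_space_def)
  obtain A where "mesh \<Omega> \<Omega>h A" using mesh_polyhedral_partition[OF assms(1,2)] .
  \<comment> \<open>\<open>n - 1\<close> is a truncated difference, so \<open>1 \<le> n\<close> is
    what makes it an earlier index.\<close>
  moreover have "t (n - 1) < t n"
    using strict_mono_onD[OF assms(7), of "n - 1" n] assms(9,10) by auto
  ultimately interpret mesh_fields \<Omega> \<Omega>h A "t (n - 1)" "t n" v w \<beta>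
    using smooth by (auto simp: mesh_fields_def mesh_fields_axioms_def piecewise_smooth_def)
  show "dg_form \<Omega> \<Omega>h \<epsilon> \<mu> \<beta> (t (n - 1)) (t n) v w v w \<ge> 1 / 2 * dg_norm_sq \<Omega> \<Omega>h \<epsilon> \<mu> \<beta> (t (n - 1)) (t n) v w"
    using dg_form_eq_half_norm[OF assms(3,4)] by simp
qed

end
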